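(* Let $((M,\nabla),h)$ be a Hessian manifold of Koszul type. Then $((M,\nabla^* ),h)$ is a radiant Hessian manifold. In fact, if $\eta$ is a $1$-form potential of $((M,\nabla),h)$, then $\eta^\sharp$ is an Euler vector field of $(M,\nabla^* )$, where $\sharp$ is the musical isomorphism with respect to $h$.
   Context: An affine manifold $(M,\nabla)$ is a connected smooth manifold $M$ without boundary with a flat and torsion-free connection $\nabla$ on its tangent bundle. A Hessian metric on $(M,\nabla)$ is a Riemannian metric $h$ on $M$ such that every point has an open neighbourhood $U$ and a function $f\in C^\infty(U)$ with $h|_U=\nabla(df)$; then $((M,\nabla),h)$ is called a Hessian manifold. It is of Koszul type if there is a global $1$-form $\eta\in\Omega^1(M)$ with $h=\nabla\eta$; such an $\eta$ is called a $1$-form potential. The conjugate connection $\nabla^*$ of $\nabla$ with respect to $h$ is the unique connection on $TM$ with $Zh(X,Y)=h(\nabla_ZX,Y)+h(X,\nabla^*_ZY)$ for all vector fields $X,Y,Z$. An Euler vector field of $(M,\nabla)$ is a vector field $H$ with $\nabla_XH=X$ for every vector field $X$; an affine manifold is radiant if it admits an Euler vector field, and a Hessian manifold is radiant if its underlying affine manifold is. *)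

theory Defs
  imports "HOL-Analysis.Analysis"
begin

section \<open>Model spaces\<close>

text \<open>
  Manifolds are modelled on types of sort \<open>{real_inner, heine_borel}\<close>. By the following lemma these
  are exactly the finite-dimensional Euclidean spaces. Unlike \<open>euclidean_space\<close>, this sort
  also admits the zero space, hence zero-dimensional manifolds.
\<close>

lemma model_space_finite_dimensional:
  "\<exists>B :: 'e::{real_inner, heine_borel} set. finite B \<and> span B = UNIV"
proof -
  have "compact (cball (0::'e) 1)"
    by (rule compact_cball)
  then obtain F where F: "finite F" "cball (0::'e) 1 \<subseteq> (\<Union>x\<in>F. ball x (1/2))"
  proof -
    have "\<exists>k. finite k \<and> cball (0::'e) 1 \<subseteq> (\<Union>x\<in>k. ball x (1/2))"
      using \<open>compact (cball (0::'e) 1)\<close>[unfolded compact_eq_totally_bounded] by simp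
    then show thesis
      using that by blast
  qed
  obtain C where C: "finite C" "span C = span F" "pairwise orthogonal C"
    using basis_orthogonal[OF F(1)] by blast
  have "x \<in> span F" for x :: 'e
  proof (rule ccontr)
    assume x: "x \<notin> span F"
    define p where "p = (\<Sum>c\<in>C. ((x \<bullet> c) / (c \<bullet> c)) *\<^sub>R c)"
    have "p \<in> span F"
      unfolding p_def C(2)[symmetric] by (intro span_sum span_scale span_base)
    then have nz: "x - p \<noteq> 0"
      using x by auto
    have orthC: "(x - p) \<bullet> c = 0" if "c \<in> C" for c
    proof -
      have "p \<bullet> c = (\<Sum>d\<in>C. ((x \<bullet> d) / (d \<bullet> d)) * (d \<bullet> c))"
        by (simp add: p_def inner_sum_left)
      also have "\<dots> = (\<Sum>d\<in>C. if d = c then x \<bullet> c else 0)"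
        using C(3) that by (intro sum.cong) (auto simp: pairwise_def orthogonal_def)
      also have "\<dots> = x \<bullet> c"
        using C(1) that by simp
      finally show ?thesis
        by (simp add: inner_diff_left)
    qed
    have orth: "(x - p) \<bullet> y = 0" if "y \<in> span F" for y
      using orthogonal_to_span[of y C "x - p"] that orthC C(2) by (auto simp: orthogonal_def)
    define u where "u = (x - p) /\<^sub>R norm (x - p)"
    have nu: "norm u = 1"
      using nz by (simp add: u_def)
    then obtain y where y: "y \<in> F" "dist y u < 1/2"
    proof -
      have "u \<in> cball 0 1"
        using nu by simp
      then have "u \<in> (\<Union>x\<in>F. ball x (1/2))"
        using F(2) by (rule set_mp[rotated])
      then show thesis
        using that by auto
    qed
    have uy: "u \<bullet> y = 0"
      using orth[of y] y(1) by (simp add: u_def span_base)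
    have "(norm (u - y))\<^sup>2 = (norm u)\<^sup>2 + (norm y)\<^sup>2"
      using uy by (simp add: power2_norm_eq_inner inner_diff_left inner_diff_right inner_commute[of y u])
    then have "1 \<le> (norm (u - y))\<^sup>2"
      using nu by simp
    moreover have "norm (u - y) < 1/2"
      using y(2) by (simp add: dist_norm norm_minus_commute)
    ultimately show False
      using power_mono[of "norm (u - y)" "1/2" 2] by (simp add: power2_eq_square)
  qed
  then show ?thesis
    using F(1) by blast
qed

section \<open>Smooth functions and smooth manifolds\<close>

text \<open>Meaningful for open \<open>S\<close>: all iterated directional derivatives of order at most \<open>k\<close>
  exist and are continuous.\<close>

primrec k_smooth_on :: "nat \<Rightarrow> 'a::real_normed_vector set \<Rightarrow> ('a \<Rightarrow> 'b::real_normed_vector) \<Rightarrow> bool" where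
  "k_smooth_on 0 S f \<longleftrightarrow> continuous_on S f"
| "k_smooth_on (Suc k) S f \<longleftrightarrow> (\<forall>x\<in>S. f differentiable (at x)) \<and>
     (\<forall>v. k_smooth_on k S (\<lambda>x. frechet_derivative f (at x) v))"

definition smooth_on :: "'a::real_normed_vector set \<Rightarrow> ('a \<Rightarrow> 'b::real_normed_vector) \<Rightarrow> bool" where
  "smooth_on S f \<longleftrightarrow> (\<forall>k. k_smooth_on k S f)"

type_synonym ('m, 'e) atlas = "('m set \<times> ('m \<Rightarrow> 'e)) set"

text \<open>The manifold is the whole type \<open>'m\<close>. An atlas need not be maximal.\<close>

definition smooth_manifold ::
    "('m::{t2_space, second_countable_topology}, 'e::{real_inner, heine_borel}) atlas \<Rightarrow> bool" where
  "smooth_manifold A \<longleftrightarrow>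
     (\<Union>(U, \<phi>)\<in>A. U) = UNIV \<and>
     (\<forall>(U, \<phi>)\<in>A. open U \<and> open (\<phi> ` U) \<and> homeomorphism U (\<phi> ` U) \<phi> (inv_into U \<phi>)) \<and>
     (\<forall>(U, \<phi>)\<in>A. \<forall>(V, \<psi>)\<in>A. smooth_on (\<phi> ` (U \<inter> V)) (\<psi> \<circ> inv_into U \<phi>))"

text \<open>\<open>f \<in> C\<^sup>\<infinity>(U)\<close>, for open \<open>U\<close>; values of \<open>f\<close> off \<open>U\<close> are irrelevant.\<close>

definition smooth_fun ::
    "('m::topological_space, 'e::real_normed_vector) atlas \<Rightarrow> 'm set \<Rightarrow> ('m \<Rightarrow> real) \<Rightarrow> bool" where
  "smooth_fun A U f \<longleftrightarrow> (\<forall>(V, \<phi>)\<in>A. smooth_on (\<phi> ` (U \<inter> V)) (f \<circ> inv_into V \<phi>))"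

definition smooth_near ::
    "('m::topological_space, 'e::real_normed_vector) atlas \<Rightarrow> 'm \<Rightarrow> ('m \<Rightarrow> real) \<Rightarrow> bool" where
  "smooth_near A p f \<longleftrightarrow> (\<exists>U. open U \<and> p \<in> U \<and> smooth_fun A U f)"

section \<open>Tangent vectors and vector fields\<close>

text \<open>
  Tangent vectors at \<open>p\<close> are derivations of the algebra of germs at \<open>p\<close> of smooth functions.
  They are set to \<open>0\<close> on functions that are not smooth near \<open>p\<close>, so that two tangent vectors
  (and two vector fields) are equal as soon as they agree on smooth germs.
\<close>

type_synonym 'm tangent_vector = "('m \<Rightarrow> real) \<Rightarrow> real"
type_synonym 'm vector_field = "'m \<Rightarrow> 'm tangent_vector"
type_synonym 'm one_form = "'m \<Rightarrow> 'm tangent_vector \<Rightarrow> real"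
type_synonym 'm bilinear_field = "'m \<Rightarrow> 'm tangent_vector \<Rightarrow> 'm tangent_vector \<Rightarrow> real"
type_synonym 'm covariant_derivative = "'m vector_field \<Rightarrow> 'm vector_field \<Rightarrow> 'm vector_field"

definition tangent_space ::
    "('m::topological_space, 'e::real_normed_vector) atlas \<Rightarrow> 'm \<Rightarrow> 'm tangent_vector set" where
  "tangent_space A p = {v.
     (\<forall>f g. smooth_near A p f \<longrightarrow> smooth_near A p g \<longrightarrow>
        v (\<lambda>q. f q + g q) = v f + v g \<and>
        v (\<lambda>q. f q * g q) = v f * g p + f p * v g) \<and>
     (\<forall>c f. smooth_near A p f \<longrightarrow> v (\<lambda>q. c * f q) = c * v f) \<and>
     (\<forall>f g. smooth_near A p f \<longrightarrow> smooth_near A p g \<longrightarrow>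
        (\<forall>\<^sub>F q in nhds p. f q = g q) \<longrightarrow> v f = v g) \<and>
     (\<forall>f. \<not> smooth_near A p f \<longrightarrow> v f = 0)}"

definition vector_fields ::
    "('m::topological_space, 'e::real_normed_vector) atlas \<Rightarrow> 'm vector_field set" where
  "vector_fields A = {X.
     (\<forall>p. X p \<in> tangent_space A p) \<and>
     (\<forall>U f. open U \<longrightarrow> smooth_fun A U f \<longrightarrow> smooth_fun A U (\<lambda>p. X p f))}"

definition vf_add :: "'m vector_field \<Rightarrow> 'm vector_field \<Rightarrow> 'm vector_field" where
  "vf_add X Y = (\<lambda>p f. X p f + Y p f)"

definition vf_scale :: "('m \<Rightarrow> real) \<Rightarrow> 'm vector_field \<Rightarrow> 'm vector_field" where
  "vf_scale g X = (\<lambda>p f. g p * X p f)"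

definition lie_bracket ::
    "('m::topological_space, 'e::real_normed_vector) atlas \<Rightarrow>
     'm vector_field \<Rightarrow> 'm vector_field \<Rightarrow> 'm vector_field" where
  "lie_bracket A X Y = (\<lambda>p f.
     if smooth_near A p f then X p (\<lambda>q. Y q f) - Y p (\<lambda>q. X q f) else 0)"

section \<open>Forms and Riemannian metrics\<close>

definition one_forms ::
    "('m::topological_space, 'e::real_normed_vector) atlas \<Rightarrow> 'm one_form set" where
  "one_forms A = {\<eta>.
     (\<forall>p. \<forall>v\<in>tangent_space A p. \<forall>w\<in>tangent_space A p. \<eta> p (\<lambda>f. v f + w f) = \<eta> p v + \<eta> p w) \<and>
     (\<forall>p c. \<forall>v\<in>tangent_space A p. \<eta> p (\<lambda>f. c * v f) = c * \<eta> p v) \<and>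
     (\<forall>X\<in>vector_fields A. smooth_fun A UNIV (\<lambda>p. \<eta> p (X p)))}"

definition differential :: "('m \<Rightarrow> real) \<Rightarrow> 'm one_form" where
  "differential f = (\<lambda>p v. v f)"

text \<open>Additivity and homogeneity in the second argument follow from symmetry.\<close>

definition riemannian_metric ::
    "('m::topological_space, 'e::real_normed_vector) atlas \<Rightarrow> 'm bilinear_field \<Rightarrow> bool" where
  "riemannian_metric A h \<longleftrightarrow>
     (\<forall>p. \<forall>u\<in>tangent_space A p. \<forall>v\<in>tangent_space A p. \<forall>w\<in>tangent_space A p.
        h p (\<lambda>f. u f + v f) w = h p u w + h p v w) \<and>
     (\<forall>p c. \<forall>v\<in>tangent_space A p. \<forall>w\<in>tangent_space A p. h p (\<lambda>f. c * v f) w = c * h p v w) \<and>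
     (\<forall>p. \<forall>v\<in>tangent_space A p. \<forall>w\<in>tangent_space A p. h p v w = h p w v) \<and>
     (\<forall>p. \<forall>v\<in>tangent_space A p. v \<noteq> (\<lambda>f. 0) \<longrightarrow> h p v v > 0) \<and>
     (\<forall>X\<in>vector_fields A. \<forall>Y\<in>vector_fields A. smooth_fun A UNIV (\<lambda>p. h p (X p) (Y p)))"

definition sharp ::
    "('m::topological_space, 'e::real_normed_vector) atlas \<Rightarrow>
     'm bilinear_field \<Rightarrow> 'm one_form \<Rightarrow> 'm vector_field" where
  "sharp A h \<eta> = (\<lambda>p. THE v. v \<in> tangent_space A p \<and> (\<forall>w\<in>tangent_space A p. h p v w = \<eta> p w))"

section \<open>Connections\<close>

text \<open>
  A connection on the tangent bundle, as an operator \<open>D X Y = \<nabla>\<^sub>X Y\<close> on global vector fields.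
  Homogeneity over the reals in \<open>Y\<close> is the Leibniz rule for constant \<open>g\<close>. The last clause only fixes
  the irrelevant values of the HOL function \<open>D\<close> outside its domain, so that connections which agree
  on vector fields are equal.
\<close>

definition connection ::
    "('m::topological_space, 'e::real_normed_vector) atlas \<Rightarrow> 'm covariant_derivative \<Rightarrow> bool" where
  "connection A D \<longleftrightarrow>
     (\<forall>X\<in>vector_fields A. \<forall>Y\<in>vector_fields A. D X Y \<in> vector_fields A) \<and>
     (\<forall>X\<in>vector_fields A. \<forall>X'\<in>vector_fields A. \<forall>Y\<in>vector_fields A.
        D (vf_add X X') Y = vf_add (D X Y) (D X' Y)) \<and>
     (\<forall>g. \<forall>X\<in>vector_fields A. \<forall>Y\<in>vector_fields A. smooth_fun A UNIV g \<longrightarrow>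
        D (vf_scale g X) Y = vf_scale g (D X Y)) \<and>
     (\<forall>X\<in>vector_fields A. \<forall>Y\<in>vector_fields A. \<forall>Y'\<in>vector_fields A.
        D X (vf_add Y Y') = vf_add (D X Y) (D X Y')) \<and>
     (\<forall>g. \<forall>X\<in>vector_fields A. \<forall>Y\<in>vector_fields A. smooth_fun A UNIV g \<longrightarrow>
        D X (vf_scale g Y) = vf_add (vf_scale (\<lambda>p. X p g) Y) (vf_scale g (D X Y))) \<and>
     (\<forall>X Y. X \<notin> vector_fields A \<or> Y \<notin> vector_fields A \<longrightarrow> D X Y = undefined)"

definition flat ::
    "('m::topological_space, 'e::real_normed_vector) atlas \<Rightarrow> 'm covariant_derivative \<Rightarrow> bool" where
  "flat A D \<longleftrightarrow> (\<forall>X\<in>vector_fields A. \<forall>Y\<in>vector_fields A. \<forall>Z\<in>vector_fields A. \<forall>p f.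
     D X (D Y Z) p f - D Y (D X Z) p f - D (lie_bracket A X Y) Z p f = 0)"

definition torsion_free ::
    "('m::topological_space, 'e::real_normed_vector) atlas \<Rightarrow> 'm covariant_derivative \<Rightarrow> bool" where
  "torsion_free A D \<longleftrightarrow> (\<forall>X\<in>vector_fields A. \<forall>Y\<in>vector_fields A. \<forall>p f.
     D X Y p f - D Y X p f - lie_bracket A X Y p f = 0)"

definition affine_manifold ::
    "('m::{t2_space, second_countable_topology}, 'e::{real_inner, heine_borel}) atlas \<Rightarrow>
     'm covariant_derivative \<Rightarrow> bool" where
  "affine_manifold A D \<longleftrightarrow>
     smooth_manifold A \<and> connected (UNIV :: 'm set) \<and> connection A D \<and> flat A D \<and> torsion_free A D"

text \<open>\<open>(\<nabla>\<eta>)(X, Y) = (\<nabla>\<^sub>X \<eta>)(Y) = X (\<eta> Y) - \<eta> (\<nabla>\<^sub>X Y)\<close>. At a point \<open>p\<close> this uses \<open>\<eta>\<close> only near \<open>p\<close>.\<close>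

definition cov_deriv_form ::
    "'m covariant_derivative \<Rightarrow> 'm one_form \<Rightarrow> 'm vector_field \<Rightarrow> 'm vector_field \<Rightarrow> 'm \<Rightarrow> real" where
  "cov_deriv_form D \<eta> X Y p = X p (\<lambda>q. \<eta> q (Y q)) - \<eta> p (D X Y p)"

section \<open>Hessian manifolds\<close>

text \<open>
  For \<open>f \<in> C\<^sup>\<infinity>(U)\<close> the identity \<open>h = \<nabla>(df)\<close> on \<open>U\<close> is tested, at the points of \<open>U\<close>, on global
  vector fields: both sides are tensors on \<open>U\<close>, and every tangent vector extends to a global
  vector field.
\<close>

definition hessian_metric ::
    "('m::topological_space, 'e::real_normed_vector) atlas \<Rightarrow>
     'm covariant_derivative \<Rightarrow> 'm bilinear_field \<Rightarrow> bool" where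
  "hessian_metric A D h \<longleftrightarrow> riemannian_metric A h \<and>
     (\<forall>p. \<exists>U f. open U \<and> p \<in> U \<and> smooth_fun A U f \<and>
        (\<forall>q\<in>U. \<forall>X\<in>vector_fields A. \<forall>Y\<in>vector_fields A.
           h q (X q) (Y q) = cov_deriv_form D (differential f) X Y q))"

definition hessian_manifold ::
    "('m::{t2_space, second_countable_topology}, 'e::{real_inner, heine_borel}) atlas \<Rightarrow>
     'm covariant_derivative \<Rightarrow> 'm bilinear_field \<Rightarrow> bool" where
  "hessian_manifold A D h \<longleftrightarrow> affine_manifold A D \<and> hessian_metric A D h"

definition one_form_potential ::
    "('m::topological_space, 'e::real_normed_vector) atlas \<Rightarrow>
     'm covariant_derivative \<Rightarrow> 'm bilinear_field \<Rightarrow> 'm one_form \<Rightarrow> bool" where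
  "one_form_potential A D h \<eta> \<longleftrightarrow> \<eta> \<in> one_forms A \<and>
     (\<forall>X\<in>vector_fields A. \<forall>Y\<in>vector_fields A. \<forall>p.
        h p (X p) (Y p) = cov_deriv_form D \<eta> X Y p)"

definition koszul_type ::
    "('m::topological_space, 'e::real_normed_vector) atlas \<Rightarrow>
     'm covariant_derivative \<Rightarrow> 'm bilinear_field \<Rightarrow> bool" where
  "koszul_type A D h \<longleftrightarrow> (\<exists>\<eta>. one_form_potential A D h \<eta>)"

definition euler_field ::
    "('m::topological_space, 'e::real_normed_vector) atlas \<Rightarrow>
     'm covariant_derivative \<Rightarrow> 'm vector_field \<Rightarrow> bool" where
  "euler_field A D H \<longleftrightarrow> H \<in> vector_fields A \<and> (\<forall>X\<in>vector_fields A. D X H = X)"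

definition radiant ::
    "('m::topological_space, 'e::real_normed_vector) atlas \<Rightarrow> 'm covariant_derivative \<Rightarrow> bool" where
  "radiant A D \<longleftrightarrow> (\<exists>H. euler_field A D H)"

definition is_conjugate_connection ::
    "('m::topological_space, 'e::real_normed_vector) atlas \<Rightarrow>
     'm covariant_derivative \<Rightarrow> 'm bilinear_field \<Rightarrow> 'm covariant_derivative \<Rightarrow> bool" where
  "is_conjugate_connection A D h D' \<longleftrightarrow> connection A D' \<and>
     (\<forall>X\<in>vector_fields A. \<forall>Y\<in>vector_fields A. \<forall>Z\<in>vector_fields A. \<forall>p.
        Z p (\<lambda>q. h q (X q) (Y q)) = h p (D Z X p) (Y p) + h p (X p) (D' Z Y p))"

definition conjugate_connection ::
    "('m::topological_space, 'e::real_normed_vector) atlas \<Rightarrow>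
     'm covariant_derivative \<Rightarrow> 'm bilinear_field \<Rightarrow> 'm covariant_derivative" where
  "conjugate_connection A D h = (THE D'. is_conjugate_connection A D h D')"

end

(*
The D-conjugate connection D' exists because a C^infinity-linear functional on vector fields is
h(V, .) for a unique smooth V; it is flat because its curvature is minus the h-adjoint of the
curvature of D. For a potential eta and E = sharp eta, the identity
h(D'_X E, Y) = X (eta Y) - eta (D_X Y) = (D eta)(X, Y) = h(X, Y) shows D'_X E = X.
Inserting E into the curvature of D' gives the torsion of D', so D' is torsion-free as well.
Finally, D' has local potentials by the Legendre transform: if h = D(df) near a point and H is a
local Euler field of D, then H f - f is a local potential of h for D'. In coordinates H solves a
linear total differential equation whose integrability conditions are flatness and torsion-freeness
of D, so its existence is a linear Frobenius theorem.
*)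
theory Submission
  imports Defs
begin

section \<open>Calculus of smooth functions\<close>

text \<open>\<open>D\<close> acts on global vector fields and is constrained only algebraically,
  while frames, Euler fields and Legendre transforms are local. Bump functions bridge the gap: local
  data are replaced by global data with the same germ, and the Leibniz rule and linearity over
  functions make the operators depend on germs only. In flat coordinates x_i one local Euler field
  is H = sum of x_i d/dx_i, and H f - f is the classical Legendre transform of f. Working with H
  alone avoids constructing flat coordinates and their duals. The equations for the components of H
  are overdetermined, one for each coordinate direction, and Picard iteration along rays satisfies
  them only in the limit: the right-hand side formed from an iterate need not be closed, so the
  derivative of the next iterate misses it by a curl term. The point of the estimate is that
  integrability bounds this curl by the defect of the current iterate. All coordinates refer to one
  orthonormal basis \<open>onb\<close>, which is empty for the zero space.\<close>

definition onb :: "'e::{real_inner, heine_borel} set" where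
  "onb = (SOME B. finite B \<and> (\<forall>b\<in>B. \<forall>c\<in>B. b \<bullet> c = (if b = c then 1 else 0)) \<and>
     (\<forall>x. x = (\<Sum>b\<in>B. (x \<bullet> b) *\<^sub>R b)))"

lemma onb_exists:
  "\<exists>B :: 'e::{real_inner, heine_borel} set. finite B \<and>
     (\<forall>b\<in>B. \<forall>c\<in>B. b \<bullet> c = (if b = c then 1 else 0)) \<and> (\<forall>x. x = (\<Sum>b\<in>B. (x \<bullet> b) *\<^sub>R b))"
proof -
  obtain F :: "'e set" where F: "finite F" "span F = UNIV"
    using model_space_finite_dimensional by blast
  obtain C where C: "finite C" "span C = span F" "pairwise orthogonal C"
    using basis_orthogonal[OF F(1)] by blast
  \<comment> \<open>Orthogonality does not exclude 0 from \<open>C\<close>; removing it leaves the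
    span unchanged and permits normalisation.\<close>
  define B where "B = (\<lambda>c. c /\<^sub>R norm c) ` (C - {0})"
  have fin: "finite B"
    using C(1) by (simp add: B_def)
  have ortho: "b \<bullet> c = (if b = c then 1 else 0)" if bc: "b \<in> B" "c \<in> B" for b c
  proof -
    obtain b' where b'0: "b = b' /\<^sub>R norm b'" "b' \<in> C - {0}"
      using bc(1) unfolding B_def by (rule imageE)
    obtain c' where c'0: "c = c' /\<^sub>R norm c'" "c' \<in> C - {0}"
      using bc(2) unfolding B_def by (rule imageE)
    have n: "norm b = 1"
      unfolding b'0(1) using b'0(2) by simp
    show ?thesis
    proof (cases "b = c")
      case True
      then show ?thesis
        using n by (simp add: dot_square_norm)
    next
      case False
      then have "b' \<noteq> c'"
        unfolding b'0(1) c'0(1) by metis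
      then have "b' \<bullet> c' = 0"
        using b'0(2) c'0(2) C(3) unfolding pairwise_def orthogonal_def by blast
      then have "b \<bullet> c = 0"
        unfolding b'0(1) c'0(1) by simp
      then show ?thesis
        using False by simp
    qed
  qed
  have spanB: "span B = UNIV"
  proof -
    have "C \<subseteq> span B"
    proof
      fix c assume "c \<in> C"
      show "c \<in> span B"
      proof (cases "c = 0")
        case False
        then have "c /\<^sub>R norm c \<in> B"
          using \<open>c \<in> C\<close> by (auto simp: B_def)
        then have "norm c *\<^sub>R (c /\<^sub>R norm c) \<in> span B"
          by (intro span_scale span_base)
        then show ?thesis
          using False by simp
      qed (simp add: span_zero)
    qed
    then have "span C \<subseteq> span B"
      by (simp add: span_minimal)
    then show ?thesis
      using C(2) F(2) by auto
  qed
  have "x = (\<Sum>b\<in>B. (x \<bullet> b) *\<^sub>R b)" for x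
  proof -
    obtain k where k: "x = (\<Sum>b\<in>B. k b *\<^sub>R b)"
      proof -
        have "x \<in> range (\<lambda>u. \<Sum>v\<in>B. u v *\<^sub>R v)"
          using spanB span_finite[OF fin] by simp
        then show thesis
          by (rule imageE) (rule that)
      qed
    have "x \<bullet> c = k c" if "c \<in> B" for c
    proof -
      have "x \<bullet> c = (\<Sum>b\<in>B. k b * (b \<bullet> c))"
        unfolding k by (simp add: inner_sum_left)
      also have "\<dots> = (\<Sum>b\<in>B. if b = c then k b else 0)"
        using ortho that by (intro sum.cong) auto
      finally show ?thesis
        using that fin by simp
    qed
    then show ?thesis
      by (subst k) (auto intro!: sum.cong)
  qed
  then show ?thesis
    using fin ortho by blast
qed

lemma
  shows finite_onb [simp]: "finite (onb :: 'e::{real_inner, heine_borel} set)"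
    and inner_onb: "b \<in> onb \<Longrightarrow> c \<in> onb \<Longrightarrow> b \<bullet> c = (if b = (c::'e) then 1 else 0)"
    and onb_expansion: "(\<Sum>b\<in>onb. (x \<bullet> b) *\<^sub>R b) = (x::'e)"
  using someI_ex[OF onb_exists, folded onb_def] by (blast, blast, metis)

lemma norm_onb: "b \<in> onb \<Longrightarrow> norm (b::'e::{real_inner, heine_borel}) = 1"
  using inner_onb[of b b] by (simp add: norm_eq_sqrt_inner)

lemma bounded_linear_onb:
  fixes L :: "'e::{real_inner, heine_borel} \<Rightarrow> real"
  assumes "linear L"
  shows "L x = (\<Sum>b\<in>onb. (x \<bullet> b) * L b)"
proof -
  have "L x = L (\<Sum>b\<in>onb. (x \<bullet> b) *\<^sub>R b)"
    by (simp add: onb_expansion)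
  then show ?thesis
    using assms by (simp add: linear_sum linear_scale)
qed

section \<open>Directional derivatives and closure properties of smooth functions\<close>

abbreviation dd :: "'a::real_normed_vector \<Rightarrow> ('a \<Rightarrow> 'b::real_normed_vector) \<Rightarrow> 'a \<Rightarrow> 'b" where
  "dd v f x \<equiv> frechet_derivative f (at x) v"

lemma dd_eq: "(f has_derivative f') (at x) \<Longrightarrow> dd v f x = f' v"
  using frechet_derivative_at by metis

lemma dd_has_derivative: "f differentiable at x \<Longrightarrow> (f has_derivative (\<lambda>v. dd v f x)) (at x)"
  using frechet_derivative_works by auto

lemma dd_expansion:
  fixes f :: "'e::{real_inner, heine_borel} \<Rightarrow> real"
  assumes "f differentiable at x"
  shows "dd v f x = (\<Sum>b\<in>onb. (v \<bullet> b) * dd b f x)"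
  using bounded_linear_onb[OF linear_frechet_derivative[OF assms]] .

lemma k_smooth_on_subset: "k_smooth_on k S f \<Longrightarrow> T \<subseteq> S \<Longrightarrow> k_smooth_on k T f"
  by (induction k arbitrary: f) (auto intro: continuous_on_subset)

text \<open>\<open>dd\<close> is the derivative in the full space, so it is openness of
  \<open>S\<close> that lets the values on \<open>S\<close> determine it.\<close>

lemma k_smooth_on_cong:
  assumes "open S" "k_smooth_on k S f" "\<And>x. x \<in> S \<Longrightarrow> f x = g x"
  shows "k_smooth_on k S g"
  using assms(2,3)
proof (induction k arbitrary: f g)
  case 0
  then show ?case by (simp cong: continuous_on_cong)
next
  case (Suc k)
  have "dd v g x = dd v f x" if "x \<in> S" for x v
    using Suc.prems that assms(1)
    by (metis frechet_derivative_transform_within_open k_smooth_on.simps(2))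
  moreover have "g differentiable at x" if "x \<in> S" for x
    using Suc.prems that assms(1)
    by (metis differentiable_def has_derivative_transform_within_open k_smooth_on.simps(2))
  ultimately show ?case
    using Suc.prems(1) by (auto intro: Suc.IH)
qed

lemma k_smooth_on_SucD: "k_smooth_on (Suc k) S f \<Longrightarrow> k_smooth_on k S f"
proof (induction k arbitrary: f)
  case 0
  then show ?case
    by (auto intro!: continuous_at_imp_continuous_on differentiable_imp_continuous_within)
qed auto

lemma k_smooth_on_le: "k_smooth_on k S f \<Longrightarrow> j \<le> k \<Longrightarrow> k_smooth_on j S f"
  by (induction k) (auto simp: le_Suc_eq intro: k_smooth_on_SucD simp del: k_smooth_on.simps)

lemma k_smooth_on_local:
  assumes "\<And>x. x \<in> S \<Longrightarrow> \<exists>T. open T \<and> x \<in> T \<and> k_smooth_on k T f"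
  shows "k_smooth_on k S f"
  using assms
proof (induction k arbitrary: f)
  case 0
  then show ?case
    by (auto intro!: continuous_at_imp_continuous_on) (metis continuous_on_eq_continuous_at)
next
  case (Suc k)
  have "k_smooth_on k S (\<lambda>x. dd v f x)" for v
    by (rule Suc.IH) (use Suc.prems in fastforce)
  then show ?case
    using Suc.prems by fastforce
qed

lemma k_smooth_on_const: "k_smooth_on k S (\<lambda>x. c)"
  by (induction k arbitrary: c) auto

lemma k_smooth_on_bounded_linear: "bounded_linear L \<Longrightarrow> k_smooth_on k S L"
proof (cases k)
  case (Suc j)
  assume L: "bounded_linear L"
  then have "(L has_derivative L) (at x)" for x
    by (rule bounded_linear.has_derivative) (rule has_derivative_ident)
  then have "L differentiable at x" "dd v L x = L v" for x v
    by (auto simp: dd_eq differentiable_def)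
  then show ?thesis
    using Suc by (simp add: k_smooth_on_const)
qed (auto intro: linear_continuous_on)

lemma k_smooth_on_add:
  assumes "open S" "k_smooth_on k S f" "k_smooth_on k S g"
  shows "k_smooth_on k S (\<lambda>x. f x + g x)"
  using assms(2,3)
proof (induction k arbitrary: f g)
  case (Suc k)
  have d: "((\<lambda>x. f x + g x) has_derivative (\<lambda>v. dd v f x + dd v g x)) (at x)" if "x \<in> S" for x
    using Suc.prems that by (auto intro!: has_derivative_add dd_has_derivative)
  have "k_smooth_on k S (\<lambda>x. dd v f x + dd v g x)" for v
    using Suc.prems by (auto intro!: Suc.IH)
  then have "k_smooth_on k S (\<lambda>x. dd v (\<lambda>x. f x + g x) x)" for v
    by (rule k_smooth_on_cong[OF assms(1)]) (simp add: dd_eq[OF d])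
  then show ?case
    using d by (auto simp: differentiable_def)
qed (auto intro: continuous_intros)

lemma k_smooth_on_linear_image:
  assumes "open S" "bounded_linear L" "k_smooth_on k S f"
  shows "k_smooth_on k S (\<lambda>x. L (f x))"
  using assms(3)
proof (induction k arbitrary: f)
  case 0
  then show ?case
    using assms(2) by (auto intro: bounded_linear.continuous_on)
next
  case (Suc k)
  have d: "((\<lambda>x. L (f x)) has_derivative (\<lambda>v. L (dd v f x))) (at x)" if "x \<in> S" for x
    using Suc.prems that assms(2)
    by (auto intro!: bounded_linear.has_derivative[OF assms(2)] dd_has_derivative)
  have "k_smooth_on k S (\<lambda>x. L (dd v f x))" for v
    using Suc.prems by (auto intro!: Suc.IH)
  then have "k_smooth_on k S (\<lambda>x. dd v (\<lambda>x. L (f x)) x)" for v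
    by (rule k_smooth_on_cong[OF assms(1)]) (simp add: dd_eq[OF d])
  then show ?case
    using d by (auto simp: differentiable_def)
qed

lemma k_smooth_on_mult:
  fixes f g :: "'a::real_normed_vector \<Rightarrow> real"
  assumes "open S" "k_smooth_on k S f" "k_smooth_on k S g"
  shows "k_smooth_on k S (\<lambda>x. f x * g x)"
  using assms(2,3)
proof (induction k arbitrary: f g)
  case (Suc k)
  have d: "((\<lambda>x. f x * g x) has_derivative (\<lambda>v. f x * dd v g x + dd v f x * g x)) (at x)"
    if "x \<in> S" for x
    using Suc.prems that by (auto intro!: has_derivative_mult dd_has_derivative)
  have "k_smooth_on k S (\<lambda>x. f x * dd v g x + dd v f x * g x)" for v
    using Suc.prems assms(1)
    by (intro k_smooth_on_add Suc.IH) (auto intro: k_smooth_on_SucD)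
  then have "k_smooth_on k S (\<lambda>x. dd v (\<lambda>x. f x * g x) x)" for v
    by (rule k_smooth_on_cong[OF assms(1)]) (simp add: dd_eq[OF d])
  then show ?case
    using d by (auto simp: differentiable_def)
qed (auto intro: continuous_intros)

lemma k_smooth_on_sum:
  assumes "open S" "\<And>i. i \<in> I \<Longrightarrow> k_smooth_on k S (f i)"
  shows "k_smooth_on k S (\<lambda>x. \<Sum>i\<in>I. f i x)"
  using assms(2)
  by (induction I rule: infinite_finite_induct)
    (simp_all add: k_smooth_on_const k_smooth_on_add assms(1))

text \<open>The derivative of \<open>1/f\<close> contains \<open>1/f\<close> only to the order
  already treated, so the induction closes on products of known functions.\<close>

lemma k_smooth_on_inverse:
  fixes f :: "'a::real_normed_vector \<Rightarrow> real"
  assumes "open S" "k_smooth_on k S f" "\<And>x. x \<in> S \<Longrightarrow> f x \<noteq> 0"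
  shows "k_smooth_on k S (\<lambda>x. inverse (f x))"
  using assms(2,3)
proof (induction k)
  case (Suc k)
  have d: "((\<lambda>x. inverse (f x)) has_derivative
      (\<lambda>v. - 1 * (inverse (f x) * dd v f x * inverse (f x)))) (at x)" if "x \<in> S" for x
    using Suc.prems that by (auto intro!: derivative_eq_intros dd_has_derivative)
  have sm: "k_smooth_on k S (\<lambda>x. - 1 * (inverse (f x) * dd v f x * inverse (f x)))" for v
    using Suc.prems assms(1) k_smooth_on_SucD[OF Suc.prems(1)]
    by (intro k_smooth_on_mult Suc.IH k_smooth_on_const) auto
  have "k_smooth_on k S (\<lambda>x. dd v (\<lambda>x. inverse (f x)) x)" for v
    by (rule k_smooth_on_cong[OF assms(1) sm[of v]]) (simp add: dd_eq[OF d])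
  then show ?case
    using d by (auto simp: differentiable_def)
qed (auto intro: continuous_on_inverse)

lemma k_smooth_on_compose:
  fixes f :: "'a::real_normed_vector \<Rightarrow> 'b::{real_inner, heine_borel}" and g :: "'b \<Rightarrow> real"
  assumes "open S" "open T" "k_smooth_on k S f" "k_smooth_on k T g" "f ` S \<subseteq> T"
  shows "k_smooth_on k S (\<lambda>x. g (f x))"
  using assms(3,4)
proof (induction k arbitrary: g)
  case 0
  then show ?case
    using assms(5) by (auto intro: continuous_on_compose2)
next
  case (Suc k)
  \<comment> \<open>The inner direction \<open>dd v f x\<close> moves with \<open>x\<close>, but
    \<open>k_smooth_on\<close> speaks of fixed directions only. Expanding in \<open>onb\<close>
    leaves derivatives of \<open>g\<close> in fixed directions, to which the induction hypothesis
    applies.\<close>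
  have d: "((\<lambda>x. g (f x)) has_derivative (\<lambda>v. \<Sum>b\<in>onb. (dd v f x \<bullet> b) * dd b g (f x))) (at x)"
    if "x \<in> S" for x
  proof -
    have g: "g differentiable at (f x)"
      using Suc.prems assms(5) that by auto
    have "((\<lambda>x. g (f x)) has_derivative (\<lambda>v. dd (dd v f x) g (f x))) (at x)"
      using Suc.prems that g
      by (intro has_derivative_compose[of f _ x UNIV g] dd_has_derivative) auto
    then show ?thesis
      by (simp add: dd_expansion[OF g, symmetric])
  qed
  have sm: "k_smooth_on k S (\<lambda>x. \<Sum>b\<in>onb. (dd v f x \<bullet> b) * dd b g (f x))" for v
  proof (intro k_smooth_on_sum k_smooth_on_mult assms(1))
    show "k_smooth_on k S (\<lambda>x. dd v f x \<bullet> b)" for b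
      using Suc.prems by (intro k_smooth_on_linear_image[OF assms(1) bounded_linear_inner_left]) auto
    show "k_smooth_on k S (\<lambda>x. dd b g (f x))" for b
      using Suc.prems by (intro Suc.IH) (auto intro: k_smooth_on_SucD)
  qed
  have "k_smooth_on k S (\<lambda>x. dd v (\<lambda>x. g (f x)) x)" for v
    using assms(1) sm by (rule k_smooth_on_cong) (simp add: dd_eq[OF d])
  then show ?case
    using d by (auto simp: differentiable_def)
qed

lemma smooth_on_subset: "smooth_on S f \<Longrightarrow> T \<subseteq> S \<Longrightarrow> smooth_on T f"
  by (auto simp: smooth_on_def intro: k_smooth_on_subset)

lemma smooth_on_cong:
  "open S \<Longrightarrow> smooth_on S f \<Longrightarrow> (\<And>x. x \<in> S \<Longrightarrow> f x = g x) \<Longrightarrow> smooth_on S g"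
  unfolding smooth_on_def using k_smooth_on_cong by blast

lemma smooth_on_local:
  "(\<And>x. x \<in> S \<Longrightarrow> \<exists>T. open T \<and> x \<in> T \<and> smooth_on T f) \<Longrightarrow> smooth_on S f"
  unfolding smooth_on_def by (meson k_smooth_on_local)

lemma smooth_on_const: "smooth_on S (\<lambda>x. c)"
  by (simp add: smooth_on_def k_smooth_on_const)

lemma smooth_on_bounded_linear: "bounded_linear L \<Longrightarrow> smooth_on S L"
  by (simp add: smooth_on_def k_smooth_on_bounded_linear)

lemma smooth_on_add: "open S \<Longrightarrow> smooth_on S f \<Longrightarrow> smooth_on S g \<Longrightarrow> smooth_on S (\<lambda>x. f x + g x)"
  by (simp add: smooth_on_def k_smooth_on_add)

lemma smooth_on_mult:
  fixes f g :: "'a::real_normed_vector \<Rightarrow> real"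
  shows "open S \<Longrightarrow> smooth_on S f \<Longrightarrow> smooth_on S g \<Longrightarrow> smooth_on S (\<lambda>x. f x * g x)"
  by (simp add: smooth_on_def k_smooth_on_mult)

lemma smooth_on_diff:
  fixes f g :: "'a::real_normed_vector \<Rightarrow> real"
  shows "open S \<Longrightarrow> smooth_on S f \<Longrightarrow> smooth_on S g \<Longrightarrow> smooth_on S (\<lambda>x. f x - g x)"
  using smooth_on_add[of S f "\<lambda>x. - 1 * g x"] smooth_on_mult[of S "\<lambda>_. -1" g]
  by (simp add: smooth_on_const)

lemma smooth_on_sum:
  "open S \<Longrightarrow> (\<And>i. i \<in> I \<Longrightarrow> smooth_on S (f i)) \<Longrightarrow> smooth_on S (\<lambda>x. \<Sum>i\<in>I. f i x)"
  by (simp add: smooth_on_def k_smooth_on_sum)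

lemma smooth_on_inverse:
  fixes f :: "'a::real_normed_vector \<Rightarrow> real"
  shows "open S \<Longrightarrow> smooth_on S f \<Longrightarrow> (\<And>x. x \<in> S \<Longrightarrow> f x \<noteq> 0) \<Longrightarrow> smooth_on S (\<lambda>x. inverse (f x))"
  by (simp add: smooth_on_def k_smooth_on_inverse)

lemma smooth_on_compose:
  fixes f :: "'a::real_normed_vector \<Rightarrow> 'b::{real_inner, heine_borel}" and g :: "'b \<Rightarrow> real"
  shows "open S \<Longrightarrow> open T \<Longrightarrow> smooth_on S f \<Longrightarrow> smooth_on T g \<Longrightarrow> f ` S \<subseteq> T \<Longrightarrow>
    smooth_on S (\<lambda>x. g (f x))"
  unfolding smooth_on_def using k_smooth_on_compose[of S T _ f g] by simp

lemma smooth_on_dd: "smooth_on S f \<Longrightarrow> smooth_on S (\<lambda>x. dd v f x)"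
  unfolding smooth_on_def by (metis k_smooth_on.simps(2))

lemma smooth_on_differentiable: "smooth_on S f \<Longrightarrow> x \<in> S \<Longrightarrow> f differentiable at x"
  unfolding smooth_on_def by (metis k_smooth_on.simps(2))

lemma smooth_on_continuous: "smooth_on S f \<Longrightarrow> continuous_on S f"
  unfolding smooth_on_def by (metis k_smooth_on.simps(1))

lemma smooth_on_inner: "smooth_on S (\<lambda>x. x \<bullet> b)"
  by (rule smooth_on_bounded_linear) (rule bounded_linear_inner_left)

section \<open>Bump functions\<close>

text \<open>Case \<open>n = 0\<close> is the standard function that is flat at 0. The powers are
  included because the family is then closed under differentiation up to linear combinations, which
  reduces smoothness to an induction on the order.\<close>

definition flat_exp :: "nat \<Rightarrow> real \<Rightarrow> real" where
  "flat_exp n x = (if x > 0 then exp (- inverse x) * inverse x ^ n else 0)"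

lemma flat_exp_has_derivative:
  "(flat_exp n has_real_derivative (flat_exp (n + 2) x - n * flat_exp (n + 1) x)) (at x)"
proof -
  consider "x > 0" | "x < 0" | "x = 0" by linarith
  then show ?thesis
  proof cases
    case 1
    have "((\<lambda>x. exp (- inverse x) * inverse x ^ n) has_real_derivative
        (flat_exp (n + 2) x - n * flat_exp (n + 1) x)) (at x)"
    proof -
      define y where "y = inverse x"
      have inv: "(inverse has_real_derivative - (y * y)) (at x)"
        using DERIV_inverse[of x UNIV] 1 by (simp add: y_def power2_eq_square)
      have "((\<lambda>x. exp (- inverse x)) has_real_derivative exp (- y) * (y * y)) (at x)"
        using DERIV_fun_exp[OF DERIV_minus[OF inv]] by (simp add: y_def)
      from DERIV_mult[OF this DERIV_power[OF inv, of n]] show ?thesis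
        by (rule DERIV_cong)
          (cases n; use 1 in \<open>simp add: flat_exp_def y_def[symmetric] algebra_simps\<close>)
    qed
    then show ?thesis
      by (rule has_field_derivative_transform_within_open[of _ _ _ "{0<..}"])
        (use 1 in \<open>auto simp: flat_exp_def\<close>)
  next
    case 2
    have "((\<lambda>x. 0) has_real_derivative 0) (at x)"
      by simp
    then have "(flat_exp n has_real_derivative 0) (at x)"
      by (rule has_field_derivative_transform_within_open[of _ _ _ "{..<0}"])
        (use 2 in \<open>auto simp: flat_exp_def\<close>)
    then show ?thesis
      using 2 by (simp add: flat_exp_def)
  next
    case 3
    \<comment> \<open>Substituting the inverse of \<open>y\<close> turns the right-hand difference
      quotient at 0 into a power divided by the exponential at infinity.\<close>
    have lim: "((\<lambda>y::real. y ^ Suc n / exp y) \<longlongrightarrow> 0) at_top"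
      by (rule tendsto_power_div_exp_0)
    have "((\<lambda>y. inverse y ^ Suc n / exp (inverse y)) \<longlongrightarrow> 0) (at_right (0::real))"
      using filterlim_compose[OF lim filterlim_inverse_at_top_right] by simp
    then have r: "((\<lambda>y. (flat_exp n y - flat_exp n 0) / (y - 0)) \<longlongrightarrow> 0) (at_right 0)"
      by (rule Lim_transform_eventually)
        (auto simp: flat_exp_def exp_minus field_simps eventually_at_right_less
          intro!: eventually_mono[OF eventually_at_right_less])
    have l: "((\<lambda>y. (flat_exp n y - flat_exp n 0) / (y - 0)) \<longlongrightarrow> 0) (at_left 0)"
      by (rule Lim_transform_eventually[OF tendsto_const])
        (auto simp: flat_exp_def eventually_at_left_field intro!: exI[of _ "-1"])
    have "(flat_exp n has_real_derivative 0) (at 0)"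
      unfolding has_field_derivative_iff
      using filterlim_split_at[OF l r] by simp
    then show ?thesis
      using 3 by (simp add: flat_exp_def)
  qed
qed

lemma smooth_flat_exp: "smooth_on UNIV (flat_exp n)"
proof -
  have "k_smooth_on k UNIV (flat_exp n)" for k
  proof (induction k arbitrary: n)
    case 0
    have "isCont (flat_exp n) x" for x
      using flat_exp_has_derivative DERIV_isCont by blast
    then show ?case
      by (simp add: continuous_at_imp_continuous_on)
  next
    case (Suc k)
    have d: "(flat_exp n has_derivative
        (\<lambda>v. (flat_exp (n + 2) x + - n * flat_exp (n + 1) x) * v)) (at x)" for x
      using flat_exp_has_derivative[of n x] unfolding has_field_derivative_def by simp
    have "k_smooth_on k UNIV (\<lambda>x. (flat_exp (n + 2) x + - n * flat_exp (n + 1) x) * v)" for v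
      by (intro k_smooth_on_mult k_smooth_on_add k_smooth_on_const Suc.IH open_UNIV)
    then show ?case
      using d by (auto simp: differentiable_def dd_eq[OF d])
  qed
  then show ?thesis
    by (simp add: smooth_on_def)
qed

text \<open>Quotient \<open>f / (f + g)\<close>: \<open>f\<close> vanishes outside the ball of
  radius \<open>r\<close>, \<open>g\<close> inside that of radius \<open>r / 2\<close>, and they are
  never zero together. The squared distance \<open>s\<close> keeps both smooth at the
  centre.\<close>

lemma bump_exists:
  fixes a :: "'e::{real_inner, heine_borel}"
  assumes "r > 0"
  obtains \<beta> :: "'e \<Rightarrow> real" where "smooth_on UNIV \<beta>"
    "\<And>x. dist a x < r / 2 \<Longrightarrow> \<beta> x = 1" "\<And>x. r \<le> dist a x \<Longrightarrow> \<beta> x = 0"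
proof -
  define s where "s = (\<lambda>x. (x - a) \<bullet> (x - a))"
  have s: "s x = (dist a x)\<^sup>2" for x
    by (simp add: s_def dist_norm norm_minus_commute[of a x] power2_norm_eq_inner)
  have "(x - a) \<bullet> (x - a) = (\<Sum>b\<in>onb. ((x - a) \<bullet> b) * ((x - a) \<bullet> b))" for x
  proof -
    have "(x - a) \<bullet> (x - a) = (x - a) \<bullet> (\<Sum>b\<in>onb. ((x - a) \<bullet> b) *\<^sub>R b)"
      by (simp add: onb_expansion)
    then show ?thesis
      by (simp add: inner_sum_right)
  qed
  moreover have "smooth_on UNIV (\<lambda>x. (x - a) \<bullet> b)" for b
    using smooth_on_add[OF open_UNIV smooth_on_inner smooth_on_const[of _ "- (a \<bullet> b)"]]
    by (simp add: inner_diff_left)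
  ultimately have sm: "smooth_on UNIV s"
    unfolding s_def by (simp add: smooth_on_sum smooth_on_mult)
  define f g where "f = (\<lambda>x. flat_exp 0 (r\<^sup>2 - s x))" and "g = (\<lambda>x. flat_exp 0 (s x - (r/2)\<^sup>2))"
  have "smooth_on UNIV (\<lambda>x. r\<^sup>2 - s x)" "smooth_on UNIV (\<lambda>x. s x - (r/2)\<^sup>2)"
    using sm by (auto intro!: smooth_on_diff smooth_on_const)
  then have fg: "smooth_on UNIV f" "smooth_on UNIV g"
    unfolding f_def g_def
    by (auto intro: smooth_on_compose[OF open_UNIV open_UNIV _ smooth_flat_exp])
  have pos: "f x + g x > 0" for x
  proof -
    have "(r/2)\<^sup>2 < r\<^sup>2"
      using assms by (simp add: power2_eq_square field_simps)
    then show ?thesis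
      by (auto simp: f_def g_def flat_exp_def add_pos_pos)
  qed
  show thesis
  proof (rule that[of "\<lambda>x. f x * inverse (f x + g x)"])
    show "smooth_on UNIV (\<lambda>x. f x * inverse (f x + g x))"
      using fg pos by (intro smooth_on_mult smooth_on_inverse smooth_on_add) (auto simp: less_le)
    fix x
    show "f x * inverse (f x + g x) = 1" if "dist a x < r / 2"
    proof -
      have "s x < (r/2)\<^sup>2"
        using that s by (simp add: power_strict_mono)
      then have "g x = 0"
        by (simp add: g_def flat_exp_def)
      then show ?thesis
        using pos[of x] by simp
    qed
    show "f x * inverse (f x + g x) = 0" if "r \<le> dist a x"
    proof -
      have "r\<^sup>2 \<le> s x"
        using that s assms by (simp add: power_mono)
      then show ?thesis
        by (simp add: f_def flat_exp_def)
    qed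
  qed
qed

section \<open>Integration along rays\<close>

text \<open>The weight \<open>t ^ m\<close> is carried along because each differentiation under the
  integral sign produces one more factor \<open>t\<close>.\<close>

definition radial :: "nat \<Rightarrow> 'e::{real_inner, heine_borel} \<Rightarrow> ('e \<Rightarrow> real) \<Rightarrow> 'e \<Rightarrow> real" where
  "radial m a f x = integral {0..1} (\<lambda>t. t ^ m * f (a + t *\<^sub>R (x - a)))"

lemma ray_in_ball:
  fixes a :: "'e::real_normed_vector"
  assumes "x \<in> ball a r" "t \<in> {0..1}"
  shows "a + t *\<^sub>R (x - a) \<in> ball a r"
proof -
  have "t * norm (x - a) \<le> norm (x - a)"
    using assms(2) by (auto intro: mult_left_le_one_le)
  then show ?thesis
    using assms by (simp add: dist_norm norm_minus_commute)
qed

lemma continuous_on_ray: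
  fixes f :: "'e::{real_inner, heine_borel} \<Rightarrow> real"
  assumes "continuous_on (ball a r) f" "x \<in> ball a r"
  shows "continuous_on {0..1} (\<lambda>t. t ^ m * f (a + t *\<^sub>R (x - a)))"
proof -
  have "continuous_on {0..1} (\<lambda>t. f (a + t *\<^sub>R (x - a)))"
    by (rule continuous_on_compose2[OF assms(1)])
      (use ray_in_ball[OF assms(2)] in \<open>auto intro!: continuous_intros\<close>)
  then show ?thesis
    by (intro continuous_intros)
qed

lemma integrable_ray:
  fixes f :: "'e::{real_inner, heine_borel} \<Rightarrow> real"
  assumes "continuous_on (ball a r) f" "x \<in> ball a r"
  shows "(\<lambda>t. t ^ m * f (a + t *\<^sub>R (x - a))) integrable_on {0..1}"
  using continuous_on_ray[OF assms] by (rule integrable_continuous_real)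

lemma radial_cong:
  assumes "x \<in> ball a r" "\<And>y. y \<in> ball a r \<Longrightarrow> f y = g y"
  shows "radial m a f x = radial m a g x"
  unfolding radial_def using ray_in_ball[OF assms(1)] assms(2) by (intro integral_cong) auto

lemma radial_diff:
  assumes "continuous_on (ball a r) f" "continuous_on (ball a r) g" "x \<in> ball a r"
  shows "radial m a (\<lambda>y. f y - g y) x = radial m a f x - radial m a g x"
  unfolding radial_def
  using integral_diff[OF integrable_ray[OF assms(1,3)] integrable_ray[OF assms(2,3)]]
  by (simp add: algebra_simps)

lemma radial_cmult: "radial m a (\<lambda>y. c * f y) x = c * radial m a f x"
  unfolding radial_def by (simp add: mult.left_commute)

lemma radial_sum:
  assumes "finite I" "\<And>i. i \<in> I \<Longrightarrow> continuous_on (ball a r) (f i)" "x \<in> ball a r"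
  shows "radial m a (\<lambda>y. \<Sum>i\<in>I. f i y) x = (\<Sum>i\<in>I. radial m a (f i) x)"
  unfolding radial_def sum_distrib_left
  by (rule integral_sum[OF assms(1)]) (rule integrable_ray[OF assms(2,3)])

lemma radial_bound:
  assumes "continuous_on (ball a r) f" "x \<in> ball a r" "\<And>y. y \<in> ball a r \<Longrightarrow> \<bar>f y\<bar> \<le> C"
  shows "\<bar>radial m a f x\<bar> \<le> C"
proof -
  have "norm (integral {0..1} (\<lambda>t. t ^ m * f (a + t *\<^sub>R (x - a)))) \<le> C * (1 - 0)"
  proof (rule integral_bound[OF _ continuous_on_ray[OF assms(1,2)]])
    fix t :: real assume t: "t \<in> {0..1}"
    have "\<bar>f (a + t *\<^sub>R (x - a))\<bar> \<le> C"
      using assms(3) ray_in_ball[OF assms(2) t] by blast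
    moreover have "\<bar>t ^ m\<bar> \<le> 1"
      using t by (simp add: power_le_one)
    ultimately show "norm (t ^ m * f (a + t *\<^sub>R (x - a))) \<le> C"
      using mult_mono[of "\<bar>t ^ m\<bar>" 1 "\<bar>f (a + t *\<^sub>R (x - a))\<bar>" C] by (simp add: abs_mult)
  qed simp
  then show ?thesis
    by (simp add: radial_def)
qed

lemma radial_continuous:
  assumes "continuous_on (ball a r) f"
  shows "continuous_on (ball a r) (radial m a f)"
proof -
  have "continuous_on (ball a r \<times> {0..1}) (\<lambda>z. f (a + snd z *\<^sub>R (fst z - a)))"
    by (rule continuous_on_compose2[OF assms])
      (use ray_in_ball[of _ a r] in \<open>auto intro!: continuous_intros simp del: mem_ball\<close>)
  then have "continuous_on (ball a r \<times> cbox 0 1)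
      (\<lambda>(x, t::real). t ^ m * f (a + t *\<^sub>R (x - a)))"
    by (auto simp: case_prod_unfold intro!: continuous_intros)
  from integral_continuous_on_param[OF this] show ?thesis
    unfolding radial_def by simp
qed

text \<open>Differentiation under the integral sign, by integrating a first-order estimate that is
  uniform in \<open>t\<close>. The chain rule along the ray contributes the factor \<open>t\<close>,
  hence \<open>Suc m\<close>.\<close>

lemma radial_has_derivative:
  fixes f :: "'e::{real_inner, heine_borel} \<Rightarrow> real"
  assumes f: "k_smooth_on (Suc 0) (ball a r) f" and x: "x \<in> ball a r"
  shows "(radial m a f has_derivative (\<lambda>v. radial (Suc m) a (dd v f) x)) (at x)"
proof -
  have df: "f differentiable at y" if "y \<in> ball a r" for y
    using f that by simp
  have cf: "continuous_on (ball a r) f"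
    using k_smooth_on_SucD[OF f] by simp
  have cdd: "continuous_on (ball a r) (dd v f)" for v
    using f by simp
  have expand: "radial (Suc m) a (dd v f) x = (\<Sum>b\<in>onb. (v \<bullet> b) * radial (Suc m) a (dd b f) x)" for v
  proof -
    have "radial (Suc m) a (dd v f) x = radial (Suc m) a (\<lambda>y. \<Sum>b\<in>onb. (v \<bullet> b) * dd b f y) x"
      using x dd_expansion[OF df] by (rule radial_cong)
    also have "\<dots> = (\<Sum>b\<in>onb. radial (Suc m) a (\<lambda>y. (v \<bullet> b) * dd b f y) x)"
      using x cdd by (intro radial_sum[where r = r]) (auto intro!: continuous_intros)
    finally show ?thesis
      by (simp add: radial_cmult)
  qed
  have bl: "bounded_linear (\<lambda>v. \<Sum>b\<in>onb. (v \<bullet> b) * radial (Suc m) a (dd b f) x)"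
    by (intro bounded_linear_sum bounded_linear_compose[OF bounded_linear_mult_left]
        bounded_linear_inner_left)
  \<comment> \<open>A compact ball inside the domain with \<open>x\<close> in its interior, on which
    the partial derivatives are uniformly continuous.\<close>
  obtain \<rho> where \<rho>: "dist a x < \<rho>" "\<rho> < r"
    using x dense by auto
  have sub: "cball a \<rho> \<subseteq> ball a r"
    using \<rho> by auto
  show ?thesis
    unfolding has_derivative_at_alt
  proof (intro conjI allI impI)
    show "bounded_linear (\<lambda>v. radial (Suc m) a (dd v f) x)"
      using bl by (simp only: expand[symmetric])
    fix e :: real assume e: "0 < e"
    \<comment> \<open>A deviation of at most \<open>e'\<close> in each partial derivative changes
      the full derivative by at most \<open>e\<close> in operator norm; the summand 1 covers the
      empty basis.\<close>
    define e' where "e' = e / (1 + card (onb :: 'e set))"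
    have e': "e' > 0" "card (onb :: 'e set) * e' \<le> e"
      using e by (auto simp: e'_def field_simps)
    have "\<exists>d>0. \<forall>y\<in>cball a \<rho>. \<forall>z\<in>cball a \<rho>. dist z y < d \<longrightarrow> dist (dd b f z) (dd b f y) < e'" for b
      using compact_uniformly_continuous[OF continuous_on_subset[OF cdd sub] compact_cball] e'(1)
      unfolding uniformly_continuous_on_def by blast
    then obtain D where D: "\<And>b. D b > 0" "\<And>b y z. y \<in> cball a \<rho> \<Longrightarrow> z \<in> cball a \<rho> \<Longrightarrow>
        dist z y < D b \<Longrightarrow> dist (dd b f z) (dd b f y) < e'"
      by metis
    \<comment> \<open>The entry \<open>\<rho> - dist a x\<close> keeps perturbed points inside the
      ball of radius \<open>\<rho>\<close> and makes the minimum meaningful for an empty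
      basis.\<close>
    define d where "d = Min (insert (\<rho> - dist a x) (D ` onb))"
    have d: "d > 0" "d \<le> \<rho> - dist a x" "\<And>b. b \<in> onb \<Longrightarrow> d \<le> D b"
      using D(1) \<rho> by (auto simp: d_def)
    have pointwise: "\<bar>f (a + t *\<^sub>R (y - a)) - f (a + t *\<^sub>R (x - a)) - t * dd (y - x) f (a + t *\<^sub>R (x - a))\<bar>
        \<le> e * norm (y - x)"
      if y: "norm (y - x) < d" and t: "t \<in> {0..1}" for y t
    proof -
      define x' y' where "x' = a + t *\<^sub>R (x - a)" and "y' = a + t *\<^sub>R (y - a)"
      have diff: "y' - x' = t *\<^sub>R (y - x)"
        by (simp add: x'_def y'_def algebra_simps)
      have tle: "norm (t *\<^sub>R (y - x)) \<le> norm (y - x)"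
        using t by (auto intro: mult_left_le_one_le)
      have "dist a y \<le> dist a x + dist x y"
        by (rule dist_triangle)
      then have yb: "y \<in> ball a \<rho>"
        using y d(2) by (simp add: dist_norm norm_minus_commute)
      have x': "x' \<in> ball a \<rho>" and y': "y' \<in> ball a \<rho>"
        unfolding x'_def y'_def using ray_in_ball[OF _ t] yb \<rho> by auto
      \<comment> \<open>The mean value estimate needs a convex set on which the derivative stays
        close to that at \<open>x'\<close>: the small ball gives the closeness, the large one keeps
        to the region of uniform continuity.\<close>
      have conv: "convex (ball x' d \<inter> ball a \<rho>)"
        by (intro convex_Int convex_ball)
      have y'2: "y' \<in> ball x' d \<inter> ball a \<rho>"
      proof -
        have "dist x' y' = norm (t *\<^sub>R (y - x))"
          by (simp flip: diff add: dist_norm norm_minus_commute)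
        then show ?thesis
          using y' tle y by simp
      qed
      have x'2: "x' \<in> ball x' d \<inter> ball a \<rho>"
        using x' d(1) by auto
      have "norm (f y' - f x' - dd (y' - x') f x') \<le> norm (y' - x') * e"
      proof (rule differentiable_bound_linearization[where S = "ball x' d \<inter> ball a \<rho>"
            and f' = "\<lambda>z v. dd v f z"])
        show "x' + s *\<^sub>R (y' - x') \<in> ball x' d \<inter> ball a \<rho>" if "s \<in> {0..1}" for s
          using convexD_alt[OF conv x'2 y'2, of s] that by (auto simp: algebra_simps)
        show "(f has_derivative (\<lambda>v. dd v f z)) (at z within ball x' d \<inter> ball a \<rho>)"
          if "z \<in> ball x' d \<inter> ball a \<rho>" for z
          by (rule has_derivative_at_withinI, rule dd_has_derivative, rule df) (use that \<rho>(2) in auto)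
        show "onorm ((\<lambda>v. dd v f z) - (\<lambda>v. dd v f x')) \<le> e" if z: "z \<in> ball x' d \<inter> ball a \<rho>" for z
        proof (rule onorm_bound[OF less_imp_le[OF e]])
          fix v
          have "norm (((\<lambda>v. dd v f z) - (\<lambda>v. dd v f x')) v)
              = \<bar>\<Sum>b\<in>onb. (v \<bullet> b) * (dd b f z - dd b f x')\<bar>"
          proof -
            have "f differentiable at z" "f differentiable at x'"
              using z x' sub by (auto intro!: df)
            then show ?thesis
              by (simp add: dd_expansion[of f _ v] sum_subtractf right_diff_distrib)
          qed
          also have "\<dots> \<le> (\<Sum>b\<in>onb. \<bar>(v \<bullet> b) * (dd b f z - dd b f x')\<bar>)"
            by (rule sum_abs)
          also have "\<dots> \<le> (\<Sum>b\<in>(onb::'e set). norm v * e')"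
          proof (rule sum_mono)
            fix b :: 'e assume b: "b \<in> onb"
            have "\<bar>v \<bullet> b\<bar> \<le> norm v"
              using Cauchy_Schwarz_ineq2[of v b] norm_onb[OF b] by simp
            moreover have "\<bar>dd b f z - dd b f x'\<bar> \<le> e'"
              using D(2)[of x' z b] d(3)[OF b] z x'
              by (auto simp: dist_commute dist_real_def abs_minus_commute)
            ultimately show "\<bar>(v \<bullet> b) * (dd b f z - dd b f x')\<bar> \<le> norm v * e'"
              by (simp add: abs_mult mult_mono)
          qed
          also have "\<dots> = (card (onb :: 'e set) * e') * norm v"
            by simp
          also have "\<dots> \<le> e * norm v"
            using e'(2) by (rule mult_right_mono) simp
          finally show "norm (((\<lambda>v. dd v f z) - (\<lambda>v. dd v f x')) v) \<le> e * norm v" .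
        qed
        show "x' \<in> ball x' d \<inter> ball a \<rho>" by (rule x'2)
      qed
      also have "\<dots> \<le> norm (y - x) * e"
        unfolding diff using tle e by (intro mult_right_mono) auto
      finally have "\<bar>f y' - f x' - dd (t *\<^sub>R (y - x)) f x'\<bar> \<le> e * norm (y - x)"
        by (simp add: diff mult.commute)
      moreover have "dd (t *\<^sub>R (y - x)) f x' = t * dd (y - x) f x'"
        using linear_scale[OF linear_frechet_derivative[OF df]] x' \<rho>(2) by simp
      ultimately show ?thesis
        by (simp add: x'_def y'_def)
    qed
    show "\<exists>d>0. \<forall>y. norm (y - x) < d \<longrightarrow>
        norm (radial m a f y - radial m a f x - radial (Suc m) a (dd (y - x) f) x) \<le> e * norm (y - x)"
    proof (intro exI conjI allI impI)
      fix y assume y: "norm (y - x) < d"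
      have "dist a y \<le> dist a x + dist x y"
        by (rule dist_triangle)
      then have yb: "y \<in> ball a r"
        using y d(2) \<rho> by (simp add: dist_norm norm_minus_commute)
      define g where "g = (\<lambda>t. t ^ m * f (a + t *\<^sub>R (y - a)) - t ^ m * f (a + t *\<^sub>R (x - a))
        - t ^ Suc m * dd (y - x) f (a + t *\<^sub>R (x - a)))"
      have "radial m a f y - radial m a f x - radial (Suc m) a (dd (y - x) f) x = integral {0..1} g"
        unfolding radial_def g_def
        by (simp only: integral_diff[OF integrable_diff[OF integrable_ray[OF cf yb]
              integrable_ray[OF cf x]] integrable_ray[OF cdd x]]
            integral_diff[OF integrable_ray[OF cf yb] integrable_ray[OF cf x]])
      moreover have "norm (integral {0..1} g) \<le> (e * norm (y - x)) * (1 - 0)"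
      proof (rule integral_bound)
        show "continuous_on {0..1} g"
          unfolding g_def
          by (intro continuous_on_diff continuous_on_ray[OF cf yb] continuous_on_ray[OF cf x]
              continuous_on_ray[OF cdd x])
        fix t :: real assume t: "t \<in> {0..1}"
        have "g t = t ^ m * (f (a + t *\<^sub>R (y - a)) - f (a + t *\<^sub>R (x - a))
            - t * dd (y - x) f (a + t *\<^sub>R (x - a)))"
          by (simp add: g_def algebra_simps)
        moreover have "\<bar>t ^ m\<bar> \<le> 1"
          using t by (simp add: power_le_one)
        ultimately show "norm (g t) \<le> e * norm (y - x)"
          using pointwise[OF y t] mult_mono[of "\<bar>t ^ m\<bar>" 1] by (fastforce simp: abs_mult)
      qed simp
      ultimately show "norm (radial m a f y - radial m a f x - radial (Suc m) a (dd (y - x) f) x)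
          \<le> e * norm (y - x)"
        by simp
    qed (rule d(1))
  qed
qed

lemma k_smooth_on_radial: "k_smooth_on k (ball a r) f \<Longrightarrow> k_smooth_on k (ball a r) (radial m a f)"
proof (induction k arbitrary: f m)
  case 0
  then show ?case by (simp add: radial_continuous)
next
  case (Suc k)
  have "k_smooth_on (Suc 0) (ball a r) f"
    using Suc.prems by (rule k_smooth_on_le) simp
  note d = radial_has_derivative[OF this]
  have "k_smooth_on k (ball a r) (radial (Suc m) a (dd v f))" for v
    using Suc by simp
  then have "k_smooth_on k (ball a r) (\<lambda>x. dd v (radial m a f) x)" for v
    by (rule k_smooth_on_cong[OF open_ball]) (simp add: dd_eq[OF d])
  moreover have "radial m a f differentiable at x" if "x \<in> ball a r" for x
    using d[OF that] unfolding differentiable_def by blast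
  ultimately show ?case
    by simp
qed

lemma smooth_on_radial: "smooth_on (ball a r) f \<Longrightarrow> smooth_on (ball a r) (radial m a f)"
  by (simp add: smooth_on_def k_smooth_on_radial)

lemma dd_radial:
  "smooth_on (ball a r) f \<Longrightarrow> x \<in> ball a r \<Longrightarrow> dd v (radial m a f) x = radial (Suc m) a (dd v f) x"
  unfolding smooth_on_def by (rule dd_eq[OF radial_has_derivative]) auto

lemma ray_has_vector_derivative:
  fixes f :: "'e::{real_inner, heine_borel} \<Rightarrow> real"
  assumes "smooth_on (ball a r) f" "x \<in> ball a r" "t \<in> {0..1}"
  shows "((\<lambda>t. f (a + t *\<^sub>R (x - a))) has_vector_derivative
    (\<Sum>b\<in>onb. ((x - a) \<bullet> b) * dd b f (a + t *\<^sub>R (x - a)))) (at t within {0..1})"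
proof -
  have df: "f differentiable at (a + t *\<^sub>R (x - a))"
    using assms smooth_on_differentiable ray_in_ball by blast
  have "((\<lambda>t. a + t *\<^sub>R (x - a)) has_derivative (\<lambda>s. s *\<^sub>R (x - a))) (at t within {0..1})"
    by (auto intro!: derivative_eq_intros)
  then have "((\<lambda>t. f (a + t *\<^sub>R (x - a))) has_derivative (\<lambda>s. dd (s *\<^sub>R (x - a)) f (a + t *\<^sub>R (x - a))))
      (at t within {0..1})"
    using dd_has_derivative[OF df] by (rule has_derivative_compose)
  then show ?thesis
    unfolding has_vector_derivative_def
    by (simp add: linear_scale[OF linear_frechet_derivative[OF df]] flip: dd_expansion[OF df])
qed

text \<open>Fundamental theorem of calculus along the ray. At \<open>x = a\<close> the factors
  \<open>radial 0 a (dd b f)\<close> are the partial derivatives of \<open>f\<close>, which is how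
  derivations are later computed in coordinates.\<close>

lemma radial_hadamard:
  fixes f :: "'e::{real_inner, heine_borel} \<Rightarrow> real"
  assumes f: "smooth_on (ball a r) f" and x: "x \<in> ball a r"
  shows "f x = f a + (\<Sum>b\<in>onb. ((x - a) \<bullet> b) * radial 0 a (dd b f) x)"
proof -
  have c: "continuous_on (ball a r) (dd b f)" for b
    using f by (intro smooth_on_continuous smooth_on_dd)
  have "((\<lambda>t. \<Sum>b\<in>onb. ((x - a) \<bullet> b) * dd b f (a + t *\<^sub>R (x - a))) has_integral
      f (a + 1 *\<^sub>R (x - a)) - f (a + 0 *\<^sub>R (x - a))) {0..1}"
    using ray_has_vector_derivative[OF f x] by (intro fundamental_theorem_of_calculus) auto
  then have "f x - f a = integral {0..1} (\<lambda>t. \<Sum>b\<in>onb. ((x - a) \<bullet> b) * dd b f (a + t *\<^sub>R (x - a)))"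
    by (simp add: integral_unique)
  also have "\<dots> = (\<Sum>b\<in>onb. integral {0..1} (\<lambda>t. ((x - a) \<bullet> b) * dd b f (a + t *\<^sub>R (x - a))))"
    using integrable_ray[OF c x, of 0] by (intro integral_sum integrable_on_mult_right) auto
  finally show ?thesis
    by (simp add: radial_def)
qed

text \<open>Integration over \<open>[0, 1]\<close> of the derivative of
  \<open>t * f (a + t (x - a))\<close>. It removes the undifferentiated term that arises when a ray
  integral of a one-form is differentiated.\<close>

lemma radial_homotopy:
  fixes f :: "'e::{real_inner, heine_borel} \<Rightarrow> real"
  assumes f: "smooth_on (ball a r) f" and x: "x \<in> ball a r"
  shows "f x = radial 0 a f x + (\<Sum>b\<in>onb. ((x - a) \<bullet> b) * radial (Suc 0) a (dd b f) x)"
proof -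
  have c: "continuous_on (ball a r) (dd b f)" for b
    using f by (intro smooth_on_continuous smooth_on_dd)
  define g where "g = (\<lambda>t. \<Sum>b\<in>onb. ((x - a) \<bullet> b) * (t * dd b f (a + t *\<^sub>R (x - a))))"
  have "((\<lambda>t. f (a + t *\<^sub>R (x - a)) + g t) has_integral
      1 *\<^sub>R f (a + 1 *\<^sub>R (x - a)) - 0 *\<^sub>R f (a + 0 *\<^sub>R (x - a))) {0..1}"
  proof (rule fundamental_theorem_of_calculus)
    fix t :: real assume t: "t \<in> {0..1}"
    have "((\<lambda>t. t *\<^sub>R f (a + t *\<^sub>R (x - a))) has_vector_derivative
        (t *\<^sub>R (\<Sum>b\<in>onb. ((x - a) \<bullet> b) * dd b f (a + t *\<^sub>R (x - a))) + 1 *\<^sub>R f (a + t *\<^sub>R (x - a))))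
        (at t within {0..1})"
      by (intro has_vector_derivative_scaleR ray_has_vector_derivative[OF f x t] DERIV_ident)
    then show "((\<lambda>t. t *\<^sub>R f (a + t *\<^sub>R (x - a))) has_vector_derivative
        (f (a + t *\<^sub>R (x - a)) + g t)) (at t within {0..1})"
      by (simp add: g_def sum_distrib_left mult.left_commute add.commute)
  qed simp
  then have "f x = integral {0..1} (\<lambda>t. f (a + t *\<^sub>R (x - a)) + g t)"
    by (simp add: integral_unique)
  also have "\<dots> = integral {0..1} (\<lambda>t. f (a + t *\<^sub>R (x - a))) + integral {0..1} g"
    using integrable_ray[OF smooth_on_continuous[OF f] x, of 0] integrable_ray[OF c x, of 1]
    unfolding g_def by (intro integral_add integrable_sum integrable_on_mult_right) auto
  also have "integral {0..1} g
      = (\<Sum>b\<in>onb. integral {0..1} (\<lambda>t. ((x - a) \<bullet> b) * (t * dd b f (a + t *\<^sub>R (x - a)))))"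
    unfolding g_def using integrable_ray[OF c x, of 1]
    by (intro integral_sum integrable_on_mult_right) auto
  finally show ?thesis
    by (simp add: radial_def)
qed

text \<open>The homotopy formula of the Poincare lemma: \<open>u = K\<alpha>\<close> satisfies \<open>du = \<alpha> - K d\<alpha>\<close>.\<close>

lemma radial_primitive:
  fixes \<alpha> :: "'e::{real_inner, heine_borel} \<Rightarrow> 'e \<Rightarrow> real"
  assumes \<alpha>: "\<And>b. b \<in> onb \<Longrightarrow> smooth_on (ball a r) (\<alpha> b)" and x: "x \<in> ball a r" and c: "c \<in> onb"
  shows "dd c (\<lambda>x. \<Sum>b\<in>onb. ((x - a) \<bullet> b) * radial 0 a (\<alpha> b) x) x =
    \<alpha> c x - (\<Sum>b\<in>onb. ((x - a) \<bullet> b) * radial (Suc 0) a (\<lambda>y. dd b (\<alpha> c) y - dd c (\<alpha> b) y) x)"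
proof -
  have d: "((\<lambda>x. \<Sum>b\<in>onb. ((x - a) \<bullet> b) * radial 0 a (\<alpha> b) x) has_derivative
      (\<lambda>v. \<Sum>b\<in>onb. ((x - a) \<bullet> b) * dd v (radial 0 a (\<alpha> b)) x + (v \<bullet> b) * radial 0 a (\<alpha> b) x)) (at x)"
  proof (intro has_derivative_sum has_derivative_mult)
    show "(radial 0 a (\<alpha> b) has_derivative (\<lambda>v. dd v (radial 0 a (\<alpha> b)) x)) (at x)"
      if "b \<in> onb" for b
      using \<alpha>[OF that] x by (intro dd_has_derivative smooth_on_differentiable[OF smooth_on_radial])
    show "((\<lambda>x. (x - a) \<bullet> b) has_derivative (\<lambda>v. v \<bullet> b)) (at x)" for b
      by (auto intro!: derivative_eq_intros)
  qed
  \<comment> \<open>Differentiating the coordinate factor leaves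
    \<open>radial 0 a (\<alpha> c)\<close>. The homotopy identity trades it for
    \<open>\<alpha> c\<close> minus a sum that merges with the remaining one into the curl of
    \<open>\<alpha>\<close>.\<close>
  have "dd c (\<lambda>x. \<Sum>b\<in>onb. ((x - a) \<bullet> b) * radial 0 a (\<alpha> b) x) x =
      (\<Sum>b\<in>onb. ((x - a) \<bullet> b) * radial (Suc 0) a (dd c (\<alpha> b)) x) + (\<Sum>b\<in>onb. (c \<bullet> b) * radial 0 a (\<alpha> b) x)"
    using dd_radial[OF \<alpha> x] by (simp add: dd_eq[OF d] sum.distrib)
  also have "(\<Sum>b\<in>onb. (c \<bullet> b) * radial 0 a (\<alpha> b) x) = (\<Sum>b\<in>onb. if c = b then radial 0 a (\<alpha> b) x else 0)"
    using c by (intro sum.cong) (auto simp: inner_onb)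
  also have "\<dots> = radial 0 a (\<alpha> c) x"
    using c by simp
  also have "radial 0 a (\<alpha> c) x
      = \<alpha> c x - (\<Sum>b\<in>onb. ((x - a) \<bullet> b) * radial (Suc 0) a (dd b (\<alpha> c)) x)"
    using radial_homotopy[OF \<alpha>[OF c] x] by simp
  also have "(\<Sum>b\<in>onb. ((x - a) \<bullet> b) * radial (Suc 0) a (dd c (\<alpha> b)) x) +
      (\<alpha> c x - (\<Sum>b\<in>onb. ((x - a) \<bullet> b) * radial (Suc 0) a (dd b (\<alpha> c)) x)) =
      \<alpha> c x - (\<Sum>b\<in>onb. ((x - a) \<bullet> b) *
        (radial (Suc 0) a (dd b (\<alpha> c)) x - radial (Suc 0) a (dd c (\<alpha> b)) x))"
    by (simp add: sum_subtractf right_diff_distrib)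
  also have "(\<Sum>b\<in>onb. ((x - a) \<bullet> b) *
        (radial (Suc 0) a (dd b (\<alpha> c)) x - radial (Suc 0) a (dd c (\<alpha> b)) x)) =
      (\<Sum>b\<in>onb. ((x - a) \<bullet> b) * radial (Suc 0) a (\<lambda>y. dd b (\<alpha> c) y - dd c (\<alpha> b) y) x)"
    using x c \<alpha> by (intro sum.cong refl)
      (simp add: radial_diff[where r = r] smooth_on_continuous smooth_on_dd)
  finally show ?thesis .
qed

section \<open>The linear Frobenius theorem\<close>

text \<open>Picard iteration \<open>u\<^sub>n\<^sub>+\<^sub>1 = K(\<beta> + a u\<^sub>n)\<close> with the ray integration operator \<open>K\<close>. By
  integrability and the homotopy formula the defect \<open>\<beta> + a u\<^sub>n - du\<^sub>n\<close> contracts up to an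
  exponentially small error, so the derivatives converge as well.\<close>

lemma linear_frobenius:
  fixes a :: "'i \<Rightarrow> 'i \<Rightarrow> 'e::{real_inner, heine_borel} \<Rightarrow> 'e \<Rightarrow> real"
    and \<beta> :: "'i \<Rightarrow> 'e \<Rightarrow> 'e \<Rightarrow> real"
  assumes I: "finite I" and S: "open S" "p \<in> S"
    and a: "\<And>i j b. i \<in> I \<Longrightarrow> j \<in> I \<Longrightarrow> b \<in> onb \<Longrightarrow> smooth_on S (a i j b)"
    and \<beta>: "\<And>i b. i \<in> I \<Longrightarrow> b \<in> onb \<Longrightarrow> smooth_on S (\<beta> i b)"
    and integ: "\<And>x i b c y. x \<in> S \<Longrightarrow> i \<in> I \<Longrightarrow> b \<in> onb \<Longrightarrow> c \<in> onb \<Longrightarrow>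
      dd b (\<beta> i c) x + (\<Sum>j\<in>I. dd b (a i j c) x * y j + a i j c x * (\<beta> j b x + (\<Sum>k\<in>I. a j k b x * y k))) =
      dd c (\<beta> i b) x + (\<Sum>j\<in>I. dd c (a i j b) x * y j + a i j b x * (\<beta> j c x + (\<Sum>k\<in>I. a j k c x * y k)))"
  obtains r u where "r > 0" "ball p r \<subseteq> S" "\<forall>i\<in>I. smooth_on (ball p r) (u i)"
    "\<forall>x\<in>ball p r. \<forall>i\<in>I. \<forall>b\<in>onb. dd b (u i) x = \<beta> i b x + (\<Sum>j\<in>I. a i j b x * u j x)"
proof -
  obtain r0 where r0: "r0 > 0" "cball p r0 \<subseteq> S"
    using S open_contains_cball by blast
  \<comment> \<open>All coefficient functions are collected in one finite set so that a single bound
    \<open>M\<close> on the compact ball serves every estimate.\<close>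
  define F where "F = (\<lambda>(i, j, b). a i j b) ` (I \<times> I \<times> onb) \<union> (\<lambda>(i, b). \<beta> i b) ` (I \<times> onb)"
  have "\<exists>M. \<forall>x\<in>cball p r0. \<bar>f x\<bar> \<le> M" if "f \<in> F" for f
  proof -
    have "continuous_on (cball p r0) f"
      using that r0(2) unfolding F_def
      by (auto intro: continuous_on_subset smooth_on_continuous[OF a] smooth_on_continuous[OF \<beta>])
    then have "bounded (f ` cball p r0)"
      by (intro compact_imp_bounded compact_continuous_image compact_cball)
    then show ?thesis
      by (auto simp: bounded_iff)
  qed
  then obtain m where m: "\<And>f x. f \<in> F \<Longrightarrow> x \<in> cball p r0 \<Longrightarrow> \<bar>f x\<bar> \<le> m f"
    by metis
  define M where "M = (\<Sum>f\<in>F. \<bar>m f\<bar>)"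
  have M0: "M \<ge> 0"
    by (simp add: M_def sum_nonneg)
  have M: "\<bar>f x\<bar> \<le> M" if "f \<in> F" "x \<in> cball p r0" for f x
  proof -
    have "finite F"
      using I by (simp add: F_def)
    then have "\<bar>m f\<bar> \<le> M"
      unfolding M_def using that(1) by (intro member_le_sum) auto
    then show ?thesis
      using m[OF that] by linarith
  qed
  \<comment> \<open>The right-hand side has Lipschitz constant \<open>N * M\<close> in the unknowns,
    and integration along rays costs a factor \<open>r * d\<close>; hence
    \<open>r * \<kappa>\<close> governs the iteration.\<close>
  define N d \<kappa> where "N = real (card I)" and "d = real (card (onb :: 'e set))" and "\<kappa> = d * N * M"
  have N0: "N \<ge> 0" and d0: "d \<ge> 0" and \<kappa>0: "\<kappa> \<ge> 0"
    using M0 by (auto simp: N_def d_def \<kappa>_def)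
  \<comment> \<open>The bound 1/4 on \<open>r * \<kappa>\<close> is dictated by the defect estimate:
    the curl has two terms, each costing \<open>r * \<kappa>\<close>, and together they may
    contribute at most a factor 1/2. The summand 1 covers \<open>\<kappa> = 0\<close>.\<close>
  define r where "r = min r0 (1 / (4 * (\<kappa> + 1)))"
  have r: "r > 0" "r \<le> r0"
    using r0 \<kappa>0 by (auto simp: r_def)
  have r\<kappa>: "r * \<kappa> \<le> 1 / 4"
  proof -
    have "r * (\<kappa> + 1) \<le> 1 / (4 * (\<kappa> + 1)) * (\<kappa> + 1)"
      using \<kappa>0 by (intro mult_right_mono) (auto simp: r_def)
    also have "\<dots> = 1 / 4"
      using \<kappa>0 by simp
    finally show ?thesis
      using r by (simp add: algebra_simps)
  qed
  let ?B = "ball p r"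
  have BS: "?B \<subseteq> S" and Bc: "?B \<subseteq> cball p r0"
    using r r0 by (auto intro: subsetD[OF r0(2)])
  have aB: "smooth_on ?B (a i j b)" if "i \<in> I" "j \<in> I" "b \<in> onb" for i j b
    using a[OF that] BS by (rule smooth_on_subset)
  have \<beta>B: "smooth_on ?B (\<beta> i b)" if "i \<in> I" "b \<in> onb" for i b
    using \<beta>[OF that] BS by (rule smooth_on_subset)
  have aM: "\<bar>a i j b x\<bar> \<le> M" if "i \<in> I" "j \<in> I" "b \<in> onb" "x \<in> ?B" for i j b x
    using that Bc by (intro M) (auto simp: F_def image_iff)
  have \<beta>M: "\<bar>\<beta> i b x\<bar> \<le> M" if "i \<in> I" "b \<in> onb" "x \<in> ?B" for i b x
    using that Bc by (intro M) (auto simp: F_def image_iff)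

  have aU: "\<bar>\<Sum>j\<in>I. a i j b x * w j\<bar> \<le> N * M * E"
    if "i \<in> I" "b \<in> onb" "x \<in> ?B" "\<And>j. j \<in> I \<Longrightarrow> \<bar>w j\<bar> \<le> E" for i b x w E
  proof -
    have "\<bar>\<Sum>j\<in>I. a i j b x * w j\<bar> \<le> (\<Sum>j\<in>I. \<bar>a i j b x * w j\<bar>)"
      by (rule sum_abs)
    also have "\<dots> \<le> (\<Sum>j\<in>I. M * E)"
      unfolding abs_mult using that aM M0 by (intro sum_mono mult_mono) auto
    finally show ?thesis
      by (simp add: N_def)
  qed
  have Kbound: "\<bar>\<Sum>b\<in>onb. ((x - p) \<bullet> b) * k b\<bar> \<le> r * d * E"
    if "x \<in> ?B" "\<And>b. b \<in> onb \<Longrightarrow> \<bar>k b\<bar> \<le> E" for x k E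
  proof -
    have "\<bar>\<Sum>b\<in>onb. ((x - p) \<bullet> b) * k b\<bar> \<le> (\<Sum>b\<in>onb. \<bar>((x - p) \<bullet> b) * k b\<bar>)"
      by (rule sum_abs)
    also have "\<dots> \<le> (\<Sum>b\<in>(onb::'e set). r * E)"
    proof (rule sum_mono)
      fix b :: 'e assume b: "b \<in> onb"
      have "\<bar>(x - p) \<bullet> b\<bar> \<le> norm (x - p)"
        using Cauchy_Schwarz_ineq2[of "x - p" b] norm_onb[OF b] by simp
      also have "\<dots> \<le> r"
        using that(1) by (simp add: dist_norm norm_minus_commute)
      finally show "\<bar>((x - p) \<bullet> b) * k b\<bar> \<le> r * E"
        unfolding abs_mult using that(2)[OF b] r by (intro mult_mono) auto
    qed
    finally show ?thesis
      by (simp add: d_def mult_ac)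
  qed

  \<comment> \<open>\<open>\<alpha> v i\<close> is the one-form that the differential of
    \<open>v i\<close> should equal. The iteration integrates it along rays from \<open>p\<close>,
    so every iterate vanishes at \<open>p\<close>.\<close>
  define \<alpha> where "\<alpha> = (\<lambda>u i b x. \<beta> i b x + (\<Sum>j\<in>I. a i j b x * u j x) :: real)"
  define u where "u = rec_nat (\<lambda>i x. 0)
    (\<lambda>n v i x. \<Sum>b\<in>onb. ((x - p) \<bullet> b) * radial 0 p (\<alpha> v i b) x)"
  have u0: "u 0 = (\<lambda>i x. 0)"
    by (simp add: u_def)
  have uS: "u (Suc n) = (\<lambda>i x. \<Sum>b\<in>onb. ((x - p) \<bullet> b) * radial 0 p (\<alpha> (u n) i b) x)" for n
    by (simp add: u_def)
  have \<alpha>_smooth: "smooth_on ?B (\<alpha> v i b)"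
    if "\<And>j. j \<in> I \<Longrightarrow> smooth_on ?B (v j)" "i \<in> I" "b \<in> onb" for v i b
    unfolding \<alpha>_def using that aB \<beta>B
    by (intro smooth_on_add smooth_on_sum smooth_on_mult open_ball) auto
  have u_smooth: "smooth_on ?B (u n i)" if "i \<in> I" for n i
    using that
  proof (induction n arbitrary: i)
    case 0
    then show ?case by (simp add: u0 smooth_on_const)
  next
    case (Suc n)
    have "smooth_on ?B (\<lambda>x. (x - p) \<bullet> b)" for b
      using smooth_on_diff[OF open_ball smooth_on_inner smooth_on_const] by (simp add: inner_diff_left)
    then show ?case
      unfolding uS using Suc
      by (intro smooth_on_sum smooth_on_mult smooth_on_radial \<alpha>_smooth open_ball) auto
  qed
  have \<alpha>u_smooth: "smooth_on ?B (\<alpha> (u n) i b)" if "i \<in> I" "b \<in> onb" for n i b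
    using u_smooth that by (rule \<alpha>_smooth)
  note cont = smooth_on_continuous[OF \<alpha>u_smooth]

  define E where "E = r * d * M"
  have E0: "E \<ge> 0"
    using r d0 M0 by (simp add: E_def)
  \<comment> \<open>The iteration contracts by 1/4; the weaker rate 1/2 is claimed because that is
    the rate of the defect below.\<close>
  have step: "\<bar>u (Suc n) i x - u n i x\<bar> \<le> E / 2 ^ n" if "x \<in> ?B" "i \<in> I" for n i x
    using that
  proof (induction n arbitrary: i x)
    case 0
    have c\<beta>: "continuous_on ?B (\<beta> i b)" if "b \<in> onb" for b
      using \<beta>B[OF 0(2) that] by (rule smooth_on_continuous)
    have "\<alpha> (u 0) i b = \<beta> i b" for b
      by (simp add: \<alpha>_def u0)
    then show ?case
      using Kbound[OF 0(1) radial_bound[OF c\<beta> 0(1)]] \<beta>M[OF 0(2)]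
      by (simp add: uS u0 E_def)
  next
    case (Suc n)
    have diff: "\<bar>\<alpha> (u (Suc n)) i b y - \<alpha> (u n) i b y\<bar> \<le> N * M * (E / 2 ^ n)"
      if "b \<in> onb" "y \<in> ?B" for b y
    proof -
      have "\<alpha> (u (Suc n)) i b y - \<alpha> (u n) i b y = (\<Sum>j\<in>I. a i j b y * (u (Suc n) j y - u n j y))"
        by (simp add: \<alpha>_def sum_subtractf right_diff_distrib)
      then show ?thesis
        using aU[OF Suc.prems(2) that Suc.IH[OF that(2)]] by simp
    qed
    have "u (Suc (Suc n)) i x - u (Suc n) i x
        = (\<Sum>b\<in>onb. ((x - p) \<bullet> b) * radial 0 p (\<alpha> (u (Suc n)) i b) x)
        - (\<Sum>b\<in>onb. ((x - p) \<bullet> b) * radial 0 p (\<alpha> (u n) i b) x)"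
      by (simp only: uS)
    also have "\<dots> = (\<Sum>b\<in>onb. ((x - p) \<bullet> b) * radial 0 p (\<lambda>y. \<alpha> (u (Suc n)) i b y - \<alpha> (u n) i b y) x)"
      using Suc.prems cont
      by (simp add: radial_diff[where r = r] sum_subtractf right_diff_distrib)
    also have "\<bar>\<dots>\<bar> \<le> r * d * (N * M * (E / 2 ^ n))"
      using Suc.prems cont diff by (intro Kbound radial_bound continuous_on_diff)
    also have "\<dots> = (r * \<kappa>) * (E / 2 ^ n)"
      by (simp add: \<kappa>_def mult_ac)
    also have "\<dots> \<le> 1 / 4 * (E / 2 ^ n)"
      using r\<kappa> E0 by (intro mult_right_mono) auto
    also have "\<dots> \<le> E / 2 ^ Suc n"
      using E0 by (simp add: field_simps)
    finally show ?case .
  qed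

  \<comment> \<open>\<open>P / 2 ^ n\<close> bounds the change of the right-hand side in one step.
    The defect \<open>e n\<close> then obeys \<open>e (n + 1) \<le> P / 2 ^ n + e n / 2\<close> with
    \<open>e 0 \<le> M\<close>, and \<open>Q * (n + 1) / 2 ^ n\<close> dominates it as soon as
    \<open>Q\<close> is at least \<open>M\<close> and \<open>2 * P\<close>.\<close>
  define P Q where "P = N * M * E" and "Q = M + 2 * P"
  have P0: "P \<ge> 0" and Q0: "Q \<ge> 0"
    using N0 M0 E0 by (auto simp: P_def Q_def)
  have defect: "\<bar>\<alpha> (u n) i c x - dd c (u n i) x\<bar> \<le> Q * (n + 1) / 2 ^ n"
    if "x \<in> ?B" "i \<in> I" "c \<in> onb" for n i c x
    using that
  proof (induction n arbitrary: i c x)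
    case 0
    then show ?case
      using \<beta>M[of i c x] P0 by (simp add: \<alpha>_def u0 Q_def)
  next
    case (Suc n)
    let ?\<Delta> = "Q * (n + 1) / 2 ^ n"
    \<comment> \<open>In the derivative of \<open>\<alpha> (u n)\<close>, replace each derivative of
      \<open>u n\<close> by the right-hand side minus the defect. Integrability makes the main part
      symmetric in \<open>b\<close> and \<open>c\<close>, so only terms linear in the defect survive
      in the curl.\<close>
    have curl: "\<bar>dd b (\<alpha> (u n) i c) y - dd c (\<alpha> (u n) i b) y\<bar> \<le> 2 * (N * M * ?\<Delta>)"
      if b: "b \<in> onb" and y: "y \<in> ?B" for b y
    proof -
      let ?\<delta> = "\<lambda>j b. \<alpha> (u n) j b y - dd b (u n j) y"
      have dda: "dd b (\<alpha> (u n) i c) y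
          = dd b (\<beta> i c) y + (\<Sum>j\<in>I. dd b (a i j c) y * u n j y + a i j c y * dd b (u n j) y)"
        if "b \<in> onb" "c \<in> onb" for b c
      proof -
        have "(\<alpha> (u n) i c has_derivative (\<lambda>v. dd v (\<beta> i c) y
            + (\<Sum>j\<in>I. a i j c y * dd v (u n j) y + dd v (a i j c) y * u n j y))) (at y)"
          unfolding \<alpha>_def
          by (intro has_derivative_add has_derivative_sum has_derivative_mult dd_has_derivative)
            (use Suc.prems(2) that y in
              \<open>auto intro: smooth_on_differentiable[OF aB] smooth_on_differentiable[OF \<beta>B]
                smooth_on_differentiable[OF u_smooth] simp del: mem_ball\<close>)
        from dd_eq[OF this] show ?thesis
          by (simp add: add.commute)
      qed
      have expand: "dd b (\<alpha> (u n) i c) y = (dd b (\<beta> i c) y + (\<Sum>j\<in>I. dd b (a i j c) y * u n j y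
          + a i j c y * (\<beta> j b y + (\<Sum>k\<in>I. a j k b y * u n k y)))) - (\<Sum>j\<in>I. a i j c y * ?\<delta> j b)"
        if "b \<in> onb" "c \<in> onb" for b c
        unfolding dda[OF that] unfolding \<alpha>_def
        by (simp add: sum.distrib sum_subtractf algebra_simps)
      \<comment> \<open>\<open>integ\<close> is assumed for every vector of values; here it is
        applied to the values of an iterate, which is not yet a solution.\<close>
      have "dd b (\<alpha> (u n) i c) y - dd c (\<alpha> (u n) i b) y
          = (\<Sum>j\<in>I. a i j b y * ?\<delta> j c) - (\<Sum>j\<in>I. a i j c y * ?\<delta> j b)"
        unfolding expand[OF b Suc.prems(3)] expand[OF Suc.prems(3) b]
        using integ[of y i b c "\<lambda>j. u n j y"] BS y b Suc.prems by auto
      moreover have "\<bar>\<Sum>j\<in>I. a i j b y * ?\<delta> j c\<bar> \<le> N * M * ?\<Delta>"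
        using Suc.IH[OF y] Suc.prems by (intro aU[OF _ b y]) auto
      moreover have "\<bar>\<Sum>j\<in>I. a i j c y * ?\<delta> j b\<bar> \<le> N * M * ?\<Delta>"
        using Suc.IH[OF y] Suc.prems b by (intro aU[OF _ _ y]) auto
      ultimately show ?thesis
        by linarith
    qed
    \<comment> \<open>Homotopy formula: the new derivative equals the old right-hand side up to the
      ray integral of the curl, which halves the defect. The change of the right-hand side adds
      \<open>P / 2 ^ n\<close>.\<close>
    have "dd c (u (Suc n) i) x = \<alpha> (u n) i c x
        - (\<Sum>b\<in>onb. ((x - p) \<bullet> b) * radial (Suc 0) p (\<lambda>y. dd b (\<alpha> (u n) i c) y - dd c (\<alpha> (u n) i b) y) x)"
      unfolding uS using Suc.prems by (intro radial_primitive[where r = r] \<alpha>u_smooth) auto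
    moreover have "\<bar>\<Sum>b\<in>onb. ((x - p) \<bullet> b) *
        radial (Suc 0) p (\<lambda>y. dd b (\<alpha> (u n) i c) y - dd c (\<alpha> (u n) i b) y) x\<bar>
        \<le> r * d * (2 * (N * M * ?\<Delta>))"
      using Suc.prems curl
      by (intro Kbound radial_bound continuous_on_diff smooth_on_continuous smooth_on_dd)
        (auto intro: \<alpha>u_smooth)
    moreover have "r * d * (2 * (N * M * ?\<Delta>)) \<le> ?\<Delta> / 2"
    proof -
      have "r * d * (2 * (N * M * ?\<Delta>)) = 2 * (r * \<kappa>) * ?\<Delta>"
        by (simp add: \<kappa>_def mult_ac)
      also have "\<dots> \<le> 2 * (1 / 4) * ?\<Delta>"
        using r\<kappa> Q0 by (intro mult_right_mono) auto
      finally show ?thesis by simp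
    qed
    moreover have "\<bar>\<alpha> (u (Suc n)) i c x - \<alpha> (u n) i c x\<bar> \<le> P / 2 ^ n"
    proof -
      have "\<alpha> (u (Suc n)) i c x - \<alpha> (u n) i c x = (\<Sum>j\<in>I. a i j c x * (u (Suc n) j x - u n j x))"
        by (simp add: \<alpha>_def sum_subtractf right_diff_distrib)
      then show ?thesis
        using aU[OF Suc.prems(2,3,1) step[OF Suc.prems(1)]] by (simp add: P_def)
    qed
    ultimately have "\<bar>\<alpha> (u (Suc n)) i c x - dd c (u (Suc n) i) x\<bar> \<le> P / 2 ^ n + ?\<Delta> / 2"
      by linarith
    also have "\<dots> = (2 * P + Q * (n + 1)) / 2 ^ Suc n"
      by (simp add: field_simps)
    also have "\<dots> \<le> Q * (Suc n + 1) / 2 ^ Suc n"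
      using M0 by (intro divide_right_mono) (auto simp: Q_def algebra_simps)
    finally show ?case .
  qed

  \<comment> \<open>The limit is written as a telescoping series for the Weierstrass test; its
    partial sums are the iterates because \<open>u 0\<close> is 0.\<close>
  define U where "U = (\<lambda>i x. \<Sum>n. u (Suc n) i x - u n i x)"
  have ulim: "uniform_limit ?B (\<lambda>n. u n i) (U i) sequentially" if "i \<in> I" for i
  proof -
    have "uniform_limit ?B (\<lambda>n x. \<Sum>k<n. u (Suc k) i x - u k i x) (U i) sequentially"
      unfolding U_def
    proof (rule Weierstrass_m_test)
      show "norm (u (Suc n) i x - u n i x) \<le> E * (1 / 2) ^ n" if "x \<in> ?B" for n x
        using step[OF that \<open>i \<in> I\<close>, of n] by (simp add: power_one_over)
      show "summable (\<lambda>n. E * (1 / 2) ^ n)"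
        by (intro summable_mult summable_geometric) simp
    qed
    moreover have "(\<Sum>k<n. u (Suc k) i x - u k i x) = u n i x" for n x
      using sum_lessThan_telescope[of "\<lambda>k. u k i x" n] by (simp add: u0)
    ultimately show ?thesis by simp
  qed
  have qlim: "(\<lambda>n. Q * (real n + 1) / 2 ^ n) \<longlonglongrightarrow> 0"
  proof -
    have "(\<lambda>n. real n * (1 / 2) ^ n) \<longlonglongrightarrow> 0"
      using powser_times_n_limit_0[of "1 / 2 :: real"] by simp
    moreover have "(\<lambda>n. (1 / 2 :: real) ^ n) \<longlonglongrightarrow> 0"
      by (rule LIMSEQ_power_zero) simp
    ultimately have "(\<lambda>n. Q * (real n * (1 / 2) ^ n + (1 / 2) ^ n)) \<longlonglongrightarrow> Q * (0 + 0)"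
      by (intro tendsto_mult tendsto_add tendsto_const)
    then show ?thesis
      by (simp add: power_one_over field_simps)
  qed
  \<comment> \<open>The defect tends to 0 and \<open>\<alpha>\<close> is Lipschitz in the unknowns,
    so the derivatives of the iterates converge uniformly to \<open>\<alpha> U\<close>.\<close>
  have dlim: "\<forall>\<^sub>F n in sequentially. \<forall>x\<in>?B. \<bar>dd b (u n i) x - \<alpha> U i b x\<bar> \<le> e"
    if e: "e > 0" and i: "i \<in> I" and b: "b \<in> onb" for e i b
  proof -
    define e' where "e' = e / (2 * (N * M + 1))"
    have e': "e' > 0" "N * M * e' \<le> e / 2"
    proof -
      show "e' > 0"
        using e N0 M0 by (auto simp: e'_def intro!: divide_pos_pos add_nonneg_pos)
      have "N * M + 1 > 0"
        using N0 M0 by (simp add: add_nonneg_pos)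
      then have "(N * M + 1) * e' = e / 2"
        by (simp add: e'_def field_simps)
      then show "N * M * e' \<le> e / 2"
        using \<open>e' > 0\<close> by (simp add: algebra_simps)
    qed
    have "\<forall>\<^sub>F n in sequentially. \<forall>j\<in>I. \<forall>x\<in>?B. dist (u n j x) (U j x) < e'"
      using ulim e'(1) I by (auto simp: eventually_ball_finite_distrib uniform_limit_iff simp del: mem_ball)
    moreover have "\<forall>\<^sub>F n in sequentially. Q * (real n + 1) / 2 ^ n < e / 2"
      using order_tendstoD(2)[OF qlim, of "e / 2"] e by simp
    ultimately show ?thesis
    proof eventually_elim
      case (elim n)
      show ?case
      proof
        fix x assume x: "x \<in> ?B"
        have "\<alpha> (u n) i b x - \<alpha> U i b x = (\<Sum>j\<in>I. a i j b x * (u n j x - U j x))"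
          by (simp add: \<alpha>_def sum_subtractf right_diff_distrib)
        then have "\<bar>\<alpha> (u n) i b x - \<alpha> U i b x\<bar> \<le> N * M * e'"
          using aU[OF i b x, of "\<lambda>j. u n j x - U j x" e'] elim(1) x by (force simp: dist_real_def)
        then show "\<bar>dd b (u n i) x - \<alpha> U i b x\<bar> \<le> e"
          using defect[OF x i b, of n, unfolded of_nat_add of_nat_1] elim(2) e'(2) by linarith
      qed
    qed
  qed
  have U_deriv: "(U i has_derivative (\<lambda>v. \<Sum>b\<in>onb. (v \<bullet> b) * \<alpha> U i b x)) (at x)"
    if i: "i \<in> I" and x: "x \<in> ?B" for i x
  proof -
    have "\<exists>g. \<forall>x\<in>?B. (\<lambda>n. u n i x) \<longlonglongrightarrow> g x \<and>
        (g has_derivative (\<lambda>v. \<Sum>b\<in>onb. (v \<bullet> b) * \<alpha> U i b x)) (at x within ?B)"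
    proof (rule has_derivative_sequence[OF convex_ball])
      show "(u n i has_derivative (\<lambda>v. dd v (u n i) x)) (at x within ?B)" if "x \<in> ?B" for n x
        using that i
        by (intro has_derivative_at_withinI[OF dd_has_derivative] smooth_on_differentiable[OF u_smooth])
      show "p \<in> ?B" using r by simp
      show "(\<lambda>n. u n i p) \<longlonglongrightarrow> U i p"
        using tendsto_uniform_limitI[OF ulim[OF i]] r by simp
      fix e :: real assume e: "0 < e"
      have "\<forall>\<^sub>F n in sequentially. \<forall>b\<in>onb. \<forall>x\<in>?B. \<bar>dd b (u n i) x - \<alpha> U i b x\<bar> \<le> e / (d + 1)"
        using dlim[OF _ i] e d0 by (intro eventually_ball_finite) auto
      then show "\<forall>\<^sub>F n in sequentially. \<forall>x\<in>?B. \<forall>v.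
          norm (dd v (u n i) x - (\<Sum>b\<in>onb. (v \<bullet> b) * \<alpha> U i b x)) \<le> e * norm v"
      proof eventually_elim
        case (elim n)
        show ?case
        proof (intro ballI allI)
          fix x v assume x: "x \<in> ?B"
          have "norm (dd v (u n i) x - (\<Sum>b\<in>onb. (v \<bullet> b) * \<alpha> U i b x))
              = \<bar>\<Sum>b\<in>onb. (v \<bullet> b) * (dd b (u n i) x - \<alpha> U i b x)\<bar>"
            by (simp add: dd_expansion[OF smooth_on_differentiable[OF u_smooth[OF i] x], where v = v]
                sum_subtractf right_diff_distrib)
          also have "\<dots> \<le> (\<Sum>b\<in>onb. \<bar>(v \<bullet> b) * (dd b (u n i) x - \<alpha> U i b x)\<bar>)"
            by (rule sum_abs)
          also have "\<dots> \<le> (\<Sum>b\<in>(onb::'e set). norm v * (e / (d + 1)))"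
          proof (rule sum_mono)
            fix b :: 'e assume b: "b \<in> onb"
            have "\<bar>v \<bullet> b\<bar> \<le> norm v"
              using Cauchy_Schwarz_ineq2[of v b] norm_onb[OF b] by simp
            then show "\<bar>(v \<bullet> b) * (dd b (u n i) x - \<alpha> U i b x)\<bar> \<le> norm v * (e / (d + 1))"
              unfolding abs_mult using elim b x by (intro mult_mono) auto
          qed
          also have "\<dots> = d / (d + 1) * (e * norm v)"
            by (simp add: d_def)
          also have "\<dots> \<le> 1 * (e * norm v)"
            using d0 e by (intro mult_right_mono) auto
          finally show "norm (dd v (u n i) x - (\<Sum>b\<in>onb. (v \<bullet> b) * \<alpha> U i b x)) \<le> e * norm v"
            by simp
        qed
      qed
    qed
    then obtain g where g: "\<And>x. x \<in> ?B \<Longrightarrow> (\<lambda>n. u n i x) \<longlonglongrightarrow> g x"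
      "\<And>x. x \<in> ?B \<Longrightarrow> (g has_derivative (\<lambda>v. \<Sum>b\<in>onb. (v \<bullet> b) * \<alpha> U i b x)) (at x within ?B)"
      by blast
    have "g x = U i x" if "x \<in> ?B" for x
      using g(1)[OF that] tendsto_uniform_limitI[OF ulim[OF i] that] LIMSEQ_unique by blast
    then show ?thesis
      using g(2)[OF x] x at_within_open[OF x open_ball]
      by (auto intro: has_derivative_transform_within_open[OF _ open_ball x] simp del: mem_ball)
  qed
  \<comment> \<open>Bootstrapping: the equation expresses the derivatives of \<open>U\<close>
    through \<open>U\<close> itself and smooth coefficients, so each order of smoothness yields the
    next.\<close>
  have U_k: "k_smooth_on k ?B (U i)" if "i \<in> I" for k i
    using that
  proof (induction k arbitrary: i)
    case 0
    then show ?case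
      using has_derivative_continuous[OF U_deriv] by (simp add: continuous_at_imp_continuous_on)
  next
    case (Suc k)
    have "k_smooth_on k ?B (\<lambda>x. \<Sum>b\<in>onb. (v \<bullet> b) * \<alpha> U i b x)" for v
      unfolding \<alpha>_def using Suc aB \<beta>B
      by (intro k_smooth_on_sum k_smooth_on_mult k_smooth_on_add k_smooth_on_const open_ball)
        (auto simp: smooth_on_def)
    then have "k_smooth_on k ?B (\<lambda>x. dd v (U i) x)" for v
      by (rule k_smooth_on_cong[OF open_ball]) (simp only: dd_eq[OF U_deriv[OF Suc.prems]])
    moreover have "U i differentiable at x" if "x \<in> ?B" for x
      using U_deriv[OF Suc.prems that] unfolding differentiable_def by blast
    ultimately show ?case
      by simp
  qed
  show thesis
  proof (rule that[OF r(1) BS]; intro ballI)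
    show "smooth_on ?B (U i)" if "i \<in> I" for i
      using U_k[OF that] by (simp add: smooth_on_def)
  next
    fix x i b assume x: "x \<in> ?B" and i: "i \<in> I" and b: "b \<in> (onb :: 'e set)"
    have "dd b (U i) x = (\<Sum>c\<in>onb. (b \<bullet> c) * \<alpha> U i c x)"
      by (rule dd_eq[OF U_deriv[OF i x]])
    also have "\<dots> = (\<Sum>c\<in>onb. if b = c then \<alpha> U i c x else 0)"
      using b by (intro sum.cong) (auto simp: inner_onb)
    also have "\<dots> = \<alpha> U i b x"
      using b by simp
    finally show "dd b (U i) x = \<beta> i b x + (\<Sum>j\<in>I. a i j b x * U j x)"
      by (simp add: \<alpha>_def)
  qed
qed

section \<open>Smooth functions on a manifold\<close>

locale smooth_mfd =
  fixes A :: "('m::{t2_space, second_countable_topology}, 'e::{real_inner, heine_borel}) atlas"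
  assumes mfd: "smooth_manifold A"
begin

lemma chart_at: obtains V \<phi> where "(V, \<phi>) \<in> A" "p \<in> V"
proof -
  have "p \<in> (\<Union>(U, \<phi>)\<in>A. U)"
    using mfd unfolding smooth_manifold_def by simp
  then show thesis
    using that by auto
qed

lemma
  assumes "(V, \<phi>) \<in> A"
  shows chart_open: "open V" and chart_image: "open (\<phi> ` V)"
    and chart_homeo: "homeomorphism V (\<phi> ` V) \<phi> (inv_into V \<phi>)"
  using mfd assms unfolding smooth_manifold_def by blast+

lemma chart_transition:
  "(V, \<phi>) \<in> A \<Longrightarrow> (W, \<psi>) \<in> A \<Longrightarrow> smooth_on (\<phi> ` (V \<inter> W)) (\<psi> \<circ> inv_into V \<phi>)"
  using mfd unfolding smooth_manifold_def by fast

lemma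
  assumes "(V, \<phi>) \<in> A"
  shows chart_inv: "q \<in> V \<Longrightarrow> inv_into V \<phi> (\<phi> q) = q"
    and chart_continuous: "continuous_on V \<phi>"
    and chart_inv_continuous: "continuous_on (\<phi> ` V) (inv_into V \<phi>)"
  using chart_homeo[OF assms] unfolding homeomorphism_def by blast+

lemma chart_preimage_open: "(V, \<phi>) \<in> A \<Longrightarrow> open T \<Longrightarrow> open (V \<inter> \<phi> -` T)"
  by (rule continuous_open_preimage[OF chart_continuous chart_open])

lemma chart_image_open:
  assumes "(V, \<phi>) \<in> A" "open U" "U \<subseteq> V"
  shows "open (\<phi> ` U)"
proof -
  have "\<phi> ` U = \<phi> ` V \<inter> inv_into V \<phi> -` U"
    using assms(3) chart_inv[OF assms(1)] by auto
  then show ?thesis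
    using continuous_open_preimage[OF chart_inv_continuous chart_image] assms by metis
qed

lemma chart_image_Int_open: "(V, \<phi>) \<in> A \<Longrightarrow> open U \<Longrightarrow> open (\<phi> ` (U \<inter> V))"
  by (rule chart_image_open) (auto intro: chart_open)

lemma smooth_funD:
  "smooth_fun A U f \<Longrightarrow> (V, \<phi>) \<in> A \<Longrightarrow> smooth_on (\<phi> ` (U \<inter> V)) (f \<circ> inv_into V \<phi>)"
  unfolding smooth_fun_def by fast

lemma smooth_funI:
  "(\<And>V \<phi>. (V, \<phi>) \<in> A \<Longrightarrow> smooth_on (\<phi> ` (U \<inter> V)) (f \<circ> inv_into V \<phi>)) \<Longrightarrow> smooth_fun A U f"
  unfolding smooth_fun_def by fast

lemma smooth_fun_subset: "smooth_fun A U f \<Longrightarrow> T \<subseteq> U \<Longrightarrow> smooth_fun A T f"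
  by (rule smooth_funI, drule (1) smooth_funD, erule smooth_on_subset) auto

lemma smooth_fun_cong:
  assumes "open U" "smooth_fun A U f" "\<And>q. q \<in> U \<Longrightarrow> f q = g q"
  shows "smooth_fun A U g"
proof (rule smooth_funI)
  fix V \<phi> assume V: "(V, \<phi>) \<in> A"
  show "smooth_on (\<phi> ` (U \<inter> V)) (g \<circ> inv_into V \<phi>)"
    by (rule smooth_on_cong[OF chart_image_Int_open[OF V assms(1)] smooth_funD[OF assms(2) V]])
      (auto simp: assms(3) chart_inv[OF V])
qed

lemma smooth_fun_local:
  assumes "\<And>q. q \<in> U \<Longrightarrow> \<exists>N. open N \<and> q \<in> N \<and> smooth_fun A N f"
  shows "smooth_fun A U f"
proof (rule smooth_funI, rule smooth_on_local)
  fix V \<phi> x assume V: "(V, \<phi>) \<in> A" and "x \<in> \<phi> ` (U \<inter> V)"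
  then obtain q where q: "q \<in> U" "q \<in> V" "x = \<phi> q" by auto
  obtain N where N: "open N" "q \<in> N" "smooth_fun A N f"
    using assms[OF q(1)] by auto
  show "\<exists>T. open T \<and> x \<in> T \<and> smooth_on T (f \<circ> inv_into V \<phi>)"
    using q N chart_image_Int_open[OF V N(1)] smooth_funD[OF N(3) V]
    by (intro exI[of _ "\<phi> ` (N \<inter> V)"]) auto
qed

lemma smooth_fun_const [simp]: "smooth_fun A U (\<lambda>q. c)"
  by (rule smooth_funI) (simp add: o_def smooth_on_const)

lemma smooth_fun_add:
  assumes "open U" "smooth_fun A U f" "smooth_fun A U g"
  shows "smooth_fun A U (\<lambda>q. f q + g q)"
proof (rule smooth_funI)
  fix V \<phi> assume V: "(V, \<phi>) \<in> A"
  show "smooth_on (\<phi> ` (U \<inter> V)) ((\<lambda>q. f q + g q) \<circ> inv_into V \<phi>)"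
    unfolding o_def
    by (rule smooth_on_add[OF chart_image_Int_open[OF V assms(1)]
          smooth_funD[OF assms(2) V, unfolded o_def] smooth_funD[OF assms(3) V, unfolded o_def]])
qed

lemma smooth_fun_mult:
  assumes "open U" "smooth_fun A U f" "smooth_fun A U g"
  shows "smooth_fun A U (\<lambda>q. f q * g q)"
proof (rule smooth_funI)
  fix V \<phi> assume V: "(V, \<phi>) \<in> A"
  show "smooth_on (\<phi> ` (U \<inter> V)) ((\<lambda>q. f q * g q) \<circ> inv_into V \<phi>)"
    unfolding o_def
    by (rule smooth_on_mult[OF chart_image_Int_open[OF V assms(1)]
          smooth_funD[OF assms(2) V, unfolded o_def] smooth_funD[OF assms(3) V, unfolded o_def]])
qed

lemma smooth_fun_diff:
  assumes "open U" "smooth_fun A U f" "smooth_fun A U g"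
  shows "smooth_fun A U (\<lambda>q. f q - g q)"
  using smooth_fun_add[OF assms(1,2) smooth_fun_mult[OF assms(1) smooth_fun_const[of U "-1"] assms(3)]]
  by simp

lemma smooth_fun_sum:
  assumes "open U" "\<And>i. i \<in> I \<Longrightarrow> smooth_fun A U (f i)"
  shows "smooth_fun A U (\<lambda>q. \<Sum>i\<in>I. f i q)"
  using assms(2)
  by (induction I rule: infinite_finite_induct) (simp_all add: smooth_fun_add assms(1))

lemma smooth_fun_inverse:
  assumes "open U" "smooth_fun A U f" "\<And>q. q \<in> U \<Longrightarrow> f q \<noteq> 0"
  shows "smooth_fun A U (\<lambda>q. inverse (f q))"
proof (rule smooth_funI)
  fix V \<phi> assume V: "(V, \<phi>) \<in> A"
  show "smooth_on (\<phi> ` (U \<inter> V)) ((\<lambda>q. inverse (f q)) \<circ> inv_into V \<phi>)"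
    unfolding o_def
    by (rule smooth_on_inverse[OF chart_image_Int_open[OF V assms(1)]
          smooth_funD[OF assms(2) V, unfolded o_def]]) (auto simp: assms(3) chart_inv[OF V])
qed

text \<open>Transition maps carry smoothness from one chart to all others, so functions can be built
  and tested in a single chart.\<close>

lemma smooth_fun_chartI:
  assumes V: "(V, \<phi>) \<in> A" and U: "open U" "U \<subseteq> V" and f: "smooth_on (\<phi> ` U) (f \<circ> inv_into V \<phi>)"
  shows "smooth_fun A U f"
proof (rule smooth_funI)
  fix W \<psi> assume W: "(W, \<psi>) \<in> A"
  have o: "open (\<psi> ` (U \<inter> W))"
    by (rule chart_image_Int_open[OF W U(1)])
  have "smooth_on (\<psi> ` (U \<inter> W)) (\<phi> \<circ> inv_into W \<psi>)"
    by (rule smooth_on_subset[OF chart_transition[OF W V]]) (use U in auto)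
  then have "smooth_on (\<psi> ` (U \<inter> W)) (\<lambda>x. (f \<circ> inv_into V \<phi>) ((\<phi> \<circ> inv_into W \<psi>) x))"
    by (rule smooth_on_compose[OF o chart_image_open[OF V U] _ f]) (auto simp: chart_inv[OF W])
  then show "smooth_on (\<psi> ` (U \<inter> W)) (f \<circ> inv_into W \<psi>)"
    by (rule smooth_on_cong[OF o]) (use U in \<open>auto simp: chart_inv[OF W] chart_inv[OF V]\<close>)
qed

lemma smooth_fun_chartD:
  "smooth_fun A U f \<Longrightarrow> (V, \<phi>) \<in> A \<Longrightarrow> U \<subseteq> V \<Longrightarrow> smooth_on (\<phi> ` U) (f \<circ> inv_into V \<phi>)"
  using smooth_funD by (metis inf.absorb1)

lemma smooth_fun_pullback:
  assumes V: "(V, \<phi>) \<in> A" and U: "open U" "U \<subseteq> V" and g: "smooth_on T g" "\<phi> ` U \<subseteq> T"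
  shows "smooth_fun A U (\<lambda>q. g (\<phi> q))"
proof (rule smooth_fun_chartI[OF V U])
  show "smooth_on (\<phi> ` U) ((\<lambda>q. g (\<phi> q)) \<circ> inv_into V \<phi>)"
    by (rule smooth_on_cong[OF chart_image_open[OF V U] smooth_on_subset[OF g]])
      (use U in \<open>auto simp: chart_inv[OF V]\<close>)
qed

lemma smooth_fun_coord: "(V, \<phi>) \<in> A \<Longrightarrow> smooth_fun A V (\<lambda>q. \<phi> q \<bullet> b)"
  using smooth_fun_pullback[OF _ _ _ smooth_on_inner[of UNIV b]] chart_open by simp

lemma smooth_fun_continuous:
  assumes "open U" "smooth_fun A U f"
  shows "continuous_on U f"
proof -
  have "isCont f q" if "q \<in> U" for q
  proof -
    obtain V \<phi> where V: "(V, \<phi>) \<in> A" "q \<in> V"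
      by (rule chart_at)
    have "continuous_on (\<phi> ` (U \<inter> V)) (f \<circ> inv_into V \<phi>)"
      by (rule smooth_on_continuous[OF smooth_funD[OF assms(2) V(1)]])
    moreover have "continuous_on (U \<inter> V) \<phi>"
      using chart_continuous[OF V(1)] by (rule continuous_on_subset) simp
    ultimately have "continuous_on (U \<inter> V) ((f \<circ> inv_into V \<phi>) \<circ> \<phi>)"
      by (rule continuous_on_compose[rotated])
    then have "continuous_on (U \<inter> V) f"
      by (rule continuous_on_eq) (simp add: chart_inv[OF V(1)])
    then show ?thesis
      using assms(1) that V chart_open[OF V(1)] by (simp add: continuous_on_eq_continuous_at open_Int)
  qed
  then show ?thesis
    by (simp add: continuous_at_imp_continuous_on)
qed

lemma smooth_fun_nonzero_open:
  assumes "smooth_fun A UNIV f" "f p \<noteq> 0"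
  obtains N where "open N" "p \<in> N" "\<forall>q\<in>N. f q \<noteq> 0"
proof
  have "continuous_on UNIV f"
    using assms by (simp add: smooth_fun_continuous)
  then show "open (f -` (- {0}))"
    by (rule open_vimage[rotated]) (simp add: open_Compl)
qed (use assms in auto)

text \<open>The open set \<open>K\<close> is recorded because \<open>W\<close> and \<open>K\<close>
  cover the manifold: a smooth function on \<open>W\<close>, multiplied by \<open>\<tau>\<close> and
  extended by zero, is then smooth on each member of an open cover.\<close>

lemma bump_function:
  assumes "open W" "p \<in> W"
  obtains \<tau> N K where "smooth_fun A UNIV \<tau>" "open N" "p \<in> N" "N \<subseteq> W" "\<forall>q\<in>N. \<tau> q = 1"
    "open K" "W \<union> K = UNIV" "\<forall>q\<in>K. \<tau> q = 0"
proof -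
  obtain V \<phi> where V: "(V, \<phi>) \<in> A" "p \<in> V"
    by (rule chart_at)
  have "open (\<phi> ` (W \<inter> V))" "\<phi> p \<in> \<phi> ` (W \<inter> V)"
    using chart_image_Int_open[OF V(1) assms(1)] V assms by auto
  then obtain r where r: "r > 0" "cball (\<phi> p) r \<subseteq> \<phi> ` (W \<inter> V)"
    using open_contains_cball by blast
  obtain \<beta> :: "'e \<Rightarrow> real" where "smooth_on UNIV \<beta>" "\<And>x. dist (\<phi> p) x < r / 2 \<Longrightarrow> \<beta> x = 1"
    "\<And>x. r \<le> dist (\<phi> p) x \<Longrightarrow> \<beta> x = 0"
    using bump_exists[OF r(1)] by metis
  note \<beta> = this
  define C where "C = inv_into V \<phi> ` cball (\<phi> p) r"
  have "compact C"
    unfolding C_def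
    by (rule compact_continuous_image[OF continuous_on_subset[OF chart_inv_continuous[OF V(1)]]])
      (use r(2) in auto)
  \<comment> \<open>Here the Hausdorff property enters: the compact set \<open>C\<close> is closed,
    so its complement is open and extension by zero is harmless.\<close>
  then have oK: "open (- C)"
    by (simp add: compact_imp_closed open_Compl)
  have CW: "C \<subseteq> W \<inter> V"
    using r(2) chart_inv[OF V(1)] by (force simp: C_def)
  define \<tau> where "\<tau> = (\<lambda>q. if q \<in> V then \<beta> (\<phi> q) else 0)"
  have \<tau>0: "\<tau> q = 0" if "q \<in> - C" for q
  proof (cases "q \<in> V")
    case True
    then have "\<phi> q \<notin> cball (\<phi> p) r"
      using that chart_inv[OF V(1) True] unfolding C_def by (metis ComplD imageI)
    then show ?thesis
      using True \<beta>(3) by (simp add: \<tau>_def)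
  qed (simp add: \<tau>_def)
  have "smooth_fun A V (\<lambda>q. \<beta> (\<phi> q))"
    by (rule smooth_fun_pullback[OF V(1) chart_open[OF V(1)] _ \<beta>(1)]) auto
  then have "smooth_fun A V \<tau>"
    by (rule smooth_fun_cong[OF chart_open[OF V(1)]]) (simp add: \<tau>_def)
  moreover have "smooth_fun A (- C) \<tau>"
    by (rule smooth_fun_cong[OF oK smooth_fun_const[of _ 0]]) (simp add: \<tau>0)
  ultimately have "smooth_fun A UNIV \<tau>"
    using CW oK chart_open[OF V(1)] by (intro smooth_fun_local) blast
  moreover have "open (V \<inter> \<phi> -` ball (\<phi> p) (r / 2))"
    by (rule chart_preimage_open[OF V(1) open_ball])
  moreover have "V \<inter> \<phi> -` ball (\<phi> p) (r / 2) \<subseteq> W"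
  proof
    fix q assume q: "q \<in> V \<inter> \<phi> -` ball (\<phi> p) (r / 2)"
    then have "\<phi> q \<in> \<phi> ` (W \<inter> V)"
      using r by (intro subsetD[OF r(2)]) auto
    then show "q \<in> W"
      using q chart_inv[OF V(1)] by (metis IntD1 IntD2 imageE)
  qed
  moreover have "W \<union> - C = UNIV"
    using CW by blast
  ultimately show thesis
    using that[of \<tau> "V \<inter> \<phi> -` ball (\<phi> p) (r / 2)" "- C"] V r oK CW \<tau>0 \<beta>(2)
    by (auto simp: \<tau>_def)
qed

text \<open>Scaling of fields in the axioms of \<open>connection\<close> uses globally smooth
  functions, so local coefficients are exchanged for global ones at the price of a smaller
  neighbourhood.\<close>

lemma extend_function:
  assumes "open W" "p \<in> W" "smooth_fun A W f"
  obtains g N where "smooth_fun A UNIV g" "open N" "p \<in> N" "N \<subseteq> W" "\<forall>q\<in>N. g q = f q"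
proof -
  obtain \<tau> N K where \<tau>: "smooth_fun A UNIV \<tau>" "open N" "p \<in> N" "N \<subseteq> W" "\<forall>q\<in>N. \<tau> q = 1"
    "open K" "W \<union> K = UNIV" "\<forall>q\<in>K. \<tau> q = 0"
    by (rule bump_function[OF assms(1,2)])
  define g where "g = (\<lambda>q. if q \<in> W then \<tau> q * f q else 0)"
  have "smooth_fun A W (\<lambda>q. \<tau> q * f q)"
    by (rule smooth_fun_mult[OF assms(1) smooth_fun_subset[OF \<tau>(1)] assms(3)]) simp
  then have "smooth_fun A W g"
    by (rule smooth_fun_cong[OF assms(1)]) (simp add: g_def)
  moreover have "smooth_fun A K g"
    by (rule smooth_fun_cong[OF \<tau>(6) smooth_fun_const[of _ 0]]) (simp add: g_def \<tau>(8))
  ultimately have "smooth_fun A UNIV g"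
    using \<tau>(6,7) assms(1) by (intro smooth_fun_local) blast
  then show thesis
  proof (rule that[OF _ \<tau>(2-4)])
    show "\<forall>q\<in>N. g q = f q"
      using \<tau>(4,5) by (auto simp: g_def)
  qed
qed

section \<open>Germs of smooth functions\<close>

lemma smooth_nearI: "open U \<Longrightarrow> p \<in> U \<Longrightarrow> smooth_fun A U f \<Longrightarrow> smooth_near A p f"
  unfolding smooth_near_def by blast

lemma smooth_near_cong:
  assumes "open N" "p \<in> N" "\<And>q. q \<in> N \<Longrightarrow> f q = g q"
  shows "smooth_near A p f \<longleftrightarrow> smooth_near A p g"
proof -
  have "smooth_near A p g" if fg: "\<And>q. q \<in> N \<Longrightarrow> f q = g q" "smooth_near A p f" for f g
  proof -
    obtain U where U: "open U" "p \<in> U" "smooth_fun A U f"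
      using fg(2) unfolding smooth_near_def by blast
    have "smooth_fun A (U \<inter> N) g"
      by (rule smooth_fun_cong[OF _ smooth_fun_subset[OF U(3)]]) (use U assms fg in auto)
    then show ?thesis
      using U assms(1,2) by (intro smooth_nearI[of "U \<inter> N"]) auto
  qed
  then show ?thesis
    using assms(3) by metis
qed

lemma smooth_near_global: "smooth_fun A UNIV f \<Longrightarrow> smooth_near A p f"
  by (rule smooth_nearI[of UNIV]) auto

lemma smooth_near_const: "smooth_near A p (\<lambda>q. c)"
  by (rule smooth_near_global) simp

lemma
  assumes "smooth_near A p f" "smooth_near A p g"
  shows smooth_near_add: "smooth_near A p (\<lambda>q. f q + g q)"
    and smooth_near_mult: "smooth_near A p (\<lambda>q. f q * g q)"
proof -
  obtain U T where U: "open U" "p \<in> U" "smooth_fun A U f" and T: "open T" "p \<in> T" "smooth_fun A T g"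
    using assms unfolding smooth_near_def by blast
  have *: "smooth_fun A (U \<inter> T) f" "smooth_fun A (U \<inter> T) g" "open (U \<inter> T)" "p \<in> U \<inter> T"
    using U T smooth_fun_subset by auto
  show "smooth_near A p (\<lambda>q. f q + g q)" "smooth_near A p (\<lambda>q. f q * g q)"
    by (rule smooth_nearI[of "U \<inter> T"], use * smooth_fun_add smooth_fun_mult in auto)+
qed

lemma smooth_near_sum:
  "(\<And>i. i \<in> I \<Longrightarrow> smooth_near A p (f i)) \<Longrightarrow> smooth_near A p (\<lambda>q. \<Sum>i\<in>I. f i q)"
  by (induction I rule: infinite_finite_induct) (simp_all add: smooth_near_add smooth_near_const)

section \<open>Tangent vectors and coordinate frames\<close>

lemma
  assumes "v \<in> tangent_space A p"
  shows tangent_add: "smooth_near A p f \<Longrightarrow> smooth_near A p g \<Longrightarrow> v (\<lambda>q. f q + g q) = v f + v g"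
    and tangent_mult: "smooth_near A p f \<Longrightarrow> smooth_near A p g \<Longrightarrow>
      v (\<lambda>q. f q * g q) = v f * g p + f p * v g"
    and tangent_cmult: "smooth_near A p f \<Longrightarrow> v (\<lambda>q. c * f q) = c * v f"
    and tangent_germ: "smooth_near A p f \<Longrightarrow> smooth_near A p g \<Longrightarrow>
      \<forall>\<^sub>F q in nhds p. f q = g q \<Longrightarrow> v f = v g"
    and tangent_not_smooth: "\<not> smooth_near A p f \<Longrightarrow> v f = 0"
proof -
  note v = assms[unfolded tangent_space_def mem_Collect_eq]
  note v1 = conjunct1[OF v] and v2 = conjunct1[OF conjunct2[OF v]]
    and v3 = conjunct1[OF conjunct2[OF conjunct2[OF v]]]
    and v4 = conjunct2[OF conjunct2[OF conjunct2[OF v]]]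
  show "smooth_near A p f \<Longrightarrow> smooth_near A p g \<Longrightarrow> v (\<lambda>q. f q + g q) = v f + v g"
    "smooth_near A p f \<Longrightarrow> smooth_near A p g \<Longrightarrow> v (\<lambda>q. f q * g q) = v f * g p + f p * v g"
    by (rule v1[rule_format, THEN conjunct1] v1[rule_format, THEN conjunct2]; assumption)+
  show "smooth_near A p f \<Longrightarrow> v (\<lambda>q. c * f q) = c * v f"
    by (rule v2[rule_format])
  show "smooth_near A p f \<Longrightarrow> smooth_near A p g \<Longrightarrow> \<forall>\<^sub>F q in nhds p. f q = g q \<Longrightarrow> v f = v g"
    by (rule v3[rule_format])
  show "\<not> smooth_near A p f \<Longrightarrow> v f = 0"
    by (rule v4[rule_format])
qed

text \<open>Smoothness near \<open>p\<close> is itself a property of the germ; where it fails, both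
  sides are the default value 0.\<close>

lemma tangent_cong:
  assumes v: "v \<in> tangent_space A p" and N: "open N" "p \<in> N" "\<And>q. q \<in> N \<Longrightarrow> f q = g q"
  shows "v f = v g"
proof -
  have sn: "smooth_near A p f \<longleftrightarrow> smooth_near A p g"
    using N by (rule smooth_near_cong)
  show ?thesis
  proof (cases "smooth_near A p f")
    case True
    moreover have "\<forall>\<^sub>F q in nhds p. f q = g q"
      using N unfolding eventually_nhds by blast
    ultimately show ?thesis
      using tangent_germ[OF v, of f g] sn by simp
  next
    case False
    then show ?thesis
      using tangent_not_smooth[OF v] sn by simp
  qed
qed

text \<open>The product rule for \<open>1 * 1\<close> gives \<open>v 1 = 2 * v 1\<close>;
  homogeneity does the rest.\<close>

lemma tangent_const: "v \<in> tangent_space A p \<Longrightarrow> v (\<lambda>q. c) = 0"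
  using tangent_mult[of v p "\<lambda>_. 1" "\<lambda>_. 1"] tangent_cmult[of v p "\<lambda>_. 1" c]
  by (simp add: smooth_near_const)

lemma tangent_sum:
  assumes "v \<in> tangent_space A p" "\<And>i. i \<in> I \<Longrightarrow> smooth_near A p (f i)"
  shows "v (\<lambda>q. \<Sum>i\<in>I. f i q) = (\<Sum>i\<in>I. v (f i))"
  using assms(2)
  by (induction I rule: infinite_finite_induct)
    (simp_all add: tangent_const[OF assms(1)] tangent_add[OF assms(1)] smooth_near_sum)

lemma tangent_diff:
  assumes v: "v \<in> tangent_space A p" and f: "smooth_near A p f" and g: "smooth_near A p g"
  shows "v (\<lambda>q. f q - g q) = v f - v g"
  using tangent_add[OF v f, of "\<lambda>q. - 1 * g q"] tangent_cmult[OF v g, of "- 1"]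
    smooth_near_mult[OF smooth_near_const g, of "- 1"] by simp

lemma tangent_spaceI:
  assumes "\<And>f g. smooth_near A p f \<Longrightarrow> smooth_near A p g \<Longrightarrow> v (\<lambda>q. f q + g q) = v f + v g"
    and "\<And>f g. smooth_near A p f \<Longrightarrow> smooth_near A p g \<Longrightarrow> v (\<lambda>q. f q * g q) = v f * g p + f p * v g"
    and "\<And>c f. smooth_near A p f \<Longrightarrow> v (\<lambda>q. c * f q) = c * v f"
    and "\<And>f g. smooth_near A p f \<Longrightarrow> smooth_near A p g \<Longrightarrow> \<forall>\<^sub>F q in nhds p. f q = g q \<Longrightarrow> v f = v g"
    and "\<And>f. \<not> smooth_near A p f \<Longrightarrow> v f = 0"
  shows "v \<in> tangent_space A p"
  unfolding tangent_space_def mem_Collect_eq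
  by (intro conjI allI impI; rule assms; assumption)

lemma tangent_space_zero: "(\<lambda>f. 0) \<in> tangent_space A p"
  by (rule tangent_spaceI) simp_all

lemma tangent_space_add:
  assumes v: "v \<in> tangent_space A p" and w: "w \<in> tangent_space A p"
  shows "(\<lambda>f. v f + w f) \<in> tangent_space A p"
proof (rule tangent_spaceI)
  show "v f + w f = v g + w g"
    if "smooth_near A p f" "smooth_near A p g" "\<forall>\<^sub>F q in nhds p. f q = g q" for f g
    using tangent_germ[OF v that] tangent_germ[OF w that] by simp
qed (simp_all add: tangent_add[OF v] tangent_add[OF w] tangent_mult[OF v] tangent_mult[OF w]
    tangent_cmult[OF v] tangent_cmult[OF w] tangent_not_smooth[OF v] tangent_not_smooth[OF w]
    algebra_simps)

lemma tangent_space_scale: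
  assumes v: "v \<in> tangent_space A p"
  shows "(\<lambda>f. c * v f) \<in> tangent_space A p"
proof (rule tangent_spaceI)
  show "c * v f = c * v g"
    if "smooth_near A p f" "smooth_near A p g" "\<forall>\<^sub>F q in nhds p. f q = g q" for f g
    using tangent_germ[OF v that] by simp
qed (simp_all add: tangent_add[OF v] tangent_mult[OF v] tangent_cmult[OF v]
    tangent_not_smooth[OF v] algebra_simps)

lemma tangent_space_sum:
  "(\<And>i. i \<in> I \<Longrightarrow> v i \<in> tangent_space A p) \<Longrightarrow> (\<lambda>f. \<Sum>i\<in>I. v i f) \<in> tangent_space A p"
  by (induction I rule: infinite_finite_induct) (simp_all add: tangent_space_add tangent_space_zero)

text \<open>Coordinate derivation in an arbitrary direction \<open>b\<close> of the model space. The
  branch 0 follows the convention of \<open>tangent_space\<close> for functions that are not smooth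
  near \<open>q\<close>.\<close>

definition coord_vec :: "'m set \<Rightarrow> ('m \<Rightarrow> 'e) \<Rightarrow> 'e \<Rightarrow> 'm \<Rightarrow> 'm tangent_vector" where
  "coord_vec V \<phi> b q = (\<lambda>f. if smooth_near A q f then dd b (f \<circ> inv_into V \<phi>) (\<phi> q) else 0)"

lemma smooth_near_differentiable:
  assumes "(V, \<phi>) \<in> A" "q \<in> V" "smooth_near A q f"
  shows "(f \<circ> inv_into V \<phi>) differentiable at (\<phi> q)"
proof -
  obtain U where "open U" "q \<in> U" "smooth_fun A U f"
    using assms(3) unfolding smooth_near_def by blast
  then show ?thesis
    using smooth_on_differentiable[OF smooth_funD[OF _ assms(1)]] assms(2) by blast
qed

lemma coord_vec_tangent:
  assumes V: "(V, \<phi>) \<in> A" "q \<in> V"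
  shows "coord_vec V \<phi> b q \<in> tangent_space A q"
proof -
  let ?c = "coord_vec V \<phi> b q" and ?i = "inv_into V \<phi>"
  note d = dd_has_derivative[OF smooth_near_differentiable[OF V], unfolded o_def]
  have "?c (\<lambda>q. f q + g q) = ?c f + ?c g \<and> ?c (\<lambda>q. f q * g q) = ?c f * g q + f q * ?c g"
    if fg: "smooth_near A q f" "smooth_near A q g" for f g
    using dd_eq[OF has_derivative_add[OF d[OF fg(1)] d[OF fg(2)]], of b]
      dd_eq[OF has_derivative_mult[OF d[OF fg(1)] d[OF fg(2)]], of b] fg
    by (simp add: coord_vec_def smooth_near_add smooth_near_mult o_def chart_inv[OF V])
  moreover have "?c (\<lambda>q. c * f q) = c * ?c f" if f: "smooth_near A q f" for c f
    using dd_eq[OF has_derivative_mult_right[OF d[OF f]], of c b] f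
    by (simp add: coord_vec_def smooth_near_mult smooth_near_const o_def)
  moreover have "?c f = ?c g"
    if f: "smooth_near A q f" and fg: "\<forall>\<^sub>F q in nhds q. f q = g q" for f g
  proof -
    obtain N where N: "open N" "q \<in> N" "\<And>x. x \<in> N \<Longrightarrow> f x = g x"
      using fg unfolding eventually_nhds by blast
    have "frechet_derivative (f \<circ> ?i) (at (\<phi> q)) = frechet_derivative (g \<circ> ?i) (at (\<phi> q))"
      using N V
      by (intro frechet_derivative_transform_within_open[OF smooth_near_differentiable[OF V f]
            chart_image_Int_open[OF V(1) N(1)]]) (auto simp: chart_inv[OF V(1)])
    moreover have "smooth_near A q f \<longleftrightarrow> smooth_near A q g"
      using N by (rule smooth_near_cong)
    ultimately show ?thesis
      using f by (simp add: coord_vec_def)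
  qed
  ultimately show ?thesis
    by (intro tangent_spaceI) (auto simp: coord_vec_def)
qed

lemma coord_vec_coord:
  assumes V: "(V, \<phi>) \<in> A" "q \<in> V"
  shows "coord_vec V \<phi> b q (\<lambda>q. \<phi> q \<bullet> c) = b \<bullet> c"
proof -
  have "((\<lambda>x. x \<bullet> c) has_derivative (\<lambda>v. v \<bullet> c)) (at (\<phi> q))"
    by (auto intro!: derivative_eq_intros)
  then have "(((\<lambda>q. \<phi> q \<bullet> c) \<circ> inv_into V \<phi>) has_derivative (\<lambda>v. v \<bullet> c)) (at (\<phi> q))"
    by (rule has_derivative_transform_within_open[OF _ chart_image[OF V(1)]])
      (use V in \<open>auto simp: chart_inv\<close>)
  then show ?thesis
    using smooth_nearI[OF chart_open[OF V(1)] V(2) smooth_fun_coord[OF V(1)]]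
    by (simp add: coord_vec_def dd_eq)
qed

text \<open>By the Hadamard formula \<open>f\<close> is a constant plus products of centred
  coordinates with smooth functions \<open>g b\<close>. The centred coordinates vanish at
  \<open>q\<close>, so the product rule leaves only their derivatives times \<open>g b q\<close>,
  the partial derivatives of \<open>f\<close>.\<close>

lemma tangent_expansion:
  assumes V: "(V, \<phi>) \<in> A" "q \<in> V" and v: "v \<in> tangent_space A q"
  shows "v f = (\<Sum>b\<in>onb. v (\<lambda>q. \<phi> q \<bullet> b) * coord_vec V \<phi> b q f)"
proof (cases "smooth_near A q f")
  case True
  then obtain U where U: "open U" "q \<in> U" "smooth_fun A U f"
    unfolding smooth_near_def by blast
  define F where "F = f \<circ> inv_into V \<phi>"
  have "open (\<phi> ` (U \<inter> V))" "\<phi> q \<in> \<phi> ` (U \<inter> V)"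
    using chart_image_Int_open[OF V(1) U(1)] V U by auto
  then obtain r where r: "r > 0" "ball (\<phi> q) r \<subseteq> \<phi> ` (U \<inter> V)"
    using open_contains_ball by blast
  have F: "smooth_on (ball (\<phi> q) r) F"
    unfolding F_def using smooth_funD[OF U(3) V(1)] r(2) by (rule smooth_on_subset)
  define N where "N = V \<inter> \<phi> -` ball (\<phi> q) r"
  have N: "open N" "q \<in> N" "N \<subseteq> V" "\<phi> ` N \<subseteq> ball (\<phi> q) r"
    unfolding N_def using chart_preimage_open[OF V(1) open_ball] V r by auto
  define g where "g = (\<lambda>b x. radial 0 (\<phi> q) (dd b F) (\<phi> x))"
  have near_coord: "smooth_near A q (\<lambda>x. (\<phi> x - \<phi> q) \<bullet> b)" for b
    using smooth_near_add[OF smooth_nearI[OF chart_open[OF V(1)] V(2) smooth_fun_coord[OF V(1)]]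
        smooth_near_const[of _ "- (\<phi> q \<bullet> b)"]]
    by (simp add: inner_diff_left)
  have v_coord: "v (\<lambda>x. (\<phi> x - \<phi> q) \<bullet> b) = v (\<lambda>x. \<phi> x \<bullet> b)" for b
    using tangent_add[OF v smooth_nearI[OF chart_open[OF V(1)] V(2) smooth_fun_coord[OF V(1)]]
        smooth_near_const[of _ "- (\<phi> q \<bullet> b)"]]
    by (simp add: inner_diff_left tangent_const[OF v])
  have near_g: "smooth_near A q (g b)" for b
    unfolding g_def
    by (rule smooth_nearI[OF N(1,2)],
        rule smooth_fun_pullback[OF V(1) N(1,3) smooth_on_radial[OF smooth_on_dd[OF F]] N(4)])
  have g_q: "g b q = coord_vec V \<phi> b q f" for b
    using True by (simp add: g_def coord_vec_def F_def radial_def)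
  have "f x = f q + (\<Sum>b\<in>onb. (\<phi> x - \<phi> q) \<bullet> b * g b x)" if "x \<in> N" for x
  proof -
    have "\<phi> x \<in> ball (\<phi> q) r"
      using N(4) that by auto
    from radial_hadamard[OF F this] show ?thesis
      using that N(3) V by (auto simp: F_def g_def chart_inv[OF V(1)])
  qed
  then have "v f = v (\<lambda>x. f q + (\<Sum>b\<in>onb. (\<phi> x - \<phi> q) \<bullet> b * g b x))"
    by (rule tangent_cong[OF v N(1,2)])
  also have "\<dots> = (\<Sum>b\<in>onb. v (\<lambda>x. (\<phi> x - \<phi> q) \<bullet> b * g b x))"
    using near_coord near_g
    by (simp add: tangent_add[OF v] tangent_const[OF v] tangent_sum[OF v]
        smooth_near_const smooth_near_sum smooth_near_mult)
  also have "\<dots> = (\<Sum>b\<in>onb. v (\<lambda>x. \<phi> x \<bullet> b) * coord_vec V \<phi> b q f)"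
    using near_coord near_g by (simp add: tangent_mult[OF v] v_coord g_q)
  finally show ?thesis .
next
  case False
  then show ?thesis
    by (simp add: tangent_not_smooth[OF v] coord_vec_def)
qed

section \<open>Global vector fields and cut-off coordinate frames\<close>

lemma
  assumes "X \<in> vector_fields A"
  shows vf_tangent: "X p \<in> tangent_space A p"
    and vf_smooth_fun: "open U \<Longrightarrow> smooth_fun A U f \<Longrightarrow> smooth_fun A U (\<lambda>p. X p f)"
  using assms unfolding vector_fields_def by simp_all

lemma vf_cong:
  assumes X: "X \<in> vector_fields A" and N: "open N" "p \<in> N" "\<And>q. q \<in> N \<Longrightarrow> f q = g q"
  shows "X p f = X p g"
  by (rule tangent_cong[OF vf_tangent[OF X] N])

lemma vf_localI:
  assumes "\<And>p. \<exists>N Y. open N \<and> p \<in> N \<and> Y \<in> vector_fields A \<and> (\<forall>q\<in>N. X q = Y q)"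
  shows "X \<in> vector_fields A"
proof -
  have "X p \<in> tangent_space A p" for p
    using assms[of p] vf_tangent by auto
  moreover have "smooth_fun A U (\<lambda>p. X p f)" if U: "open U" "smooth_fun A U f" for U f
  proof (rule smooth_fun_local)
    fix q assume q: "q \<in> U"
    obtain N Y where N: "open N" "q \<in> N" "Y \<in> vector_fields A" "\<And>x. x \<in> N \<Longrightarrow> X x = Y x"
      using assms[of q] by auto
    have "smooth_fun A (N \<inter> U) (\<lambda>p. X p f)"
      by (rule smooth_fun_cong[OF _ smooth_fun_subset[OF vf_smooth_fun[OF N(3) U]]])
        (use N U in auto)
    then show "\<exists>N. open N \<and> q \<in> N \<and> smooth_fun A N (\<lambda>p. X p f)"
      using N U q by (intro exI[of _ "N \<inter> U"]) auto
  qed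
  ultimately show ?thesis
    by (simp add: vector_fields_def)
qed

lemma vf_add_in: "X \<in> vector_fields A \<Longrightarrow> Y \<in> vector_fields A \<Longrightarrow> vf_add X Y \<in> vector_fields A"
  using tangent_space_add smooth_fun_add by (simp add: vector_fields_def vf_add_def)

lemma vf_scale_in: "smooth_fun A UNIV g \<Longrightarrow> X \<in> vector_fields A \<Longrightarrow> vf_scale g X \<in> vector_fields A"
  using tangent_space_scale smooth_fun_mult smooth_fun_subset[of UNIV g]
  by (simp add: vector_fields_def vf_scale_def)

definition vf_sum :: "'i set \<Rightarrow> ('i \<Rightarrow> 'm vector_field) \<Rightarrow> 'm vector_field" where
  "vf_sum I X = (\<lambda>p f. \<Sum>i\<in>I. X i p f)"

lemma vf_sum_in: "(\<And>i. i \<in> I \<Longrightarrow> X i \<in> vector_fields A) \<Longrightarrow> vf_sum I X \<in> vector_fields A"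
  by (simp add: vector_fields_def vf_sum_def tangent_space_sum smooth_fun_sum)

text \<open>A bump function equal to 1 near \<open>p\<close> turns coordinate fields and coordinate
  functions of a chart into global objects, the only kind on which \<open>D\<close> operates,
  without changing them on \<open>N\<close>.\<close>

lemma coordinate_frame:
  obtains N V \<phi> r X x where "(V, \<phi>) \<in> A" "open N" "p \<in> N" "N \<subseteq> V" "r > 0" "\<phi> ` N = ball (\<phi> p) r"
    "\<And>b. X b \<in> vector_fields A" "\<And>b. smooth_fun A UNIV (x b)"
    "\<And>b q. q \<in> N \<Longrightarrow> X b q = coord_vec V \<phi> b q"
    "\<And>b c q. q \<in> N \<Longrightarrow> X b q (x c) = b \<bullet> c"
    "\<And>q v f. q \<in> N \<Longrightarrow> v \<in> tangent_space A q \<Longrightarrow> v f = (\<Sum>b\<in>onb. v (x b) * X b q f)"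
proof -
  obtain V \<phi> where V: "(V, \<phi>) \<in> A" "p \<in> V"
    by (rule chart_at)
  obtain \<tau> N K where \<tau>: "smooth_fun A UNIV \<tau>" "open N" "p \<in> N" "N \<subseteq> V" "\<forall>q\<in>N. \<tau> q = 1"
    "open K" "V \<union> K = UNIV" "\<forall>q\<in>K. \<tau> q = 0"
    by (rule bump_function[OF chart_open[OF V(1)] V(2)])
  define X where "X = (\<lambda>b q f. if q \<in> V then \<tau> q * coord_vec V \<phi> b q f else 0)"
  define x where "x = (\<lambda>b q. if q \<in> V then \<tau> q * (\<phi> q \<bullet> b) else 0)"
  have x_smooth: "smooth_fun A UNIV (x b)" for b
  proof -
    have "smooth_fun A V (\<lambda>q. \<tau> q * (\<phi> q \<bullet> b))"
      by (rule smooth_fun_mult[OF chart_open[OF V(1)] smooth_fun_subset[OF \<tau>(1)]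
            smooth_fun_coord[OF V(1)]]) simp
    then have "smooth_fun A V (x b)"
      by (rule smooth_fun_cong[OF chart_open[OF V(1)]]) (simp add: x_def)
    moreover have "smooth_fun A K (x b)"
      by (rule smooth_fun_cong[OF \<tau>(6) smooth_fun_const[of _ 0]]) (simp add: x_def \<tau>(8))
    ultimately show ?thesis
      using \<tau>(6,7) chart_open[OF V(1)] by (intro smooth_fun_local) blast
  qed
  have X_in: "X b \<in> vector_fields A" for b
  proof -
    have "X b q \<in> tangent_space A q" for q
      using tangent_space_scale[OF coord_vec_tangent[OF V(1)]] tangent_space_zero
      by (cases "q \<in> V") (simp_all add: X_def)
    moreover have "smooth_fun A U (\<lambda>q. X b q f)" if U: "open U" "smooth_fun A U f" for U f
    proof -
      have UV: "open (U \<inter> V)"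
        using U chart_open[OF V(1)] by auto
      have "smooth_on (\<phi> ` (U \<inter> V)) (\<lambda>y. dd b (f \<circ> inv_into V \<phi>) y)"
        by (rule smooth_on_dd[OF smooth_funD[OF U(2) V(1)]])
      then have "smooth_fun A (U \<inter> V) (\<lambda>q. dd b (f \<circ> inv_into V \<phi>) (\<phi> q))"
        by (rule smooth_fun_pullback[OF V(1) UV Int_lower2 _ order_refl])
      then have "smooth_fun A (U \<inter> V) (\<lambda>q. \<tau> q * dd b (f \<circ> inv_into V \<phi>) (\<phi> q))"
        by (rule smooth_fun_mult[OF UV smooth_fun_subset[OF \<tau>(1) subset_UNIV]])
      then have "smooth_fun A (U \<inter> V) (\<lambda>q. X b q f)"
        by (rule smooth_fun_cong[OF UV]) (use smooth_nearI[OF U(1) _ U(2)] in \<open>simp add: X_def coord_vec_def\<close>)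
      moreover have "smooth_fun A K (\<lambda>q. X b q f)"
        by (rule smooth_fun_cong[OF \<tau>(6) smooth_fun_const[of _ 0]]) (simp add: X_def \<tau>(8))
      ultimately show ?thesis
        using \<tau>(6,7) UV by (intro smooth_fun_local) blast
    qed
    ultimately show ?thesis
      by (simp add: vector_fields_def)
  qed
  have "open (\<phi> ` N)" "\<phi> p \<in> \<phi> ` N"
    using chart_image_open[OF V(1) \<tau>(2,4)] \<tau>(3) by auto
  then obtain r where r: "r > 0" "ball (\<phi> p) r \<subseteq> \<phi> ` N"
    using open_contains_ball by blast
  define N' where "N' = V \<inter> \<phi> -` ball (\<phi> p) r"
  have N'N: "N' \<subseteq> N"
  proof
    fix q assume q: "q \<in> N'"
    then have "\<phi> q \<in> \<phi> ` N"
      using r(2) by (auto simp: N'_def)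
    then show "q \<in> N"
      using q \<tau>(4) chart_inv[OF V(1)] unfolding N'_def by (metis IntD1 imageE subsetD)
  qed
  have XN: "X b q = coord_vec V \<phi> b q" and xN: "x b q = \<phi> q \<bullet> b" if "q \<in> N'" for b q
  proof -
    have "q \<in> V" "\<tau> q = 1"
      using that N'N \<tau>(4,5) by auto
    then show "X b q = coord_vec V \<phi> b q" "x b q = \<phi> q \<bullet> b"
      by (simp_all add: X_def x_def)
  qed
  have N': "open N'" "N' \<subseteq> V" "p \<in> N'"
    using chart_preimage_open[OF V(1) open_ball] V r by (auto simp: N'_def)
  have im: "\<phi> ` N' = ball (\<phi> p) r"
  proof
    show "ball (\<phi> p) r \<subseteq> \<phi> ` N'"
    proof
      fix y assume y: "y \<in> ball (\<phi> p) r"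
      then obtain q where "q \<in> N" "y = \<phi> q"
        using r(2) by blast
      then show "y \<in> \<phi> ` N'"
        using y \<tau>(4) unfolding N'_def by blast
    qed
  qed (auto simp: N'_def)
  have vx: "v (x b) = v (\<lambda>q. \<phi> q \<bullet> b)" if "q \<in> N'" "v \<in> tangent_space A q" for q v b
    using that xN by (intro tangent_cong[OF that(2) N'(1)])
  have Xx: "X b q (x c) = b \<bullet> c" if "q \<in> N'" for b c q
    using vx[OF that vf_tangent[OF X_in]] XN[OF that] coord_vec_coord[OF V(1)] N'(2) that by auto
  have ex: "v f = (\<Sum>b\<in>onb. v (x b) * X b q f)"
    if "q \<in> N'" "v \<in> tangent_space A q" for q v f
    using tangent_expansion[OF V(1) _ that(2), of f] that vx[OF that] XN[OF that(1)] N'(2) by auto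
  show thesis
    by (rule that[OF V(1) N'(1,3,2) r(1) im X_in x_smooth XN Xx ex])
qed

end

section \<open>Local frames and function-linear functionals\<close>

context smooth_mfd
begin

text \<open>What is left of \<open>coordinate_frame\<close> once the chart is forgotten. The duality
  reads \<open>b \<bullet> c\<close> because \<open>X\<close> and \<open>x\<close> are indexed by
  the whole model space; on \<open>onb\<close> it is the Kronecker delta.\<close>

definition local_frame :: "'m set \<Rightarrow> ('e \<Rightarrow> 'm vector_field) \<Rightarrow> ('e \<Rightarrow> 'm \<Rightarrow> real) \<Rightarrow> bool" where
  "local_frame N X x \<longleftrightarrow> open N \<and> (\<forall>b. X b \<in> vector_fields A) \<and> (\<forall>b. smooth_fun A UNIV (x b)) \<and>
     (\<forall>q\<in>N. \<forall>b c. X b q (x c) = b \<bullet> c) \<and>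
     (\<forall>q\<in>N. \<forall>v\<in>tangent_space A q. \<forall>f. v f = (\<Sum>b\<in>onb. v (x b) * X b q f))"

lemma
  assumes "local_frame N X x"
  shows frame_open: "open N"
    and frame_in: "X b \<in> vector_fields A"
    and frame_coord_smooth: "smooth_fun A UNIV (x b)"
    and frame_dual: "q \<in> N \<Longrightarrow> X b q (x c) = b \<bullet> c"
    and frame_expansion: "q \<in> N \<Longrightarrow> v \<in> tangent_space A q \<Longrightarrow> v f = (\<Sum>b\<in>onb. v (x b) * X b q f)"
proof -
  note F = assms[unfolded local_frame_def]
  show "open N" "X b \<in> vector_fields A" "smooth_fun A UNIV (x b)" "q \<in> N \<Longrightarrow> X b q (x c) = b \<bullet> c"
    using F by simp_all
  show "q \<in> N \<Longrightarrow> v \<in> tangent_space A q \<Longrightarrow> v f = (\<Sum>b\<in>onb. v (x b) * X b q f)"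
    by (rule F[THEN conjunct2, THEN conjunct2, THEN conjunct2, THEN conjunct2, rule_format])
qed

lemma frame_exists:
  obtains N X x where "local_frame N X x" "p \<in> N"
proof (rule coordinate_frame[of p])
  fix N V \<phi> r X x
  assume F: "(V, \<phi>) \<in> A" "open N" "p \<in> N" "N \<subseteq> V" "r > 0" "\<phi> ` N = ball (\<phi> p) r"
    "\<And>b. X b \<in> vector_fields A" "\<And>b. smooth_fun A UNIV (x b)"
    "\<And>b q. q \<in> N \<Longrightarrow> X b q = coord_vec V \<phi> b q"
    "\<And>b c q. q \<in> N \<Longrightarrow> X b q (x c) = b \<bullet> c"
    "\<And>q v f. q \<in> N \<Longrightarrow> v \<in> tangent_space A q \<Longrightarrow> v f = (\<Sum>b\<in>onb. v (x b) * X b q f)"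
  have "local_frame N X x"
    unfolding local_frame_def
    by (intro conjI ballI allI F(2) F(7) F(8) F(10); (assumption | rule F(11); assumption))
  then show thesis
    using F(3) by (rule that)
qed

text \<open>Constant coefficients in a frame suffice, since only the value at \<open>p\<close> is
  prescribed. This makes testing on global fields as strong as testing on tangent vectors.\<close>

lemma tangent_extends:
  assumes "v \<in> tangent_space A p"
  obtains Y where "Y \<in> vector_fields A" "Y p = v"
proof -
  obtain N X x where F: "local_frame N X x" "p \<in> N"
    by (rule frame_exists)
  show thesis
  proof (rule that)
    show "vf_sum onb (\<lambda>b. vf_scale (\<lambda>_. v (x b)) (X b)) \<in> vector_fields A"
      by (intro vf_sum_in vf_scale_in smooth_fun_const frame_in[OF F(1)])
    show "vf_sum onb (\<lambda>b. vf_scale (\<lambda>_. v (x b)) (X b)) p = v"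
      by (intro ext) (simp add: vf_sum_def vf_scale_def frame_expansion[OF F assms, symmetric])
  qed
qed

text \<open>Linearity over the ring of global smooth functions: the algebraic form of a one-form,
  given by its action on global fields.\<close>

definition tensorial :: "('m vector_field \<Rightarrow> 'm \<Rightarrow> real) \<Rightarrow> bool" where
  "tensorial \<omega> \<longleftrightarrow>
     (\<forall>X\<in>vector_fields A. \<forall>Y\<in>vector_fields A. \<forall>p. \<omega> (vf_add X Y) p = \<omega> X p + \<omega> Y p) \<and>
     (\<forall>X\<in>vector_fields A. \<forall>g. smooth_fun A UNIV g \<longrightarrow> (\<forall>p. \<omega> (vf_scale g X) p = g p * \<omega> X p))"

lemma
  assumes "tensorial \<omega>"
  shows tensorial_add: "X \<in> vector_fields A \<Longrightarrow> Y \<in> vector_fields A \<Longrightarrow>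
      \<omega> (vf_add X Y) p = \<omega> X p + \<omega> Y p"
    and tensorial_scale: "X \<in> vector_fields A \<Longrightarrow> smooth_fun A UNIV g \<Longrightarrow>
      \<omega> (vf_scale g X) p = g p * \<omega> X p"
  using assms unfolding tensorial_def by simp_all

text \<open>Fields that agree near \<open>p\<close> become globally equal after multiplication by a
  bump function. All locality statements are drawn from this, using only the behaviour of an
  operator under scaling.\<close>

lemma cutoff_eq:
  assumes "open N" "p \<in> N" "\<And>q. q \<in> N \<Longrightarrow> X q = Y q"
  obtains \<tau> where "smooth_fun A UNIV \<tau>" "\<tau> p = 1" "vf_scale \<tau> X = vf_scale \<tau> Y"
proof -
  obtain \<tau> N' K where \<tau>: "smooth_fun A UNIV \<tau>" "open N'" "p \<in> N'" "N' \<subseteq> N" "\<forall>q\<in>N'. \<tau> q = 1"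
    "open K" "N \<union> K = UNIV" "\<forall>q\<in>K. \<tau> q = 0"
    by (rule bump_function[OF assms(1,2)])
  have "vf_scale \<tau> X q = vf_scale \<tau> Y q" for q
  proof (cases "q \<in> N")
    case True
    then show ?thesis
      by (simp add: vf_scale_def assms(3))
  next
    case False
    then have "\<tau> q = 0"
      using \<tau>(7,8) by blast
    then show ?thesis
      by (simp add: vf_scale_def)
  qed
  then show thesis
    using that[of \<tau>] \<tau>(1,3,5) by blast
qed

lemma tensorial_germ:
  assumes \<omega>: "tensorial \<omega>" and X: "X \<in> vector_fields A" and Y: "Y \<in> vector_fields A"
    and N: "open N" "p \<in> N" "\<And>q. q \<in> N \<Longrightarrow> X q = Y q"
  shows "\<omega> X p = \<omega> Y p"
proof -
  obtain \<tau> where \<tau>: "smooth_fun A UNIV \<tau>" "\<tau> p = 1" "vf_scale \<tau> X = vf_scale \<tau> Y"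
    by (rule cutoff_eq[of N p X Y, OF N])
  then show ?thesis
    using tensorial_scale[OF \<omega> X \<tau>(1), of p] tensorial_scale[OF \<omega> Y \<tau>(1), of p] by simp
qed

lemma vf_sum_empty_in: "vf_sum {} X \<in> vector_fields A"
  by (rule vf_sum_in) simp

text \<open>Presents the zero field as a scaled field, so that homogeneity or the Leibniz rule gives
  the value 0 on an empty sum.\<close>

lemma vf_sum_empty_scale: "vf_sum {} X = vf_scale (\<lambda>_. 0) (vf_sum {} X)"
  by (simp add: vf_sum_def vf_scale_def)

lemma vf_sum_insert:
  "finite I \<Longrightarrow> i \<notin> I \<Longrightarrow> vf_sum (insert i I) X = vf_add (X i) (vf_sum I X)"
  by (simp add: vf_sum_def vf_add_def)

lemma tensorial_sum:
  assumes \<omega>: "tensorial \<omega>" and "finite I" "\<And>i. i \<in> I \<Longrightarrow> X i \<in> vector_fields A"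
  shows "\<omega> (vf_sum I X) p = (\<Sum>i\<in>I. \<omega> (X i) p)"
  using assms(2,3)
proof (induction I)
  case empty
  then show ?case
    using tensorial_scale[OF \<omega> vf_sum_empty_in smooth_fun_const[of _ 0]] vf_sum_empty_scale
    by (metis mult_zero_left sum.empty)
next
  case (insert i I)
  then show ?case
    by (simp add: vf_sum_insert tensorial_add[OF \<omega>] vf_sum_in)
qed

text \<open>The frame expansion of \<open>Y\<close> is an identity of fields on \<open>N\<close>
  only; locality turns it into an identity of values. In particular the value at \<open>q\<close>
  depends on \<open>Y q\<close> alone.\<close>

lemma tensorial_expansion:
  assumes \<omega>: "tensorial \<omega>" and F: "local_frame N X x" "q \<in> N" and Y: "Y \<in> vector_fields A"
  shows "\<omega> Y q = (\<Sum>b\<in>onb. Y q (x b) * \<omega> (X b) q)"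
proof -
  define Z where "Z = (\<lambda>b. vf_scale (\<lambda>p. Y p (x b)) (X b))"
  have sm: "smooth_fun A UNIV (\<lambda>p. Y p (x b))" for b
    by (rule vf_smooth_fun[OF Y open_UNIV frame_coord_smooth[OF F(1)]])
  have Z: "Z b \<in> vector_fields A" for b
    unfolding Z_def by (rule vf_scale_in[OF sm frame_in[OF F(1)]])
  have "Y p = vf_sum onb Z p" if "p \<in> N" for p
    by (intro ext) (simp add: Z_def vf_sum_def vf_scale_def
        frame_expansion[OF F(1) that vf_tangent[OF Y], symmetric])
  then have "\<omega> Y q = \<omega> (vf_sum onb Z) q"
    by (rule tensorial_germ[OF \<omega> Y vf_sum_in[OF Z] frame_open[OF F(1)] F(2)])
  also have "\<dots> = (\<Sum>b\<in>onb. \<omega> (Z b) q)"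
    by (rule tensorial_sum[OF \<omega> finite_onb Z])
  also have "\<dots> = (\<Sum>b\<in>onb. Y q (x b) * \<omega> (X b) q)"
    unfolding Z_def by (simp add: tensorial_scale[OF \<omega> frame_in[OF F(1)] sm])
  finally show ?thesis .
qed

section \<open>Lie brackets and connections\<close>

lemma vf_near:
  assumes "X \<in> vector_fields A" "smooth_near A p f"
  shows "smooth_near A p (\<lambda>q. X q f)"
proof -
  obtain U where "open U" "p \<in> U" "smooth_fun A U f"
    using assms(2) unfolding smooth_near_def by blast
  then show ?thesis
    using vf_smooth_fun[OF assms(1)] by (intro smooth_nearI[of U]) auto
qed

lemma smooth_near_nhd:
  assumes "smooth_near A p f" "smooth_near A p g"
  obtains N where "open N" "p \<in> N" "\<forall>q\<in>N. smooth_near A q f \<and> smooth_near A q g"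
proof -
  obtain U T where U: "open U" "p \<in> U" "smooth_fun A U f" and T: "open T" "p \<in> T" "smooth_fun A T g"
    using assms unfolding smooth_near_def by blast
  show thesis
    by (rule that[of "U \<inter> T"]) (use U T in \<open>auto intro: smooth_nearI\<close>)
qed

lemma lie_bracket_in:
  assumes X: "X \<in> vector_fields A" and Y: "Y \<in> vector_fields A"
  shows "lie_bracket A X Y \<in> vector_fields A"
proof -
  have add: "X p (\<lambda>q. Y q (\<lambda>r. f r + g r)) = X p (\<lambda>q. Y q f) + X p (\<lambda>q. Y q g)"
    if f: "smooth_near A p f" and g: "smooth_near A p g"
      and X: "X \<in> vector_fields A" and Y: "Y \<in> vector_fields A" for f g p X Y
  proof -
    obtain N where N: "open N" "p \<in> N" "\<forall>q\<in>N. smooth_near A q f \<and> smooth_near A q g"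
      using f g by (rule smooth_near_nhd)
    have "X p (\<lambda>q. Y q (\<lambda>r. f r + g r)) = X p (\<lambda>q. Y q f + Y q g)"
      by (rule vf_cong[OF X N(1,2)]) (use N(3) tangent_add[OF vf_tangent[OF Y]] in blast)
    then show ?thesis
      using tangent_add[OF vf_tangent[OF X] vf_near[OF Y f] vf_near[OF Y g]] by simp
  qed
  \<comment> \<open>The mixed products of first derivatives are symmetric in \<open>X\<close> and
    \<open>Y\<close>, so they cancel in the bracket.\<close>
  have mult: "X p (\<lambda>q. Y q (\<lambda>r. f r * g r))
      = (X p (\<lambda>q. Y q f) * g p + Y p f * X p g) + (X p f * Y p g + f p * X p (\<lambda>q. Y q g))"
    if f: "smooth_near A p f" and g: "smooth_near A p g"
      and X: "X \<in> vector_fields A" and Y: "Y \<in> vector_fields A" for f g p X Y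
  proof -
    obtain N where N: "open N" "p \<in> N" "\<forall>q\<in>N. smooth_near A q f \<and> smooth_near A q g"
      using f g by (rule smooth_near_nhd)
    have "X p (\<lambda>q. Y q (\<lambda>r. f r * g r)) = X p (\<lambda>q. Y q f * g q + f q * Y q g)"
      by (rule vf_cong[OF X N(1,2)]) (use N(3) tangent_mult[OF vf_tangent[OF Y]] in blast)
    also have "\<dots> = X p (\<lambda>q. Y q f * g q) + X p (\<lambda>q. f q * Y q g)"
      using f g by (intro tangent_add[OF vf_tangent[OF X]] smooth_near_mult vf_near[OF Y])
    finally show ?thesis
      using f g vf_near[OF Y f] vf_near[OF Y g]
      by (simp add: tangent_mult[OF vf_tangent[OF X]])
  qed
  have cmult: "X p (\<lambda>q. Y q (\<lambda>r. c * f r)) = c * X p (\<lambda>q. Y q f)"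
    if f: "smooth_near A p f" and X: "X \<in> vector_fields A" and Y: "Y \<in> vector_fields A" for c f p X Y
  proof -
    obtain N where N: "open N" "p \<in> N" "\<forall>q\<in>N. smooth_near A q f \<and> smooth_near A q f"
      using f f by (rule smooth_near_nhd)
    have "X p (\<lambda>q. Y q (\<lambda>r. c * f r)) = X p (\<lambda>q. c * Y q f)"
      by (rule vf_cong[OF X N(1,2)]) (use N(3) tangent_cmult[OF vf_tangent[OF Y]] in blast)
    then show ?thesis
      using tangent_cmult[OF vf_tangent[OF X] vf_near[OF Y f]] by simp
  qed
  have germ: "X p (\<lambda>q. Y q f) = X p (\<lambda>q. Y q g)"
    if fg: "\<forall>\<^sub>F q in nhds p. f q = g q"
      and X: "X \<in> vector_fields A" and Y: "Y \<in> vector_fields A" for f g p X Y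
  proof -
    obtain N where N: "open N" "p \<in> N" "\<forall>q\<in>N. f q = g q"
      using fg unfolding eventually_nhds by blast
    show ?thesis
      by (rule vf_cong[OF X N(1,2)], rule vf_cong[OF Y N(1)]) (use N in auto)
  qed
  have "lie_bracket A X Y p \<in> tangent_space A p" for p
  proof (rule tangent_spaceI)
    fix f g assume f: "smooth_near A p f" and g: "smooth_near A p g"
    show "lie_bracket A X Y p (\<lambda>q. f q + g q) = lie_bracket A X Y p f + lie_bracket A X Y p g"
      using f g smooth_near_add[OF f g] add[OF f g X Y] add[OF f g Y X]
      by (simp add: lie_bracket_def)
    show "lie_bracket A X Y p (\<lambda>q. f q * g q) = lie_bracket A X Y p f * g p + f p * lie_bracket A X Y p g"
      using f g smooth_near_mult[OF f g] mult[OF f g X Y] mult[OF f g Y X]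
      by (simp add: lie_bracket_def algebra_simps)
    show "lie_bracket A X Y p f = lie_bracket A X Y p g" if "\<forall>\<^sub>F q in nhds p. f q = g q"
      using f g germ[OF that X Y] germ[OF that Y X] by (simp add: lie_bracket_def)
  next
    fix c f assume f: "smooth_near A p f"
    show "lie_bracket A X Y p (\<lambda>q. c * f q) = c * lie_bracket A X Y p f"
      using f smooth_near_mult[OF smooth_near_const f] cmult[OF f X Y] cmult[OF f Y X]
      by (simp add: lie_bracket_def algebra_simps)
  qed (simp add: lie_bracket_def)
  moreover have "smooth_fun A U (\<lambda>p. lie_bracket A X Y p f)" if U: "open U" "smooth_fun A U f" for U f
  proof -
    have "smooth_fun A U (\<lambda>p. X p (\<lambda>q. Y q f) - Y p (\<lambda>q. X q f))"
      by (intro smooth_fun_diff vf_smooth_fun[OF X] vf_smooth_fun[OF Y] U)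
    then show ?thesis
      by (rule smooth_fun_cong[OF U(1)]) (use smooth_nearI[OF U(1) _ U(2)] in \<open>simp add: lie_bracket_def\<close>)
  qed
  ultimately show ?thesis
    by (simp add: vector_fields_def)
qed

section \<open>Algebra and locality of connections\<close>

lemma
  assumes "connection A D" "X \<in> vector_fields A" "Y \<in> vector_fields A"
  shows conn_in: "D X Y \<in> vector_fields A"
    and conn_add1: "X' \<in> vector_fields A \<Longrightarrow> D (vf_add X X') Y = vf_add (D X Y) (D X' Y)"
    and conn_scale1: "smooth_fun A UNIV g \<Longrightarrow> D (vf_scale g X) Y = vf_scale g (D X Y)"
    and conn_add2: "Y' \<in> vector_fields A \<Longrightarrow> D X (vf_add Y Y') = vf_add (D X Y) (D X Y')"
    and conn_leibniz: "smooth_fun A UNIV g \<Longrightarrow>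
      D X (vf_scale g Y) = vf_add (vf_scale (\<lambda>p. X p g) Y) (vf_scale g (D X Y))"
  using assms unfolding connection_def by simp_all

lemma conn_tensorial: "connection A D \<Longrightarrow> Y \<in> vector_fields A \<Longrightarrow> tensorial (\<lambda>X p. D X Y p f)"
  unfolding tensorial_def
  by (simp add: conn_add1 conn_scale1 vf_add_def[of "D _ _"] vf_scale_def[of _ "D _ _"])

text \<open>The Leibniz rule is applied to the common field \<open>\<tau> Y = \<tau> Y'\<close>. The
  terms with the derivative of \<open>\<tau>\<close> agree because the fields agree at
  \<open>p\<close>, and \<open>\<tau> p = 1\<close> isolates the rest.\<close>

lemma conn_germ:
  assumes D: "connection A D" and X: "X \<in> vector_fields A"
    and Y: "Y \<in> vector_fields A" and Y': "Y' \<in> vector_fields A"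
    and N: "open N" "p \<in> N" "\<And>q. q \<in> N \<Longrightarrow> Y q = Y' q"
  shows "D X Y p = D X Y' p"
proof -
  obtain \<tau> where \<tau>: "smooth_fun A UNIV \<tau>" "\<tau> p = 1" "vf_scale \<tau> Y = vf_scale \<tau> Y'"
    by (rule cutoff_eq[of N p Y Y', OF N])
  have "D X (vf_scale \<tau> Y) p = D X (vf_scale \<tau> Y') p"
    by (simp only: \<tau>(3))
  then show ?thesis
    using \<tau>(2) N(3)[OF N(2)]
    unfolding conn_leibniz[OF D X Y \<tau>(1)] conn_leibniz[OF D X Y' \<tau>(1)]
    by (simp add: vf_add_def vf_scale_def fun_eq_iff)
qed

lemma conn_sum:
  assumes D: "connection A D" and X: "X \<in> vector_fields A" and "finite I"
    and "\<And>i. i \<in> I \<Longrightarrow> Y i \<in> vector_fields A"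
  shows "D X (vf_sum I Y) p f = (\<Sum>i\<in>I. D X (Y i) p f)"
  using assms(3,4)
proof (induction I)
  case empty
  have "D X (vf_scale (\<lambda>_. 0) (vf_sum {} Y)) p f = 0"
    by (simp only: conn_leibniz[OF D X vf_sum_empty_in smooth_fun_const[of _ 0]])
      (simp add: vf_add_def vf_scale_def vf_sum_def)
  then show ?case
    by (simp flip: vf_sum_empty_scale)
next
  case (insert i I)
  then have "D X (vf_sum (insert i I) Y) = vf_add (D X (Y i)) (D X (vf_sum I Y))"
    by (simp add: vf_sum_insert conn_add2[OF D X] vf_sum_in)
  then show ?case
    using insert by (simp add: vf_add_def)
qed

lemma conn_sum_scale:
  assumes D: "connection A D" and X: "X \<in> vector_fields A" and "finite I"
    and Y: "\<And>i. i \<in> I \<Longrightarrow> Y i \<in> vector_fields A" and w: "\<And>i. i \<in> I \<Longrightarrow> smooth_fun A UNIV (w i)"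
  shows "D X (vf_sum I (\<lambda>i. vf_scale (w i) (Y i))) p f
    = (\<Sum>i\<in>I. X p (w i) * Y i p f + w i p * D X (Y i) p f)"
proof -
  have "D X (vf_sum I (\<lambda>i. vf_scale (w i) (Y i))) p f = (\<Sum>i\<in>I. D X (vf_scale (w i) (Y i)) p f)"
    by (rule conn_sum[OF D X assms(3)]) (rule vf_scale_in[OF w Y])
  also have "\<dots> = (\<Sum>i\<in>I. X p (w i) * Y i p f + w i p * D X (Y i) p f)"
  proof (rule sum.cong[OF refl])
    fix i assume i: "i \<in> I"
    show "D X (vf_scale (w i) (Y i)) p f = X p (w i) * Y i p f + w i p * D X (Y i) p f"
      unfolding conn_leibniz[OF D X Y[OF i] w[OF i]] by (simp add: vf_add_def vf_scale_def)
  qed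
  finally show ?thesis .
qed

end

section \<open>Riemannian metrics and musical isomorphisms\<close>

locale riem_mfd = smooth_mfd A
  for A :: "('m::{t2_space, second_countable_topology}, 'e::{real_inner, heine_borel}) atlas" +
  fixes h :: "'m bilinear_field"
  assumes riem: "riemannian_metric A h"
begin

lemma
  assumes "u \<in> tangent_space A p" "w \<in> tangent_space A p"
  shows h_add_left: "v \<in> tangent_space A p \<Longrightarrow> h p (\<lambda>f. u f + v f) w = h p u w + h p v w"
    and h_scale_left: "h p (\<lambda>f. c * u f) w = c * h p u w"
    and h_sym: "h p u w = h p w u"
    and h_add_right: "v \<in> tangent_space A p \<Longrightarrow> h p w (\<lambda>f. u f + v f) = h p w u + h p w v"
    and h_scale_right: "h p w (\<lambda>f. c * u f) = c * h p w u"
proof -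
  note R = riem[unfolded riemannian_metric_def]
  note R1 = R[THEN conjunct1, rule_format]
    and R2 = R[THEN conjunct2, THEN conjunct1, rule_format]
    and R3 = R[THEN conjunct2, THEN conjunct2, THEN conjunct1, rule_format]
  show a: "v \<in> tangent_space A p \<Longrightarrow> h p (\<lambda>f. u f + v f) w = h p u w + h p v w"
    using R1 assms by blast
  show b: "h p (\<lambda>f. c * u f) w = c * h p u w"
    using R2 assms by blast
  show "h p u w = h p w u"
    using R3 assms by blast
  show "v \<in> tangent_space A p \<Longrightarrow> h p w (\<lambda>f. u f + v f) = h p w u + h p w v"
    using a R3[OF assms(2) tangent_space_add[OF assms(1)]] R3[OF assms] R3[of v p w] assms(2) by simp
  show "h p w (\<lambda>f. c * u f) = c * h p w u"
    using b R3[OF assms(2) tangent_space_scale[OF assms(1)]] R3[OF assms] by simp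
qed

lemma h_pos: "v \<in> tangent_space A p \<Longrightarrow> v \<noteq> (\<lambda>f. 0) \<Longrightarrow> h p v v > 0"
  using riem[unfolded riemannian_metric_def, THEN conjunct2, THEN conjunct2, THEN conjunct2,
      THEN conjunct1, rule_format] .

lemma h_smooth:
  "X \<in> vector_fields A \<Longrightarrow> Y \<in> vector_fields A \<Longrightarrow> smooth_fun A UNIV (\<lambda>p. h p (X p) (Y p))"
  using riem[unfolded riemannian_metric_def, THEN conjunct2, THEN conjunct2, THEN conjunct2,
      THEN conjunct2, rule_format] .

lemma h_vf_add:
  assumes "X \<in> vector_fields A" "Y \<in> vector_fields A" "w \<in> tangent_space A p"
  shows "h p (vf_add X Y p) w = h p (X p) w + h p (Y p) w"
    and "h p w (vf_add X Y p) = h p w (X p) + h p w (Y p)"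
  using h_add_left[OF vf_tangent[OF assms(1)] assms(3) vf_tangent[OF assms(2)]]
    h_add_right[OF vf_tangent[OF assms(1)] assms(3) vf_tangent[OF assms(2)]]
  by (simp_all add: vf_add_def)

lemma h_vf_scale:
  assumes "X \<in> vector_fields A" "w \<in> tangent_space A p"
  shows "h p (vf_scale g X p) w = g p * h p (X p) w"
    and "h p w (vf_scale g X p) = g p * h p w (X p)"
  using h_scale_left[OF vf_tangent[OF assms(1)] assms(2)]
    h_scale_right[OF vf_tangent[OF assms(1)] assms(2)]
  by (simp_all add: vf_scale_def)

lemma h_tensorial: "Y \<in> vector_fields A \<Longrightarrow> tensorial (\<lambda>X p. h p (X p) (Y p))"
  unfolding tensorial_def by (simp add: h_vf_add h_vf_scale vf_tangent)

text \<open>The difference of \<open>v\<close> and \<open>w\<close>, extended to a global field,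
  serves as its own test field; positive definiteness then forces it to vanish.\<close>

lemma h_eqI:
  assumes v: "v \<in> tangent_space A p" and w: "w \<in> tangent_space A p"
    and eq: "\<And>Y. Y \<in> vector_fields A \<Longrightarrow> h p v (Y p) = h p w (Y p)"
  shows "v = w"
proof (rule ccontr)
  assume neq: "v \<noteq> w"
  define u where "u = (\<lambda>f. v f + - 1 * w f)"
  have w': "(\<lambda>f. - 1 * w f) \<in> tangent_space A p"
    by (rule tangent_space_scale[OF w])
  have u: "u \<in> tangent_space A p"
    unfolding u_def by (rule tangent_space_add[OF v w'])
  obtain Y where Y: "Y \<in> vector_fields A" "Y p = u"
    using u by (rule tangent_extends)
  have "h p u u = h p v u + - 1 * h p w u"
    using h_add_left[OF v u w'] h_scale_left[OF w u, of "-1"] by (simp add: u_def)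
  also have "\<dots> = 0"
    using eq[OF Y(1)] Y(2) by simp
  finally have "u = (\<lambda>f. 0)"
    using h_pos[OF u] by force
  then show False
    using neq by (auto simp: u_def fun_eq_iff)
qed

lemma h_vf_eqI:
  assumes "V \<in> vector_fields A" "W \<in> vector_fields A"
    and "\<And>Y p. Y \<in> vector_fields A \<Longrightarrow> h p (V p) (Y p) = h p (W p) (Y p)"
  shows "V = W"
proof
  show "V p = W p" for p
    by (rule h_eqI[OF vf_tangent[OF assms(1)] vf_tangent[OF assms(2)]]) (rule assms(3))
qed

text \<open>Induction on the number of equations, as in the Gram-Schmidt process: \<open>W\<close> below is the
  component of \<open>X c\<close> that is orthogonal to the previous fields near \<open>p\<close>.\<close>

lemma gram_solvable:
  assumes F: "local_frame N X x" "p \<in> N"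
    and "finite S" "S \<subseteq> onb" "\<And>b. smooth_fun A UNIV (w b)"
  shows "\<exists>a M. (\<forall>b. smooth_fun A UNIV (a b)) \<and> open M \<and> p \<in> M \<and>
    (\<forall>q\<in>M. \<forall>b\<in>S. h q (vf_sum S (\<lambda>b. vf_scale (a b) (X b)) q) (X b q) = w b q)"
  using assms(3-5)
proof (induction S arbitrary: w)
  case empty
  show ?case
    by (intro exI[of _ "\<lambda>_ _. 0"] exI[of _ UNIV]) simp
next
  case (insert c S)
  note Xin = frame_in[OF F(1)]
  have comb: "vf_sum S (\<lambda>b. vf_scale (a b) (X b)) \<in> vector_fields A"
    if "\<And>b. smooth_fun A UNIV (a b)" for S a
    using that by (intro vf_sum_in vf_scale_in Xin)
  have SO: "S \<subseteq> onb"
    using insert.prems(1) by blast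
  obtain a M1 where a: "\<forall>b. smooth_fun A UNIV (a b)" and M1: "open M1" "p \<in> M1"
    "\<forall>q\<in>M1. \<forall>b\<in>S. h q (vf_sum S (\<lambda>b. vf_scale (a b) (X b)) q) (X b q) = w b q"
    using insert.IH[of w, OF SO insert.prems(2)] by (elim exE conjE)
  \<comment> \<open>A second use of the induction hypothesis, with the inner products of
    \<open>X c\<close> on the right: it yields the orthogonal projection of \<open>X c\<close> onto
    the span of the earlier fields near \<open>p\<close>.\<close>
  obtain e M2 where e: "\<forall>b. smooth_fun A UNIV (e b)" and M2: "open M2" "p \<in> M2"
    "\<forall>q\<in>M2. \<forall>b\<in>S.
      h q (vf_sum S (\<lambda>b. vf_scale (e b) (X b)) q) (X b q) = h q (X c q) (X b q)"
    using insert.IH[of "\<lambda>b q. h q (X c q) (X b q)", OF SO h_smooth[OF Xin Xin]] by (elim exE conjE)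
  define V U where "V = vf_sum S (\<lambda>b. vf_scale (a b) (X b))" and "U = vf_sum S (\<lambda>b. vf_scale (e b) (X b))"
  define W where "W = vf_add (X c) (vf_scale (\<lambda>_. - 1) U)"
  have V: "V \<in> vector_fields A" and U: "U \<in> vector_fields A"
    unfolding V_def U_def by (rule comb[OF a[rule_format]], rule comb[OF e[rule_format]])
  have mU: "vf_scale (\<lambda>_. - 1) U \<in> vector_fields A"
    by (rule vf_scale_in[OF smooth_fun_const U])
  have W: "W \<in> vector_fields A"
    unfolding W_def by (rule vf_add_in[OF Xin mU])
  have hW: "h q (W q) (Y q) = h q (X c q) (Y q) - h q (U q) (Y q)" if "Y \<in> vector_fields A" for q Y
    unfolding W_def using vf_tangent[OF that]
    by (simp add: h_vf_add(1)[OF Xin mU] h_vf_scale(1)[OF U])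
  have WX: "h q (W q) (X b q) = 0" if "q \<in> M2" "b \<in> S" for q b
    using hW[OF Xin] M2(3) that by (simp add: U_def)
  have "h p (U p) (W p) = (\<Sum>b\<in>S. h p (vf_scale (e b) (X b) p) (W p))"
    unfolding U_def
    by (rule tensorial_sum[OF h_tensorial[OF W] insert.hyps(1) vf_scale_in[OF e[rule_format] Xin]])
  also have "\<dots> = 0"
    using WX[OF M2(2)] by (intro sum.neutral)
      (simp add: h_vf_scale(1)[OF Xin vf_tangent[OF W]] h_sym[OF vf_tangent[OF Xin] vf_tangent[OF W]])
  finally have UW: "h p (U p) (W p) = 0" .
  define g where "g = (\<lambda>q. h q (W q) (X c q))"
  have g: "smooth_fun A UNIV g"
    unfolding g_def by (rule h_smooth[OF W Xin])
  have "g p = h p (X c p) (W p)"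
    unfolding g_def by (rule h_sym[OF vf_tangent[OF W] vf_tangent[OF Xin]])
  also have "\<dots> = h p (W p) (W p)"
    using hW[OF W] UW by simp
  also have "\<dots> > 0"
  proof (rule h_pos[OF vf_tangent[OF W]])
    \<comment> \<open>\<open>U\<close> has no component along \<open>X c\<close>, so the coordinate
      \<open>x c\<close> shows that \<open>W\<close> is nonzero at \<open>p\<close>.\<close>
    have "U p (x c) = (\<Sum>b\<in>S. e b p * (b \<bullet> c))"
      by (simp add: U_def vf_sum_def vf_scale_def frame_dual[OF F])
    also have "\<dots> = 0"
    proof (rule sum.neutral, rule ballI)
      fix b assume "b \<in> S"
      then have "b \<in> onb" "c \<in> onb" "b \<noteq> c"
        using insert.hyps(2) insert.prems(1) by auto
      then show "e b p * (b \<bullet> c) = 0"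
        by (simp add: inner_onb)
    qed
    finally have "W p (x c) = 1"
      using insert.prems(1) by (simp add: W_def vf_add_def vf_scale_def frame_dual[OF F] inner_onb)
    then show "W p \<noteq> (\<lambda>f. 0)"
      by auto
  qed
  finally have "g p \<noteq> 0" by simp
  then obtain M3 where M3: "open M3" "p \<in> M3" "\<forall>q\<in>M3. g q \<noteq> 0"
    by (rule smooth_fun_nonzero_open[OF g])
  have "smooth_fun A M3 (\<lambda>q. inverse (g q))"
    using M3 by (intro smooth_fun_inverse smooth_fun_subset[OF g]) auto
  then obtain k M4 where k: "smooth_fun A UNIV k" and M4: "open M4" "p \<in> M4" "M4 \<subseteq> M3"
    "\<forall>q\<in>M4. k q = inverse (g q)"
    by (rule extend_function[OF M3(1,2)])
  \<comment> \<open>Adding \<open>t W\<close> corrects the equation for \<open>c\<close> and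
    disturbs none of those for \<open>S\<close>, because \<open>W\<close> is orthogonal to these
    fields near \<open>p\<close>. The global function \<open>k\<close> stands in for
    \<open>1/g\<close>.\<close>
  define t where "t = (\<lambda>q. (w c q - h q (V q) (X c q)) * k q)"
  have t: "smooth_fun A UNIV t"
    unfolding t_def using insert.prems k by (intro smooth_fun_mult smooth_fun_diff h_smooth V Xin) auto
  define a' where "a' = (\<lambda>b. if b = c then t else (\<lambda>q. a b q - t q * e b q))"
  have a': "smooth_fun A UNIV (a' b)" for b
    unfolding a'_def using a e t by (auto intro!: smooth_fun_diff smooth_fun_mult)
  have sum: "vf_sum (insert c S) (\<lambda>b. vf_scale (a' b) (X b)) = vf_add V (vf_scale t W)"
  proof (intro ext)
    fix q f
    have "(\<Sum>b\<in>S. a' b q * X b q f) = (\<Sum>b\<in>S. a b q * X b q f - t q * (e b q * X b q f))"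
      using insert.hyps by (intro sum.cong) (auto simp: a'_def algebra_simps)
    also have "\<dots> = V q f - t q * U q f"
      by (simp add: V_def U_def vf_sum_def vf_scale_def sum_subtractf sum_distrib_left)
    finally have "vf_sum (insert c S) (\<lambda>b. vf_scale (a' b) (X b)) q f
        = a' c q * X c q f + (V q f - t q * U q f)"
      using insert.hyps by (simp add: vf_sum_def vf_scale_def)
    then show "vf_sum (insert c S) (\<lambda>b. vf_scale (a' b) (X b)) q f = vf_add V (vf_scale t W) q f"
      by (simp add: a'_def W_def vf_add_def vf_scale_def algebra_simps)
  qed
  have "h q (vf_add V (vf_scale t W) q) (X b q) = w b q"
    if q: "q \<in> M1 \<inter> M2 \<inter> M4" and b: "b \<in> insert c S" for q b
  proof -
    have eq: "h q (vf_add V (vf_scale t W) q) (X b q) = h q (V q) (X b q) + t q * h q (W q) (X b q)"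
      by (simp add: h_vf_add(1)[OF V vf_scale_in[OF t W] vf_tangent[OF Xin]]
          h_vf_scale(1)[OF W vf_tangent[OF Xin]])
    show ?thesis
    proof (cases "b = c")
      case True
      have "g q \<noteq> 0" "k q = inverse (g q)"
        using q M3(3) M4(3,4) by auto
      then show ?thesis
        using eq True by (simp add: t_def mult.assoc flip: g_def[THEN fun_cong])
    next
      case False
      then show ?thesis
        using eq WX[of q b] M1(3) q b by (simp add: V_def)
    qed
  qed
  then show ?case
    using a' M1(1,2) M2(1,2) M4(1,2)
    by (intro exI[of _ a'] exI[of _ "M1 \<inter> M2 \<inter> M4"]) (auto simp: sum)
qed

text \<open>Near each point the Gram system of a frame provides a smooth solution. Positive
  definiteness makes the representing vector unique at each point, so the local solutions fit
  together without a partition of unity.\<close>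

lemma riesz:
  assumes \<omega>: "tensorial \<omega>" and sm: "\<And>Y. Y \<in> vector_fields A \<Longrightarrow> smooth_fun A UNIV (\<omega> Y)"
  obtains V where "V \<in> vector_fields A" "\<forall>Y\<in>vector_fields A. \<forall>p. h p (V p) (Y p) = \<omega> Y p"
proof -
  have loc: "\<exists>V M. V \<in> vector_fields A \<and> open M \<and> p \<in> M \<and>
      (\<forall>q\<in>M. \<forall>Y\<in>vector_fields A. h q (V q) (Y q) = \<omega> Y q)" for p
  proof -
    obtain N X x where F: "local_frame N X x" "p \<in> N"
      by (rule frame_exists)
    obtain a M where a: "\<forall>b. smooth_fun A UNIV (a b)" and M: "open M" "p \<in> M"
      "\<forall>q\<in>M. \<forall>b\<in>onb. h q (vf_sum onb (\<lambda>b. vf_scale (a b) (X b)) q) (X b q) = \<omega> (X b) q"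
      using gram_solvable[OF F finite_onb order_refl, of "\<lambda>b. \<omega> (X b)", OF sm[OF frame_in[OF F(1)]]]
      by (elim exE conjE)
    define V where "V = vf_sum onb (\<lambda>b. vf_scale (a b) (X b))"
    have V: "V \<in> vector_fields A"
      unfolding V_def by (intro vf_sum_in vf_scale_in a[rule_format] frame_in[OF F(1)])
    have "h q (V q) (Y q) = \<omega> Y q" if q: "q \<in> M \<inter> N" and Y: "Y \<in> vector_fields A" for q Y
    proof -
      have qN: "q \<in> N" using q by simp
      have sym: "h q (V q) (Z q) = h q (Z q) (V q)" if "Z \<in> vector_fields A" for Z
        by (rule h_sym[OF vf_tangent[OF V] vf_tangent[OF that]])
      have "h q (V q) (Y q) = (\<Sum>b\<in>onb. Y q (x b) * h q (V q) (X b q))"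
        using tensorial_expansion[OF h_tensorial[OF V] F(1) qN Y]
        by (simp add: sym[OF Y] sym[OF frame_in[OF F(1)]])
      also have "\<dots> = (\<Sum>b\<in>onb. Y q (x b) * \<omega> (X b) q)"
        using M(3) q by (simp add: V_def)
      also have "\<dots> = \<omega> Y q"
        by (rule tensorial_expansion[OF \<omega> F(1) qN Y, symmetric])
      finally show ?thesis .
    qed
    then show ?thesis
      using V M F frame_open[OF F(1)] by (intro exI[of _ V] exI[of _ "M \<inter> N"]) auto
  qed
  have "\<exists>v. v \<in> tangent_space A p \<and> (\<forall>Y\<in>vector_fields A. h p v (Y p) = \<omega> Y p)" for p
    using loc[of p] vf_tangent by blast
  then obtain V where V: "\<And>p. V p \<in> tangent_space A p"
    "\<And>p Y. Y \<in> vector_fields A \<Longrightarrow> h p (V p) (Y p) = \<omega> Y p"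
    by metis
  show thesis
  proof (rule that[of V])
    show "V \<in> vector_fields A"
    proof (rule vf_localI)
      fix p
      obtain V' M where M: "V' \<in> vector_fields A" "open M" "p \<in> M"
        "\<forall>q\<in>M. \<forall>Y\<in>vector_fields A. h q (V' q) (Y q) = \<omega> Y q"
        using loc by blast
      \<comment> \<open>Uniqueness identifies the pointwise choice with a local smooth solution,
        which is the source of its smoothness.\<close>
      have "V q = V' q" if "q \<in> M" for q
        using M(4) that V(2) by (intro h_eqI[OF V(1) vf_tangent[OF M(1)]]) simp
      then show "\<exists>N Y. open N \<and> p \<in> N \<and> Y \<in> vector_fields A \<and> (\<forall>q\<in>N. V q = Y q)"
        using M by blast
    qed
  qed (use V(2) in blast)
qed

lemma
  assumes \<eta>: "\<eta> \<in> one_forms A"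
  shows sharp_in: "sharp A h \<eta> \<in> vector_fields A"
    and h_sharp: "Y \<in> vector_fields A \<Longrightarrow> h p (sharp A h \<eta> p) (Y p) = \<eta> p (Y p)"
proof -
  have \<eta>_lin: "\<eta> p (vf_add X Y p) = \<eta> p (X p) + \<eta> p (Y p)" "\<eta> p (vf_scale g X p) = g p * \<eta> p (X p)"
    if "X \<in> vector_fields A" "Y \<in> vector_fields A" for p X Y g
    using \<eta> vf_tangent[OF that(1)] vf_tangent[OF that(2)]
    unfolding one_forms_def vf_add_def vf_scale_def by simp_all
  have "tensorial (\<lambda>Y p. \<eta> p (Y p))"
    unfolding tensorial_def using \<eta>_lin by simp
  moreover have "smooth_fun A UNIV (\<lambda>p. \<eta> p (Y p))" if "Y \<in> vector_fields A" for Y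
    using \<eta> that unfolding one_forms_def by simp
  ultimately obtain V where V: "V \<in> vector_fields A"
    "\<forall>Y\<in>vector_fields A. \<forall>p. h p (V p) (Y p) = \<eta> p (Y p)"
    by (rule riesz)
  have "sharp A h \<eta> = V"
  proof
    fix p
    show "sharp A h \<eta> p = V p"
      unfolding sharp_def
    proof (rule the_equality)
      show "V p \<in> tangent_space A p \<and> (\<forall>w\<in>tangent_space A p. h p (V p) w = \<eta> p w)"
        using V vf_tangent by (metis tangent_extends)
      show "v = V p" if "v \<in> tangent_space A p \<and> (\<forall>w\<in>tangent_space A p. h p v w = \<eta> p w)" for v
        using that V vf_tangent by (intro h_eqI[OF _ vf_tangent[OF V(1)]]) auto
    qed
  qed
  then show "sharp A h \<eta> \<in> vector_fields A"
    "Y \<in> vector_fields A \<Longrightarrow> h p (sharp A h \<eta> p) (Y p) = \<eta> p (Y p)"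
    using V by auto
qed

end

section \<open>The conjugate connection\<close>

context riem_mfd
begin

lemma conjugate_exists:
  assumes D: "connection A D"
  shows "\<exists>D'. is_conjugate_connection A D h D'"
proof -
  \<comment> \<open>The conjugacy identity solved for \<open>h p (D' Z Y p) (W p)\<close>, to be
    represented by a field for fixed \<open>Z\<close> and \<open>Y\<close>.\<close>
  define \<omega> where "\<omega> = (\<lambda>Z Y W p. Z p (\<lambda>q. h q (W q) (Y q)) - h p (D Z W p) (Y p))"
  have near: "smooth_near A p (\<lambda>q. h q (X q) (Y q))"
    if "X \<in> vector_fields A" "Y \<in> vector_fields A" for X Y p
    by (rule smooth_near_global[OF h_smooth[OF that]])
  have "\<exists>V. V \<in> vector_fields A \<and> (\<forall>W\<in>vector_fields A. \<forall>p. h p (V p) (W p) = \<omega> Z Y W p)"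
    if Z: "Z \<in> vector_fields A" and Y: "Y \<in> vector_fields A" for Z Y
  proof -
    have "\<omega> Z Y (vf_add W W') p = \<omega> Z Y W p + \<omega> Z Y W' p"
      if W: "W \<in> vector_fields A" and W': "W' \<in> vector_fields A" for W W' p
    proof -
      have "(\<lambda>q. h q (vf_add W W' q) (Y q)) = (\<lambda>q. h q (W q) (Y q) + h q (W' q) (Y q))"
        by (simp add: h_vf_add(1)[OF W W' vf_tangent[OF Y]])
      then show ?thesis
        by (simp add: \<omega>_def tangent_add[OF vf_tangent[OF Z] near[OF W Y] near[OF W' Y]]
            conn_add2[OF D Z W W'] h_vf_add(1)[OF conn_in[OF D Z W] conn_in[OF D Z W'] vf_tangent[OF Y]])
    qed
    \<comment> \<open>The derivative of \<open>g\<close> appears once from the product rule for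
      \<open>Z\<close> and once from the Leibniz rule of \<open>D\<close>, and cancels.\<close>
    moreover have "\<omega> Z Y (vf_scale g W) p = g p * \<omega> Z Y W p"
      if W: "W \<in> vector_fields A" and g: "smooth_fun A UNIV g" for W g p
    proof -
      have "(\<lambda>q. h q (vf_scale g W q) (Y q)) = (\<lambda>q. g q * h q (W q) (Y q))"
        by (simp add: h_vf_scale(1)[OF W vf_tangent[OF Y]])
      then show ?thesis
        by (simp add: \<omega>_def tangent_mult[OF vf_tangent[OF Z] smooth_near_global[OF g] near[OF W Y]]
            conn_leibniz[OF D Z W g] h_vf_add(1)[OF vf_scale_in[OF vf_smooth_fun[OF Z open_UNIV g] W]
              vf_scale_in[OF g conn_in[OF D Z W]] vf_tangent[OF Y]]
            h_vf_scale(1)[OF W vf_tangent[OF Y]] h_vf_scale(1)[OF conn_in[OF D Z W] vf_tangent[OF Y]]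
            algebra_simps)
    qed
    ultimately have t: "tensorial (\<omega> Z Y)"
      by (simp add: tensorial_def)
    have "smooth_fun A UNIV (\<omega> Z Y W)" if W: "W \<in> vector_fields A" for W
      unfolding \<omega>_def
      by (intro smooth_fun_diff vf_smooth_fun[OF Z] h_smooth conn_in[OF D Z] W Y open_UNIV)
    with t obtain V where "V \<in> vector_fields A"
      "\<forall>W\<in>vector_fields A. \<forall>p. h p (V p) (W p) = \<omega> Z Y W p"
      by (rule riesz)
    then show ?thesis by blast
  qed
  then obtain V where V: "\<And>Z Y. Z \<in> vector_fields A \<Longrightarrow> Y \<in> vector_fields A \<Longrightarrow> V Z Y \<in> vector_fields A"
    "\<And>Z Y W p. Z \<in> vector_fields A \<Longrightarrow> Y \<in> vector_fields A \<Longrightarrow> W \<in> vector_fields A \<Longrightarrow>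
      h p (V Z Y p) (W p) = \<omega> Z Y W p"
    by metis
  \<comment> \<open>The value \<open>undefined\<close> off the vector fields is prescribed by the
    last clause of \<open>connection\<close>.\<close>
  define D' where "D' = (\<lambda>Z Y. if Z \<in> vector_fields A \<and> Y \<in> vector_fields A then V Z Y else undefined)"
  have D'_in: "D' Z Y \<in> vector_fields A" if "Z \<in> vector_fields A" "Y \<in> vector_fields A" for Z Y
    using V(1) that by (simp add: D'_def)
  have D'_h: "h p (D' Z Y p) (W p) = \<omega> Z Y W p"
    if "Z \<in> vector_fields A" "Y \<in> vector_fields A" "W \<in> vector_fields A" for Z Y W p
    using V(2) that by (simp add: D'_def)
  have "D' (vf_add X X') Y = vf_add (D' X Y) (D' X' Y)"
    if X: "X \<in> vector_fields A" and X': "X' \<in> vector_fields A" and Y: "Y \<in> vector_fields A" for X X' Y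
  proof (rule h_vf_eqI)
    fix W p assume W: "W \<in> vector_fields A"
    show "h p (D' (vf_add X X') Y p) (W p) = h p (vf_add (D' X Y) (D' X' Y) p) (W p)"
      by (simp add: D'_h[OF vf_add_in[OF X X'] Y W] D'_h[OF X Y W] D'_h[OF X' Y W] \<omega>_def
          h_vf_add(1)[OF D'_in[OF X Y] D'_in[OF X' Y] vf_tangent[OF W]] conn_add1[OF D X W X']
          h_vf_add(1)[OF conn_in[OF D X W] conn_in[OF D X' W] vf_tangent[OF Y]])
        (simp add: vf_add_def)
  qed (intro D'_in vf_add_in X X' Y)+
  moreover have "D' (vf_scale g X) Y = vf_scale g (D' X Y)"
    if g: "smooth_fun A UNIV g" and X: "X \<in> vector_fields A" and Y: "Y \<in> vector_fields A" for g X Y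
  proof (rule h_vf_eqI)
    fix W p assume W: "W \<in> vector_fields A"
    show "h p (D' (vf_scale g X) Y p) (W p) = h p (vf_scale g (D' X Y) p) (W p)"
      by (simp add: D'_h[OF vf_scale_in[OF g X] Y W] D'_h[OF X Y W] \<omega>_def
          h_vf_scale(1)[OF D'_in[OF X Y] vf_tangent[OF W]] conn_scale1[OF D X W g]
          h_vf_scale(1)[OF conn_in[OF D X W] vf_tangent[OF Y]])
        (simp add: vf_scale_def algebra_simps)
  qed (intro D'_in vf_scale_in g X Y)+
  moreover have "D' X (vf_add Y Y') = vf_add (D' X Y) (D' X Y')"
    if X: "X \<in> vector_fields A" and Y: "Y \<in> vector_fields A" and Y': "Y' \<in> vector_fields A" for X Y Y'
  proof (rule h_vf_eqI)
    fix W p assume W: "W \<in> vector_fields A"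
    have "(\<lambda>q. h q (W q) (vf_add Y Y' q)) = (\<lambda>q. h q (W q) (Y q) + h q (W q) (Y' q))"
      by (simp add: h_vf_add(2)[OF Y Y' vf_tangent[OF W]])
    then show "h p (D' X (vf_add Y Y') p) (W p) = h p (vf_add (D' X Y) (D' X Y') p) (W p)"
      by (simp add: D'_h[OF X vf_add_in[OF Y Y'] W] D'_h[OF X Y W] D'_h[OF X Y' W] \<omega>_def
          tangent_add[OF vf_tangent[OF X] near[OF W Y] near[OF W Y']]
          h_vf_add(1)[OF D'_in[OF X Y] D'_in[OF X Y'] vf_tangent[OF W]]
          h_vf_add(2)[OF Y Y' vf_tangent[OF conn_in[OF D X W]]])
  qed (intro D'_in vf_add_in X Y Y')+
  moreover have "D' X (vf_scale g Y) = vf_add (vf_scale (\<lambda>p. X p g) Y) (vf_scale g (D' X Y))"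
    if g: "smooth_fun A UNIV g" and X: "X \<in> vector_fields A" and Y: "Y \<in> vector_fields A" for g X Y
  proof (rule h_vf_eqI)
    have Xg: "smooth_fun A UNIV (\<lambda>p. X p g)"
      by (rule vf_smooth_fun[OF X open_UNIV g])
    show "vf_add (vf_scale (\<lambda>p. X p g) Y) (vf_scale g (D' X Y)) \<in> vector_fields A"
      by (intro vf_add_in vf_scale_in Xg g D'_in X Y)
    fix W p assume W: "W \<in> vector_fields A"
    have "(\<lambda>q. h q (W q) (vf_scale g Y q)) = (\<lambda>q. g q * h q (W q) (Y q))"
      by (simp add: h_vf_scale(2)[OF Y vf_tangent[OF W]])
    then show "h p (D' X (vf_scale g Y) p) (W p)
        = h p (vf_add (vf_scale (\<lambda>p. X p g) Y) (vf_scale g (D' X Y)) p) (W p)"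
      by (simp add: D'_h[OF X vf_scale_in[OF g Y] W] D'_h[OF X Y W] \<omega>_def
          tangent_mult[OF vf_tangent[OF X] smooth_near_global[OF g] near[OF W Y]]
          h_vf_add(1)[OF vf_scale_in[OF Xg Y] vf_scale_in[OF g D'_in[OF X Y]] vf_tangent[OF W]]
          h_vf_scale(1)[OF Y vf_tangent[OF W]] h_vf_scale(1)[OF D'_in[OF X Y] vf_tangent[OF W]]
          h_vf_scale(2)[OF Y vf_tangent[OF conn_in[OF D X W]]]
          h_sym[OF vf_tangent[OF W, of p] vf_tangent[OF Y, of p]] algebra_simps)
  qed (intro D'_in vf_scale_in g X Y)
  ultimately have "connection A D'"
    unfolding connection_def using D'_in by (simp add: D'_def)
  moreover have "Z p (\<lambda>q. h q (X q) (Y q)) = h p (D Z X p) (Y p) + h p (X p) (D' Z Y p)"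
    if X: "X \<in> vector_fields A" and Y: "Y \<in> vector_fields A" and Z: "Z \<in> vector_fields A" for X Y Z p
    using D'_h[OF Z Y X] h_sym[OF vf_tangent[OF X] vf_tangent[OF D'_in[OF Z Y]]] by (simp add: \<omega>_def)
  ultimately show ?thesis
    unfolding is_conjugate_connection_def by blast
qed

lemma conjugate_connection_is_conjugate:
  assumes D: "connection A D"
  shows "is_conjugate_connection A D h (conjugate_connection A D h)"
  unfolding conjugate_connection_def
proof (rule theI'[of "is_conjugate_connection A D h"])
  have "D1 = D2" if D1: "is_conjugate_connection A D h D1" and D2: "is_conjugate_connection A D h D2"
    for D1 D2
  proof (intro ext)
    fix Z Y p f
    note c1 = D1[unfolded is_conjugate_connection_def, THEN conjunct1]
      and c2 = D2[unfolded is_conjugate_connection_def, THEN conjunct1]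
    have "D1 Z Y = D2 Z Y"
    proof (cases "Z \<in> vector_fields A \<and> Y \<in> vector_fields A")
      case True
      then have Z: "Z \<in> vector_fields A" and Y: "Y \<in> vector_fields A" by auto
      note i1 = conn_in[OF c1 Z Y] and i2 = conn_in[OF c2 Z Y]
      show ?thesis
      proof (rule h_vf_eqI[OF i1 i2])
        fix W p assume W: "W \<in> vector_fields A"
        have "h p (W p) (D1 Z Y p) = h p (W p) (D2 Z Y p)"
          using D1[unfolded is_conjugate_connection_def, THEN conjunct2, rule_format, OF W Y Z, of p]
            D2[unfolded is_conjugate_connection_def, THEN conjunct2, rule_format, OF W Y Z, of p]
          by simp
        then show "h p (D1 Z Y p) (W p) = h p (D2 Z Y p) (W p)"
          by (simp add: h_sym[OF vf_tangent[OF W] vf_tangent[OF i1]]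
              h_sym[OF vf_tangent[OF W] vf_tangent[OF i2]])
      qed
    next
      \<comment> \<open>Off the vector fields both connections take the value
        \<open>undefined\<close>, so uniqueness holds for the HOL functions themselves, as the
        definite description demands.\<close>
      case False
      then show ?thesis
        using c1 c2 unfolding connection_def by (metis (lifting))
    qed
    then show "D1 Z Y p f = D2 Z Y p f" by simp
  qed
  then show "\<exists>!D'. is_conjugate_connection A D h D'"
    using conjugate_exists[OF D] by blast
qed

end

section \<open>Curvature and Euler fields of the conjugate connection\<close>

locale conj_mfd = riem_mfd A h
  for A :: "('m::{t2_space, second_countable_topology}, 'e::{real_inner, heine_borel}) atlas"
    and h :: "'m bilinear_field" +
  fixes D D' :: "'m covariant_derivative"
  assumes D: "connection A D" and conj: "is_conjugate_connection A D h D'"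
begin

lemma D': "connection A D'"
  using conj by (simp add: is_conjugate_connection_def)

lemma h_conj:
  assumes "X \<in> vector_fields A" "Y \<in> vector_fields A" "Z \<in> vector_fields A"
  shows "h p (X p) (D' Z Y p) = Z p (\<lambda>q. h q (X q) (Y q)) - h p (D Z X p) (Y p)"
  using conj[unfolded is_conjugate_connection_def, THEN conjunct2, rule_format, OF assms, of p] by simp

lemma conj_flat:
  assumes flat: "flat A D"
  shows "flat A D'"
  unfolding flat_def
proof (intro ballI allI)
  fix X Y Z p f
  assume X: "X \<in> vector_fields A" and Y: "Y \<in> vector_fields A" and Z: "Z \<in> vector_fields A"
  note L = lie_bracket_in[OF X Y]
  note in1 = conn_in[OF D' X conn_in[OF D' Y Z]] and in2 = conn_in[OF D' Y conn_in[OF D' X Z]]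
    and in3 = conn_in[OF D' L Z]
  have "D' X (D' Y Z) = vf_add (D' Y (D' X Z)) (D' (lie_bracket A X Y) Z)"
  proof (rule h_vf_eqI[OF in1 vf_add_in[OF in2 in3]])
    fix W p assume W: "W \<in> vector_fields A"
    \<comment> \<open>Conjugacy used twice. The two middle terms are symmetric in \<open>U\<close>
      and \<open>T\<close> and drop out of the curvature, the first yields the bracket, and the last
      carries the derivatives of \<open>D\<close> in reversed order, hence the minus sign between
      the curvatures.\<close>
    have second: "h p (W p) (D' U (D' T Z) p) = U p (\<lambda>q. T q (\<lambda>q. h q (W q) (Z q)))
        - U p (\<lambda>q. h q (D T W q) (Z q)) - T p (\<lambda>q. h q (D U W q) (Z q)) + h p (D T (D U W) p) (Z p)"
      if U: "U \<in> vector_fields A" and T: "T \<in> vector_fields A" for U T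
    proof -
      have "(\<lambda>q. h q (W q) (D' T Z q)) = (\<lambda>q. T q (\<lambda>q. h q (W q) (Z q)) - h q (D T W q) (Z q))"
        by (simp add: h_conj[OF W Z T])
      then have "h p (W p) (D' U (D' T Z) p)
          = U p (\<lambda>q. T q (\<lambda>q. h q (W q) (Z q)) - h q (D T W q) (Z q)) - h p (D U W p) (D' T Z p)"
        by (simp add: h_conj[OF W conn_in[OF D' T Z] U])
      also have "U p (\<lambda>q. T q (\<lambda>q. h q (W q) (Z q)) - h q (D T W q) (Z q))
          = U p (\<lambda>q. T q (\<lambda>q. h q (W q) (Z q))) - U p (\<lambda>q. h q (D T W q) (Z q))"
        by (intro tangent_diff[OF vf_tangent[OF U]] smooth_near_global vf_smooth_fun[OF T]
            h_smooth W Z conn_in[OF D T] open_UNIV)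
      finally show ?thesis
        by (simp add: h_conj[OF conn_in[OF D U W] Z T])
    qed
    have "D X (D Y W) = vf_add (D Y (D X W)) (D (lie_bracket A X Y) W)"
    proof (intro ext)
      fix p f
      show "D X (D Y W) p f = vf_add (D Y (D X W)) (D (lie_bracket A X Y) W) p f"
        using flat[unfolded flat_def, rule_format, OF X Y W, of p f] by (simp add: vf_add_def)
    qed
    then have "h p (D X (D Y W) p) (Z p)
        = h p (D Y (D X W) p) (Z p) + h p (D (lie_bracket A X Y) W p) (Z p)"
      by (simp add: h_vf_add(1)[OF conn_in[OF D Y conn_in[OF D X W]] conn_in[OF D L W] vf_tangent[OF Z]])
    moreover have "lie_bracket A X Y p (\<lambda>q. h q (W q) (Z q))
        = X p (\<lambda>q. Y q (\<lambda>q. h q (W q) (Z q))) - Y p (\<lambda>q. X q (\<lambda>q. h q (W q) (Z q)))"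
      using smooth_near_global[OF h_smooth[OF W Z]] by (simp add: lie_bracket_def)
    ultimately have "h p (W p) (D' X (D' Y Z) p)
        = h p (W p) (D' Y (D' X Z) p) + h p (W p) (D' (lie_bracket A X Y) Z p)"
      by (simp add: second[OF X Y] second[OF Y X] h_conj[OF W Z L])
    then show "h p (D' X (D' Y Z) p) (W p)
        = h p (vf_add (D' Y (D' X Z)) (D' (lie_bracket A X Y) Z) p) (W p)"
      by (simp add: h_vf_add(1)[OF in2 in3 vf_tangent[OF W]] h_sym[OF vf_tangent[OF W] vf_tangent[OF in1]]
          h_sym[OF vf_tangent[OF W] vf_tangent[OF in2]] h_sym[OF vf_tangent[OF W] vf_tangent[OF in3]])
  qed
  then show "D' X (D' Y Z) p f - D' Y (D' X Z) p f - D' (lie_bracket A X Y) Z p f = 0"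
    by (simp add: vf_add_def)
qed

lemma sharp_euler:
  assumes "one_form_potential A D h \<eta>"
  shows "euler_field A D' (sharp A h \<eta>)"
  unfolding euler_field_def
proof (intro conjI ballI)
  have \<eta>: "\<eta> \<in> one_forms A"
    using assms by (simp add: one_form_potential_def)
  note E = sharp_in[OF \<eta>]
  show "sharp A h \<eta> \<in> vector_fields A" by (rule E)
  fix X assume X: "X \<in> vector_fields A"
  note DE = conn_in[OF D' X E]
  show "D' X (sharp A h \<eta>) = X"
  proof (rule h_vf_eqI[OF DE X])
    fix W p assume W: "W \<in> vector_fields A"
    have hE: "h q (Y q) (sharp A h \<eta> q) = \<eta> q (Y q)" if "Y \<in> vector_fields A" for Y q
      using h_sharp[OF \<eta> that] h_sym[OF vf_tangent[OF that] vf_tangent[OF E]] by simp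
    have "h p (W p) (D' X (sharp A h \<eta>) p) = X p (\<lambda>q. \<eta> q (W q)) - \<eta> p (D X W p)"
      by (simp add: h_conj[OF W E X] hE[OF W] hE[OF conn_in[OF D X W]])
    also have "\<dots> = h p (X p) (W p)"
      using assms X W by (simp add: one_form_potential_def cov_deriv_form_def)
    finally show "h p (D' X (sharp A h \<eta>) p) (W p) = h p (X p) (W p)"
      by (simp add: h_sym[OF vf_tangent[OF W] vf_tangent[OF DE]])
  qed
qed

end

context smooth_mfd
begin

lemma flat_euler_torsion_free:
  assumes D: "connection A D" and "flat A D" and "euler_field A D H"
  shows "torsion_free A D"
  using assms(2,3) lie_bracket_in unfolding torsion_free_def flat_def euler_field_def
  by (metis (no_types, lifting))

section \<open>Local Euler fields\<close>

text \<open>For \<open>H\<close> with components \<open>w k\<close> in a coordinate frame the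
  condition reads: the \<open>b\<close>-derivative of \<open>w k\<close> is
  \<open>b \<bullet> k\<close> minus the sum over \<open>m\<close> of
  \<open>\<Gamma> k b m * w m\<close>. This is the linear system solved below; \<open>H\<close> is
  then made global, while the equation is claimed only on \<open>M\<close>.\<close>

lemma local_euler_field:
  assumes D: "connection A D" and flat: "flat A D" and tf: "torsion_free A D"
  shows "\<exists>H M. H \<in> vector_fields A \<and> open M \<and> p \<in> M \<and>
    (\<forall>X\<in>vector_fields A. \<forall>q\<in>M. D X H q = X q)"
proof (rule coordinate_frame[of p])
  fix N V \<phi> r X x
  assume V: "(V, \<phi>) \<in> A" and N: "open N" "p \<in> N" "N \<subseteq> V" and r: "r > 0"
    and im: "\<phi> ` N = ball (\<phi> p) r"
    and Xin: "\<And>b. X b \<in> vector_fields A" and xs: "\<And>b. smooth_fun A UNIV (x b)"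
    and Xc: "\<And>b q. q \<in> N \<Longrightarrow> X b q = coord_vec V \<phi> b q"
    and dual: "\<And>b c q. q \<in> N \<Longrightarrow> X b q (x c) = b \<bullet> c"
    and ex: "\<And>q v f. q \<in> N \<Longrightarrow> v \<in> tangent_space A q \<Longrightarrow> v f = (\<Sum>b\<in>onb. v (x b) * X b q f)"
  have F: "local_frame N X x"
    unfolding local_frame_def
    by (intro conjI ballI allI N(1) Xin xs dual; (assumption | rule ex; assumption))
  let ?i = "inv_into V \<phi>"
  define \<Gamma> where "\<Gamma> = (\<lambda>k b c q. D (X b) (X c) q (x k))"
  have DX: "D (X b) (X c) \<in> vector_fields A" for b c
    by (rule conn_in[OF D Xin Xin])
  have \<Gamma>s: "smooth_fun A UNIV (\<Gamma> k b c)" for k b c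
    unfolding \<Gamma>_def by (rule vf_smooth_fun[OF DX open_UNIV xs])
  have dd_X: "dd b (g \<circ> ?i) (\<phi> q) = X b q g" if "q \<in> N" "smooth_near A q g" for b q g
    using that by (simp add: Xc coord_vec_def)
  \<comment> \<open>Coordinate fields commute: each \<open>X c\<close> sends the coordinate
    functions to constants on \<open>N\<close>.\<close>
  have bracket: "lie_bracket A (X b) (X c) q (x k) = 0" if q: "q \<in> N" for b c k q
  proof -
    have *: "X b q (\<lambda>q. X c q (x k)) = 0" for b c
    proof -
      have "X b q (\<lambda>q. X c q (x k)) = X b q (\<lambda>q. c \<bullet> k)"
        by (rule vf_cong[OF Xin N(1) q]) (rule dual)
      then show ?thesis
        by (simp add: tangent_const[OF vf_tangent[OF Xin]])
    qed
    show ?thesis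
      by (simp add: lie_bracket_def smooth_near_global[OF xs] *)
  qed
  have bracket0: "lie_bracket A (X b) (X c) q f = 0" if "q \<in> N" for b c q f
    using ex[OF that vf_tangent[OF lie_bracket_in[OF Xin Xin]], of b c f] bracket[OF that] by simp
  have \<Gamma>_sym: "\<Gamma> k b c q = \<Gamma> k c b q" if "q \<in> N" for k b c q
  proof -
    have "D (X b) (X c) q (x k) - D (X c) (X b) q (x k) - lie_bracket A (X b) (X c) q (x k) = 0"
      using tf Xin unfolding torsion_free_def by blast
    then show ?thesis
      by (simp add: \<Gamma>_def bracket0[OF that])
  qed
  \<comment> \<open>\<open>D (X c) (X k)\<close> equals its expansion with coefficients
    \<open>\<Gamma>\<close> only on \<open>N\<close>; locality of \<open>D\<close> in the second
    argument permits the replacement before differentiating again.\<close>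
  have second: "D (X b) (D (X c) (X k)) q (x i)
      = X b q (\<Gamma> i c k) + (\<Sum>m\<in>onb. \<Gamma> m c k q * \<Gamma> i b m q)"
    if q: "q \<in> N" and i: "i \<in> onb" for b c k q i
  proof -
    define Y where "Y = vf_sum onb (\<lambda>m. vf_scale (\<Gamma> m c k) (X m))"
    have Y: "Y \<in> vector_fields A"
      unfolding Y_def by (intro vf_sum_in vf_scale_in \<Gamma>s Xin)
    have "D (X c) (X k) s = Y s" if "s \<in> N" for s
      by (intro ext) (simp add: Y_def vf_sum_def vf_scale_def \<Gamma>_def ex[OF that vf_tangent[OF DX], symmetric])
    then have "D (X b) (D (X c) (X k)) q = D (X b) Y q"
      by (rule conn_germ[OF D Xin DX Y N(1) q])
    then have "D (X b) (D (X c) (X k)) q (x i)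
        = (\<Sum>m\<in>onb. X b q (\<Gamma> m c k) * X m q (x i) + \<Gamma> m c k q * D (X b) (X m) q (x i))"
      unfolding Y_def by (simp add: conn_sum_scale[OF D Xin finite_onb Xin \<Gamma>s])
    also have "\<dots> = (\<Sum>m\<in>onb. X b q (\<Gamma> m c k) * (if m = i then 1 else 0)) + (\<Sum>m\<in>onb. \<Gamma> m c k q * \<Gamma> i b m q)"
      using i by (simp add: dual[OF q] inner_onb sum.distrib \<Gamma>_def)
    also have "(\<Sum>m\<in>onb. X b q (\<Gamma> m c k) * (if m = i then 1 else 0)) = X b q (\<Gamma> i c k)"
      using i by (simp add: if_distrib sum.If_cases cong: if_cong)
    finally show ?thesis .
  qed
  have curvature: "X b q (\<Gamma> i c k) + (\<Sum>m\<in>onb. \<Gamma> m c k q * \<Gamma> i b m q)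
      = X c q (\<Gamma> i b k) + (\<Sum>m\<in>onb. \<Gamma> m b k q * \<Gamma> i c m q)"
    if q: "q \<in> N" and i: "i \<in> onb" for b c k q i
  proof -
    let ?L = "lie_bracket A (X b) (X c)"
    have "D ?L (X k) q (x i) = (\<Sum>m\<in>onb. ?L q (x m) * D (X m) (X k) q (x i))"
      by (rule tensorial_expansion[OF conn_tensorial[OF D Xin] F q lie_bracket_in[OF Xin Xin]])
    also have "\<dots> = 0"
      by (simp add: bracket[OF q])
    finally have "D ?L (X k) q (x i) = 0" .
    moreover have "D (X b) (D (X c) (X k)) q (x i) - D (X c) (D (X b) (X k)) q (x i) - D ?L (X k) q (x i) = 0"
      using flat Xin unfolding flat_def by blast
    ultimately show ?thesis
      by (simp add: second[OF q i])
  qed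
  define a where "a = (\<lambda>k m b y. - 1 * (\<Gamma> k b m \<circ> ?i) y)"
  define \<beta> where "\<beta> = (\<lambda>(k::'e) b (y::'e). b \<bullet> k)"
  have \<Gamma>_smooth: "smooth_on (ball (\<phi> p) r) (\<Gamma> k b m \<circ> ?i)" for k b m
    using smooth_fun_chartD[OF smooth_fun_subset[OF \<Gamma>s subset_UNIV] V N(3)] by (simp add: im)
  have a_smooth: "smooth_on (ball (\<phi> p) r) (a k m b)" for k m b
    unfolding a_def by (intro smooth_on_mult smooth_on_const \<Gamma>_smooth open_ball)
  have integ: "dd b (\<beta> i c) y + (\<Sum>j\<in>onb. dd b (a i j c) y * w j + a i j c y * (\<beta> j b y + (\<Sum>k\<in>onb. a j k b y * w k))) =
      dd c (\<beta> i b) y + (\<Sum>j\<in>onb. dd c (a i j b) y * w j + a i j b y * (\<beta> j c y + (\<Sum>k\<in>onb. a j k c y * w k)))"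
    if y: "y \<in> ball (\<phi> p) r" and i: "i \<in> onb" and b: "b \<in> onb" and c: "c \<in> onb" for y i b c w
  proof -
    obtain q where q: "q \<in> N" "y = \<phi> q"
      using y im by blast
    have iq: "?i y = q"
      using q N(3) chart_inv[OF V] by auto
    \<comment> \<open>Each side of the integrability condition splits by its dependence on
      \<open>w\<close>: the part free of \<open>w\<close> is a connection coefficient, whose
      symmetry is torsion-freeness, and the coefficients of \<open>w k\<close> match by
      flatness.\<close>
    have expand: "dd b (\<beta> i c) y + (\<Sum>j\<in>onb. dd b (a i j c) y * w j
          + a i j c y * (\<beta> j b y + (\<Sum>k\<in>onb. a j k b y * w k)))
        = - \<Gamma> i c b q - (\<Sum>k\<in>onb. (X b q (\<Gamma> i c k) - (\<Sum>m\<in>onb. \<Gamma> i c m q * \<Gamma> m b k q)) * w k)"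
      if b: "b \<in> onb" for b c
    proof -
      have "dd b (a i j c) y = - 1 * X b q (\<Gamma> i c j)" for j
      proof -
        have "(\<Gamma> i c j \<circ> ?i) differentiable at y"
          using \<Gamma>_smooth y by (rule smooth_on_differentiable)
        from dd_eq[OF has_derivative_mult_right[OF dd_has_derivative[OF this]]]
        have "dd b (a i j c) y = - 1 * dd b (\<Gamma> i c j \<circ> ?i) y"
          unfolding a_def .
        then show ?thesis
          using dd_X[OF q(1) smooth_near_global[OF \<Gamma>s]] q(2) by simp
      qed
      moreover have "(\<Sum>j\<in>onb. \<Gamma> i c j q * (b \<bullet> j)) = \<Gamma> i c b q"
      proof -
        have "(\<Sum>j\<in>onb. \<Gamma> i c j q * (b \<bullet> j)) = (\<Sum>j\<in>onb. if b = j then \<Gamma> i c j q else 0)"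
          using b by (intro sum.cong) (auto simp: inner_onb)
        then show ?thesis
          using b by simp
      qed
      moreover have "(\<Sum>j\<in>onb. \<Gamma> i c j q * (\<Sum>k\<in>onb. \<Gamma> j b k q * w k))
          = (\<Sum>k\<in>onb. (\<Sum>m\<in>onb. \<Gamma> i c m q * \<Gamma> m b k q) * w k)"
        unfolding sum_distrib_left sum_distrib_right by (subst sum.swap) (simp add: mult.assoc)
      moreover have "dd b (\<beta> i c) y = 0"
        by (simp add: \<beta>_def)
      moreover have "a i j c y = - \<Gamma> i c j q" for i j c
        by (simp add: a_def iq)
      ultimately show ?thesis
        by (simp add: \<beta>_def sum.distrib sum_negf sum_subtractf left_diff_distrib right_diff_distrib)
    qed
    have "X b q (\<Gamma> i c k) - (\<Sum>m\<in>onb. \<Gamma> i c m q * \<Gamma> m b k q)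
        = X c q (\<Gamma> i b k) - (\<Sum>m\<in>onb. \<Gamma> i b m q * \<Gamma> m c k q)" for k
      using curvature[OF q(1) i, of b c k] by (simp add: mult.commute)
    then show ?thesis
      unfolding expand[OF b] expand[OF c] by (simp add: \<Gamma>_sym[OF q(1), of i c b])
  qed
  have \<beta>_smooth: "smooth_on (ball (\<phi> p) r) (\<beta> i b)" for i b
    unfolding \<beta>_def by (rule smooth_on_const)
  have "\<phi> p \<in> ball (\<phi> p) r"
    using r by simp
  then obtain s u where s: "s > 0" "ball (\<phi> p) s \<subseteq> ball (\<phi> p) r"
    and u: "\<forall>i\<in>onb. smooth_on (ball (\<phi> p) s) (u i)"
    and du: "\<forall>y\<in>ball (\<phi> p) s. \<forall>i\<in>onb. \<forall>b\<in>onb.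
      dd b (u i) y = \<beta> i b y + (\<Sum>j\<in>onb. a i j b y * u j y)"
    by (rule linear_frobenius[OF finite_onb open_ball _ a_smooth \<beta>_smooth integ])
  define N1 where "N1 = N \<inter> (V \<inter> \<phi> -` ball (\<phi> p) s)"
  have N1: "open N1" "p \<in> N1" "N1 \<subseteq> N" "N1 \<subseteq> V" "\<phi> ` N1 \<subseteq> ball (\<phi> p) s"
    using N s chart_preimage_open[OF V open_ball] by (auto simp: N1_def)
  have u_mfd: "smooth_fun A N1 (\<lambda>q. u k (\<phi> q))" if "k \<in> onb" for k
    by (rule smooth_fun_pullback[OF V N1(1,4) u[rule_format, OF that] N1(5)])
  \<comment> \<open>The solution lives on a small ball. Each component is replaced by a global
    function with the same germ, and the finitely many neighbourhoods are intersected.\<close>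
  have "\<exists>g M. smooth_fun A UNIV g \<and> open M \<and> p \<in> M \<and> M \<subseteq> N1 \<and> (\<forall>q\<in>M. g q = u k (\<phi> q))"
    if "k \<in> onb" for k
    by (rule extend_function[OF N1(1,2) u_mfd[OF that]]) blast
  then obtain w Mk where w: "\<And>k. k \<in> onb \<Longrightarrow> smooth_fun A UNIV (w k)"
    and Mk: "\<And>k. k \<in> onb \<Longrightarrow> open (Mk k) \<and> p \<in> Mk k \<and> Mk k \<subseteq> N1 \<and> (\<forall>q\<in>Mk k. w k q = u k (\<phi> q))"
    by metis
  define M where "M = N1 \<inter> (\<Inter>k\<in>onb. Mk k)"
  have M: "open M" "p \<in> M" "M \<subseteq> N1"
    unfolding M_def using N1(1,2) Mk by (auto intro!: open_Int open_INT)
  have wu: "w k q = u k (\<phi> q)" if "k \<in> onb" "q \<in> M" for k q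
    using Mk[OF that(1)] that by (auto simp: M_def)
  define H where "H = vf_sum onb (\<lambda>k. vf_scale (w k) (X k))"
  have H: "H \<in> vector_fields A"
    unfolding H_def by (intro vf_sum_in vf_scale_in w Xin)
  have basic: "D (X b) H q (x k) = b \<bullet> k" if q: "q \<in> M" and b: "b \<in> onb" and k: "k \<in> onb" for b k q
  proof -
    have qN: "q \<in> N" "q \<in> N1" and qV: "q \<in> V"
      using q M(3) N1(3,4) by auto
    have "D (X b) H q (x k)
        = (\<Sum>m\<in>onb. X b q (w m) * X m q (x k) + w m q * D (X b) (X m) q (x k))"
      unfolding H_def by (rule conn_sum_scale[OF D Xin finite_onb Xin w])
    also have "\<dots> = (\<Sum>m\<in>onb. X b q (w m) * (if m = k then 1 else 0)) + (\<Sum>m\<in>onb. w m q * \<Gamma> k b m q)"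
      using k by (simp add: dual[OF qN(1)] inner_onb sum.distrib \<Gamma>_def)
    also have "(\<Sum>m\<in>onb. X b q (w m) * (if m = k then 1 else 0)) = X b q (w k)"
      using k by (simp add: if_distrib sum.If_cases cong: if_cong)
    also have "X b q (w k) = X b q (\<lambda>q. u k (\<phi> q))"
      by (rule vf_cong[OF Xin M(1) q]) (rule wu[OF k])
    also have "\<dots> = dd b ((\<lambda>q. u k (\<phi> q)) \<circ> ?i) (\<phi> q)"
      by (rule dd_X[OF qN(1), symmetric]) (rule smooth_nearI[OF N1(1) qN(2) u_mfd[OF k]])
    also have "\<dots> = dd b (u k) (\<phi> q)"
    proof -
      have qs: "\<phi> q \<in> ball (\<phi> p) s"
        using qN(2) N1(5) by auto
      have "frechet_derivative (u k) (at (\<phi> q)) = frechet_derivative ((\<lambda>q. u k (\<phi> q)) \<circ> ?i) (at (\<phi> q))"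
      proof (rule frechet_derivative_transform_within_open[OF smooth_on_differentiable[OF u[rule_format, OF k] qs] chart_image[OF V]])
        show "\<phi> q \<in> \<phi> ` V" using qV by simp
        show "u k y = ((\<lambda>q. u k (\<phi> q)) \<circ> ?i) y" if "y \<in> \<phi> ` V" for y
          using that chart_inv[OF V] by auto
      qed
      then show ?thesis by simp
    qed
    also have "\<dots> = (b \<bullet> k) + (\<Sum>m\<in>onb. - (\<Gamma> k b m q * w m q))"
      using du[rule_format, of "\<phi> q" k b] qN(2) N1(5) k b q
      by (auto simp: \<beta>_def a_def chart_inv[OF V qV] wu)
    finally show ?thesis
      by (simp add: sum_negf mult.commute)
  qed
  have "D Y H q = Y q" if Y: "Y \<in> vector_fields A" and q: "q \<in> M" for Y q
  proof
    fix f
    have qN: "q \<in> N"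
      using q M(3) N1(3) by auto
    have coord: "D Y H q (x k) = Y q (x k)" if k: "k \<in> onb" for k
    proof -
      have "D Y H q (x k) = (\<Sum>b\<in>onb. Y q (x b) * D (X b) H q (x k))"
        by (rule tensorial_expansion[OF conn_tensorial[OF D H] F qN Y])
      also have "\<dots> = (\<Sum>b\<in>onb. Y q (x b) * X b q (x k))"
        by (simp add: basic[OF q _ k] dual[OF qN])
      also have "\<dots> = Y q (x k)"
        by (rule ex[OF qN vf_tangent[OF Y], symmetric])
      finally show ?thesis .
    qed
    have "D Y H q f = (\<Sum>b\<in>onb. D Y H q (x b) * X b q f)"
      by (rule ex[OF qN vf_tangent[OF conn_in[OF D Y H]]])
    also have "\<dots> = (\<Sum>b\<in>onb. Y q (x b) * X b q f)"
      by (simp add: coord)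
    also have "\<dots> = Y q f"
      by (rule ex[OF qN vf_tangent[OF Y], symmetric])
    finally show "D Y H q f = Y q f" .
  qed
  then show ?thesis
    using H M(1,2) by blast
qed

end

section \<open>Legendre transform of a local potential\<close>

context conj_mfd
begin

text \<open>Since \<open>D X H = X\<close> near \<open>p\<close>, the derivative
  \<open>X F = X (H f) - X f\<close> equals \<open>(D df)(X, H) = h(X, H)\<close>, so the
  differential of \<open>F\<close> is dual to \<open>H\<close>. Conjugacy then gives \<open>(D'
  dF)(X, Y) = X h(H, Y) - h(H, D' X Y) = h(D X H, Y) = h(X, Y)\<close>.\<close>

lemma conj_hessian:
  assumes flat: "flat A D" and tf: "torsion_free A D" and hess: "hessian_metric A D h"
  shows "hessian_metric A D' h"
  unfolding hessian_metric_def
proof (intro conjI allI)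
  show "riemannian_metric A h" by (rule riem)
  fix p
  obtain U f where U: "open U" "p \<in> U" "smooth_fun A U f"
    and f: "\<forall>q\<in>U. \<forall>X\<in>vector_fields A. \<forall>Y\<in>vector_fields A.
      h q (X q) (Y q) = cov_deriv_form D (differential f) X Y q"
    using hess unfolding hessian_metric_def by blast
  obtain H M where H: "H \<in> vector_fields A" and M: "open M" "p \<in> M"
    "\<forall>X\<in>vector_fields A. \<forall>q\<in>M. D X H q = X q"
    using local_euler_field[OF D flat tf] by blast
  define F where "F = (\<lambda>q. H q f - f q)"
  have UM: "open (U \<inter> M)" using U M by auto
  have F_smooth: "smooth_fun A (U \<inter> M) F"
    unfolding F_def using smooth_fun_subset[OF U(3), of "U \<inter> M"]
    by (intro smooth_fun_diff vf_smooth_fun[OF H] UM) auto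
  have XF: "X q F = h q (X q) (H q)" if X: "X \<in> vector_fields A" and q: "q \<in> U \<inter> M" for X q
  proof -
    have sn: "smooth_near A q f"
      using U q by (intro smooth_nearI[of U]) auto
    have "X q F = X q (\<lambda>q. H q f) - X q f"
      unfolding F_def by (rule tangent_diff[OF vf_tangent[OF X] vf_near[OF H sn] sn])
    moreover have "h q (X q) (H q) = X q (\<lambda>q. H q f) - D X H q f"
      using f X H q by (simp add: cov_deriv_form_def differential_def)
    ultimately show ?thesis
      using M(3) X q by simp
  qed
  have "h q (X q) (Y q) = cov_deriv_form D' (differential F) X Y q"
    if q: "q \<in> U \<inter> M" and X: "X \<in> vector_fields A" and Y: "Y \<in> vector_fields A" for q X Y
  proof -
    have "X q (\<lambda>q. Y q F) = X q (\<lambda>q. h q (Y q) (H q))"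
      by (rule vf_cong[OF X UM q]) (rule XF[OF Y])
    also have "(\<lambda>q. h q (Y q) (H q)) = (\<lambda>q. h q (H q) (Y q))"
      by (simp add: h_sym[OF vf_tangent[OF Y] vf_tangent[OF H]])
    finally have "cov_deriv_form D' (differential F) X Y q
        = X q (\<lambda>q. h q (H q) (Y q)) - h q (D' X Y q) (H q)"
      by (simp add: cov_deriv_form_def differential_def XF[OF conn_in[OF D' X Y] q])
    also have "\<dots> = h q (D X H q) (Y q)"
      using h_conj[OF H Y X, of q] h_sym[OF vf_tangent[OF H] vf_tangent[OF conn_in[OF D' X Y]], of q]
      by simp
    also have "\<dots> = h q (X q) (Y q)"
      using M(3) X q by simp
    finally show ?thesis by simp
  qed
  then show "\<exists>U f. open U \<and> p \<in> U \<and> smooth_fun A U f \<and>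
      (\<forall>q\<in>U. \<forall>X\<in>vector_fields A. \<forall>Y\<in>vector_fields A.
        h q (X q) (Y q) = cov_deriv_form D' (differential f) X Y q)"
    using UM U M F_smooth by blast
qed

end

theorem proposition3p8:
  fixes A :: "('m::{t2_space, second_countable_topology}, 'e::{real_inner, heine_borel}) atlas"
    and D :: "'m covariant_derivative"
    and h :: "'m bilinear_field"
  assumes "hessian_manifold A D h"
    and "koszul_type A D h"
  shows "(hessian_manifold A (conjugate_connection A D h) h \<and>
          radiant A (conjugate_connection A D h)) \<and>
         (\<forall>\<eta>. one_form_potential A D h \<eta> \<longrightarrow>
            euler_field A (conjugate_connection A D h) (sharp A h \<eta>))"
proof -
  let ?D = "conjugate_connection A D h"
  have hess: "hessian_metric A D h" and aff: "affine_manifold A D"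
    using assms(1) by (simp_all add: hessian_manifold_def)
  have mfd: "smooth_manifold A" and D: "connection A D" and flat: "flat A D"
    and tf: "torsion_free A D" and conn: "connected (UNIV :: 'm set)"
    using aff by (simp_all add: affine_manifold_def)
  interpret riem_mfd A h
    by unfold_locales (use mfd hess in \<open>simp_all add: hessian_metric_def\<close>)
  interpret conj_mfd A h D ?D
    by unfold_locales (rule D, rule conjugate_connection_is_conjugate[OF D])
  obtain \<eta> where \<eta>: "one_form_potential A D h \<eta>"
    using assms(2) by (auto simp: koszul_type_def)
  have "torsion_free A ?D"
    by (rule flat_euler_torsion_free[OF D' conj_flat[OF flat] sharp_euler[OF \<eta>]])
  then have "hessian_manifold A ?D h"
    unfolding hessian_manifold_def affine_manifold_def
    using mfd conn D' conj_flat[OF flat] conj_hessian[OF flat tf hess] by simp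
  then show ?thesis
    using sharp_euler \<eta> by (auto simp: radiant_def)
qed

end
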